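(* Let $K$ be a scattered, locally compact Hausdorff space and let $X$ be a Banach space that does not contain a copy of $\ell^1$ or for which the unit ball of $X^*$ is weak$^*$ sequentially compact. Then for any non-compact operator $T:C_0(K)\to X$ and any $\varepsilon>0$, there exist operators $U\in\mathscr{B}(X,c_0)$ and $V\in\mathscr{B}(c_0,C_0(K))$ such that $$UTV=I_{c_0}\quad\text{and}\quad \|U\|\,\|V\|<\frac{2}{\|T\|_e}+\varepsilon.$$
   Context: All spaces are over a scalar field $\mathbb{K}$ which is either $\mathbb{R}$ or $\mathbb{C}$. $C_0(K)$ is the Banach space of continuous functions $f:K\to\mathbb{K}$ vanishing at infinity, with the supremum norm. "Operator" means bounded linear map; $\mathscr{B}(X,Y)$ and $\mathscr{K}(X,Y)$ denote the spaces of bounded and of compact operators from $X$ to $Y$. The essential norm of $T\in\mathscr{B}(X,Y)$ is $\|T\|_e=\inf\{\|T-S\|:S\in\mathscr{K}(X,Y)\}$. $I_{c_0}$ is the identity operator on $c_0$ (null scalar sequences with the supremum norm). "Contains a copy of $\ell^1$" means having a subspace linearly isomorphic to $\ell^1$. *)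

theory Defs
  imports "HOL-Analysis.Analysis"
begin

section \<open>The scalar field\<close>

text \<open>
  The types of this class are, up to isometric isomorphism of fields, exactly \<open>\<real>\<close> and \<open>\<complex>\<close>:
  \<open>h\<close> identifies the scalars with one of the two subfields \<open>\<real>\<close>, \<open>UNIV\<close> of the type \<^typ>\<open>complex\<close>.
\<close>

class real_or_complex = real_normed_field +
  assumes ex_real_or_complex_iso:
    "\<exists>h :: 'a \<Rightarrow> complex. (\<forall>a b. h (a + b) = h a + h b) \<and> (\<forall>a b. h (a * b) = h a * h b) \<and>
       (\<forall>a. cmod (h a) = norm a) \<and> (range h = \<real> \<or> range h = UNIV)"

instance real :: real_or_complex
  by standard (rule exI[of _ complex_of_real], auto simp: Reals_def)

instance complex :: real_or_complex
  by standard (rule exI[of _ "\<lambda>z. z"], auto)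


section \<open>Normed spaces over the scalar field\<close>

text \<open>
  A normed space over \<open>'k\<close> is a real normed space with a scalar multiplication by \<open>'k\<close> extending
  the real one; it is a Banach space over \<open>'k\<close> if moreover its type is in the class \<open>banach\<close>.
\<close>

locale normed_space = vector_space scale
  for scale :: "'k::real_or_complex \<Rightarrow> 'x::real_normed_vector \<Rightarrow> 'x" +
  assumes norm_scale: "norm (scale a x) = norm a * norm x"
    and scale_of_real: "scale (of_real r) x = r *\<^sub>R x"

lemma normed_space_scalars: "normed_space ((*) :: 'k::real_or_complex \<Rightarrow> 'k \<Rightarrow> 'k)"
  by standard (auto simp: algebra_simps norm_mult scaleR_conv_of_real)

text \<open>
  \<^typ>\<open>'x \<Rightarrow>\<^sub>L 'y\<close> consists of the bounded real-linear maps, with the operator norm;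
  linearity over the scalar field has to be imposed.
\<close>

definition operators ::
    "('k::real_or_complex \<Rightarrow> 'x::real_normed_vector \<Rightarrow> 'x) \<Rightarrow>
     ('k \<Rightarrow> 'y::real_normed_vector \<Rightarrow> 'y) \<Rightarrow> ('x \<Rightarrow>\<^sub>L 'y) set" where
  "operators s1 s2 = {T. Vector_Spaces.linear s1 s2 (blinfun_apply T)}"

definition compact_operators ::
    "('k::real_or_complex \<Rightarrow> 'x::real_normed_vector \<Rightarrow> 'x) \<Rightarrow>
     ('k \<Rightarrow> 'y::real_normed_vector \<Rightarrow> 'y) \<Rightarrow> ('x \<Rightarrow>\<^sub>L 'y) set" where
  "compact_operators s1 s2 =
     {T \<in> operators s1 s2. compact (closure (blinfun_apply T ` cball 0 1))}"

definition essential_norm ::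
    "('k::real_or_complex \<Rightarrow> 'x::real_normed_vector \<Rightarrow> 'x) \<Rightarrow>
     ('k \<Rightarrow> 'y::real_normed_vector \<Rightarrow> 'y) \<Rightarrow> ('x \<Rightarrow>\<^sub>L 'y) \<Rightarrow> real" where
  "essential_norm s1 s2 T = Inf {norm (T - S) |S. S \<in> compact_operators s1 s2}"

abbreviation dual ::
    "('k::real_or_complex \<Rightarrow> 'x::real_normed_vector \<Rightarrow> 'x) \<Rightarrow> ('x \<Rightarrow>\<^sub>L 'k) set" where
  "dual s \<equiv> operators s (*)"

text \<open>Weak-star convergence of a sequence of functionals is pointwise convergence.\<close>

definition dual_ball_weak_star_seq_compact ::
    "('k::real_or_complex \<Rightarrow> 'x::real_normed_vector \<Rightarrow> 'x) \<Rightarrow> bool" where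
  "dual_ball_weak_star_seq_compact s \<longleftrightarrow>
     (\<forall>\<phi> :: nat \<Rightarrow> 'x \<Rightarrow>\<^sub>L 'k. (\<forall>n. \<phi> n \<in> dual s \<inter> cball 0 1) \<longrightarrow>
        (\<exists>\<psi> \<in> dual s \<inter> cball 0 1. \<exists>r :: nat \<Rightarrow> nat. strict_mono r \<and>
           (\<forall>x. (\<lambda>n. blinfun_apply (\<phi> (r n)) x) \<longlonglongrightarrow> blinfun_apply \<psi> x)))"


section \<open>The space of continuous functions vanishing at infinity\<close>

definition vanishes_at_infinity :: "('p::topological_space \<Rightarrow>\<^sub>C 'k::real_normed_vector) \<Rightarrow> bool" where
  "vanishes_at_infinity f \<longleftrightarrow> (\<forall>e>0. compact {x. e \<le> norm (apply_bcontfun f x)})"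

lemma compact_le_norm_subset:
  fixes f :: "'p::topological_space \<Rightarrow>\<^sub>C 'k::real_normed_vector"
  assumes "compact K" "\<And>x. e \<le> norm (apply_bcontfun f x) \<Longrightarrow> x \<in> K"
  shows "compact {x. e \<le> norm (apply_bcontfun f x)}"
proof -
  have "closed {x. e \<le> norm (apply_bcontfun f x)}"
    by (intro closed_Collect_le continuous_intros) simp_all
  from compact_Int_closed[OF assms(1) this] show ?thesis
    using assms(2) by (metis Int_absorb1 mem_Collect_eq subsetI)
qed

lemma vanishing_add:
  fixes f g :: "'p::topological_space \<Rightarrow>\<^sub>C 'k::real_normed_vector"
  assumes "vanishes_at_infinity f"
    and "vanishes_at_infinity g"
  shows "vanishes_at_infinity (f + g)"
unfolding vanishes_at_infinity_def
proof (intro allI impI)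
  fix e :: real assume "e > 0"
  then have "compact ({x. e/2 \<le> norm (apply_bcontfun f x)} \<union> {x. e/2 \<le> norm (apply_bcontfun g x)})"
    using assms by (intro compact_Un) (simp_all only: vanishes_at_infinity_def half_gt_zero)
  then show "compact {x. e \<le> norm (apply_bcontfun (f + g) x)}"
  proof (rule compact_le_norm_subset)
    fix x assume "e \<le> norm (apply_bcontfun (f + g) x)"
    then show "x \<in> {x. e/2 \<le> norm (apply_bcontfun f x)} \<union> {x. e/2 \<le> norm (apply_bcontfun g x)}"
      using norm_triangle_ineq[of "apply_bcontfun f x" "apply_bcontfun g x"] by auto
  qed
qed

lemma vanishing_bounded_by:
  fixes f g :: "'p::topological_space \<Rightarrow>\<^sub>C 'k::real_normed_vector"
  assumes "vanishes_at_infinity f"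
    and "\<And>x. norm (apply_bcontfun g x) \<le> c * norm (apply_bcontfun f x)"
  shows "vanishes_at_infinity g"
unfolding vanishes_at_infinity_def
proof (intro allI impI)
  fix e :: real assume e: "e > 0"
  define d where "d = max c 1"
  have d: "d > 0" "norm (apply_bcontfun g x) \<le> d * norm (apply_bcontfun f x)" for x
    using assms(2)[of x] mult_right_mono[of c d "norm (apply_bcontfun f x)"] by (auto simp: d_def)
  have "compact {x. e / d \<le> norm (apply_bcontfun f x)}"
    using assms(1) e d(1) by (simp add: vanishes_at_infinity_def)
  then show "compact {x. e \<le> norm (apply_bcontfun g x)}"
  proof (rule compact_le_norm_subset)
    fix x assume "e \<le> norm (apply_bcontfun g x)"
    then show "x \<in> {x. e / d \<le> norm (apply_bcontfun f x)}"
      using d(1) d(2)[of x] by (simp add: divide_le_eq mult.commute)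
  qed
qed

lemma mult_bcontfun:
  fixes f :: "'p::topological_space \<Rightarrow> 'k::real_normed_algebra"
  assumes "f \<in> bcontfun"
  shows "(\<lambda>x. a * f x) \<in> bcontfun"
proof -
  from assms obtain B where f: "continuous_on UNIV f" "\<And>x. norm (f x) \<le> B"
    by (auto simp: bcontfun_def bounded_iff)
  show ?thesis
  proof (rule bcontfun_normI)
    show "continuous_on UNIV (\<lambda>x. a * f x)" by (intro continuous_intros f)
    show "norm (a * f x) \<le> norm a * B" for x
      by (rule order_trans[OF norm_mult_ineq]) (simp add: f mult_left_mono)
  qed
qed

definition bcontfun_scale ::
    "'k::real_normed_algebra \<Rightarrow> ('p::topological_space \<Rightarrow>\<^sub>C 'k) \<Rightarrow> ('p \<Rightarrow>\<^sub>C 'k)" where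
  "bcontfun_scale a f = Bcontfun (\<lambda>x. a * apply_bcontfun f x)"

lemma apply_bcontfun_scale [simp]: "apply_bcontfun (bcontfun_scale a f) x = a * apply_bcontfun f x"
  unfolding bcontfun_scale_def by (simp add: Bcontfun_inverse mult_bcontfun apply_bcontfun)

lemma vanishes_at_infinity_0: "vanishes_at_infinity 0"
  by (simp add: vanishes_at_infinity_def)

typedef (overloaded) ('p, 'k) C0 =
  "{f :: 'p::topological_space \<Rightarrow>\<^sub>C 'k::real_normed_vector. vanishes_at_infinity f}"
  morphisms bcontfun_of_C0 Abs_C0
  by (rule exI[of _ 0]) (simp add: vanishes_at_infinity_0)

setup_lifting type_definition_C0

instantiation C0 :: (topological_space, real_normed_vector) real_normed_vector
begin

lift_definition zero_C0 :: "('a, 'b) C0" is 0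
  by (rule vanishes_at_infinity_0)
lift_definition plus_C0 :: "('a, 'b) C0 \<Rightarrow> ('a, 'b) C0 \<Rightarrow> ('a, 'b) C0" is "(+)"
  by (rule vanishing_add)
lift_definition uminus_C0 :: "('a, 'b) C0 \<Rightarrow> ('a, 'b) C0" is uminus
  by (simp add: vanishes_at_infinity_def)
lift_definition minus_C0 :: "('a, 'b) C0 \<Rightarrow> ('a, 'b) C0 \<Rightarrow> ('a, 'b) C0" is "(-)"
  subgoal for f g using vanishing_add[of f "- g"] by (simp add: vanishes_at_infinity_def)
  done
lift_definition scaleR_C0 :: "real \<Rightarrow> ('a, 'b) C0 \<Rightarrow> ('a, 'b) C0" is "(*\<^sub>R)"
  subgoal for r f by (rule vanishing_bounded_by[of f _ "\<bar>r\<bar>"]) auto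
  done
lift_definition norm_C0 :: "('a, 'b) C0 \<Rightarrow> real" is norm .
lift_definition dist_C0 :: "('a, 'b) C0 \<Rightarrow> ('a, 'b) C0 \<Rightarrow> real" is dist .

definition sgn_C0 :: "('a, 'b) C0 \<Rightarrow> ('a, 'b) C0" where "sgn_C0 f = inverse (norm f) *\<^sub>R f"
definition uniformity_C0 :: "(('a, 'b) C0 \<times> ('a, 'b) C0) filter" where
  "uniformity_C0 = (INF e\<in>{0 <..}. principal {(x, y). dist x y < e})"
definition open_C0 :: "('a, 'b) C0 set \<Rightarrow> bool" where
  "open_C0 S = (\<forall>x\<in>S. \<forall>\<^sub>F (x', y) in uniformity. x' = x \<longrightarrow> y \<in> S)"

instance
  by standard
    ((transfer, simp add: algebra_simps dist_norm norm_triangle_ineq; fail) |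
      rule sgn_C0_def uniformity_C0_def open_C0_def)+

end

lift_definition C0_scale ::
    "'k::real_or_complex \<Rightarrow> ('p::topological_space, 'k) C0 \<Rightarrow> ('p, 'k) C0" is bcontfun_scale
  subgoal for a f by (rule vanishing_bounded_by[of f _ "norm a"]) (auto simp: norm_mult)
  done

lemma norm_bcontfun_scale: "norm (bcontfun_scale a f) = norm a * norm f"
  for a :: "'k::real_or_complex"
proof (rule antisym)
  show le: "norm (bcontfun_scale a f) \<le> norm a * norm f" for a :: 'k and f :: "'p::topological_space \<Rightarrow>\<^sub>C 'k"
    by (rule norm_bound) (simp add: norm_mult mult_left_mono norm_bounded)
  show "norm a * norm f \<le> norm (bcontfun_scale a f)"
  proof (cases "a = 0")
    case False
    have "bcontfun_scale (inverse a) (bcontfun_scale a f) = f"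
      using False by (intro bcontfun_eqI) simp
    with le[of "inverse a" "bcontfun_scale a f"] False show ?thesis
      by (simp add: norm_inverse norm_divide field_simps)
  qed simp
qed

lemma normed_space_C0:
  "normed_space (C0_scale :: 'k::real_or_complex \<Rightarrow> ('p::topological_space, 'k) C0 \<Rightarrow> ('p, 'k) C0)"
  by standard
    (transfer, (rule bcontfun_eqI)?, simp add: algebra_simps norm_bcontfun_scale scaleR_conv_of_real)+


section \<open>The sequence spaces\<close>

text \<open>Since \<^typ>\<open>nat\<close> is discrete, \<^typ>\<open>nat \<Rightarrow>\<^sub>C 'k\<close> is the space of bounded sequences.\<close>

typedef (overloaded) 'k c0 =
  "{f :: nat \<Rightarrow>\<^sub>C 'k::real_normed_vector. apply_bcontfun f \<longlonglongrightarrow> 0}"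
  morphisms bcontfun_of_c0 Abs_c0
  by (rule exI[of _ 0]) (simp add: zero_bcontfun.rep_eq)

setup_lifting type_definition_c0

instantiation c0 :: (real_normed_vector) real_normed_vector
begin

lift_definition zero_c0 :: "'a c0" is 0 by simp
lift_definition plus_c0 :: "'a c0 \<Rightarrow> 'a c0 \<Rightarrow> 'a c0" is "(+)"
  by (simp add: plus_bcontfun.rep_eq tendsto_add_zero)
lift_definition uminus_c0 :: "'a c0 \<Rightarrow> 'a c0" is uminus
  using tendsto_minus by fastforce
lift_definition minus_c0 :: "'a c0 \<Rightarrow> 'a c0 \<Rightarrow> 'a c0" is "(-)"
  using tendsto_diff by fastforce
lift_definition scaleR_c0 :: "real \<Rightarrow> 'a c0 \<Rightarrow> 'a c0" is "(*\<^sub>R)"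
  using tendsto_scaleR[OF tendsto_const] by fastforce
lift_definition norm_c0 :: "'a c0 \<Rightarrow> real" is norm .
lift_definition dist_c0 :: "'a c0 \<Rightarrow> 'a c0 \<Rightarrow> real" is dist .

definition sgn_c0 :: "'a c0 \<Rightarrow> 'a c0" where "sgn_c0 f = inverse (norm f) *\<^sub>R f"
definition uniformity_c0 :: "('a c0 \<times> 'a c0) filter" where
  "uniformity_c0 = (INF e\<in>{0 <..}. principal {(x, y). dist x y < e})"
definition open_c0 :: "'a c0 set \<Rightarrow> bool" where
  "open_c0 S = (\<forall>x\<in>S. \<forall>\<^sub>F (x', y) in uniformity. x' = x \<longrightarrow> y \<in> S)"

instance
  by standard
    ((transfer, simp add: algebra_simps dist_norm norm_triangle_ineq; fail) |
      rule sgn_c0_def uniformity_c0_def open_c0_def)+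

end

lift_definition c0_scale :: "'k::real_or_complex \<Rightarrow> 'k c0 \<Rightarrow> 'k c0" is bcontfun_scale
  subgoal for a f using tendsto_mult_right_zero[of "apply_bcontfun f" sequentially a]
    by (simp add: bcontfun_scale_def Bcontfun_inverse mult_bcontfun apply_bcontfun)
  done

lemma normed_space_c0: "normed_space (c0_scale :: 'k::real_or_complex \<Rightarrow> 'k c0 \<Rightarrow> 'k c0)"
  by standard
    (transfer, (rule bcontfun_eqI)?, simp add: algebra_simps norm_bcontfun_scale scaleR_conv_of_real)+

typedef (overloaded) 'k l1 =
  "{f :: nat \<Rightarrow> 'k::real_normed_vector. summable (\<lambda>n. norm (f n))}"
  morphisms l1_apply Abs_l1
  by (rule exI[of _ "\<lambda>_. 0"]) simp

setup_lifting type_definition_l1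

lemma summable_norm_plus:
  fixes f g :: "nat \<Rightarrow> 'k::real_normed_vector"
  assumes "summable (\<lambda>n. norm (f n))" "summable (\<lambda>n. norm (g n))"
  shows "summable (\<lambda>n. norm (f n + g n))"
  using summable_add[OF assms]
  by (rule summable_comparison_test_ev[rotated]) (simp add: norm_triangle_ineq)

instantiation l1 :: (real_normed_vector) real_normed_vector
begin

lift_definition zero_l1 :: "'a l1" is "\<lambda>_. 0" by simp
lift_definition plus_l1 :: "'a l1 \<Rightarrow> 'a l1 \<Rightarrow> 'a l1" is "\<lambda>f g n. f n + g n"
  by (rule summable_norm_plus)
lift_definition uminus_l1 :: "'a l1 \<Rightarrow> 'a l1" is "\<lambda>f n. - f n" by simp
lift_definition minus_l1 :: "'a l1 \<Rightarrow> 'a l1 \<Rightarrow> 'a l1" is "\<lambda>f g n. f n - g n"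
  subgoal for f g using summable_norm_plus[of f "\<lambda>n. - g n"] by simp
  done
lift_definition scaleR_l1 :: "real \<Rightarrow> 'a l1 \<Rightarrow> 'a l1" is "\<lambda>r f n. r *\<^sub>R f n"
  by (simp add: summable_mult)
lift_definition norm_l1 :: "'a l1 \<Rightarrow> real" is "\<lambda>f. \<Sum>n. norm (f n)" .

definition dist_l1 :: "'a l1 \<Rightarrow> 'a l1 \<Rightarrow> real" where "dist_l1 f g = norm (f - g)"
definition sgn_l1 :: "'a l1 \<Rightarrow> 'a l1" where "sgn_l1 f = inverse (norm f) *\<^sub>R f"
definition uniformity_l1 :: "('a l1 \<times> 'a l1) filter" where
  "uniformity_l1 = (INF e\<in>{0 <..}. principal {(x, y). dist x y < e})"
definition open_l1 :: "'a l1 set \<Rightarrow> bool" where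
  "open_l1 S = (\<forall>x\<in>S. \<forall>\<^sub>F (x', y) in uniformity. x' = x \<longrightarrow> y \<in> S)"

instance
proof
  fix f g :: "'a l1" and r :: real
  show "(norm f = 0) = (f = 0)"
    by transfer (auto simp: suminf_eq_zero_iff)
  show "norm (f + g) \<le> norm f + norm g"
    by transfer
      (auto simp: suminf_add intro!: suminf_le summable_norm_plus summable_add norm_triangle_ineq)
  show "norm (r *\<^sub>R f) = \<bar>r\<bar> * norm f"
    by transfer (simp add: suminf_mult)
qed ((transfer, simp add: algebra_simps fun_eq_iff; fail) |
      rule dist_l1_def sgn_l1_def uniformity_l1_def open_l1_def)+

end

lift_definition l1_scale :: "'k::real_or_complex \<Rightarrow> 'k l1 \<Rightarrow> 'k l1" is "\<lambda>a f n. a * f n"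
  by (simp add: norm_mult summable_mult)

lemma normed_space_l1: "normed_space (l1_scale :: 'k::real_or_complex \<Rightarrow> 'k l1 \<Rightarrow> 'k l1)"
  by standard
    (transfer, simp add: algebra_simps norm_mult suminf_mult scaleR_conv_of_real)+

definition contains_copy_of_l1 ::
    "('k::real_or_complex \<Rightarrow> 'x::real_normed_vector \<Rightarrow> 'x) \<Rightarrow> bool" where
  "contains_copy_of_l1 s \<longleftrightarrow>
     (\<exists>Y. module.subspace s Y \<and>
        (\<exists>(J :: 'k l1 \<Rightarrow> 'x) J'. Vector_Spaces.linear l1_scale s J \<and> homeomorphism UNIV Y J J'))"


section \<open>Scattered spaces\<close>

definition scattered :: "'p::topological_space set \<Rightarrow> bool" where
  "scattered S \<longleftrightarrow> (\<forall>A\<subseteq>S. A \<noteq> {} \<longrightarrow> (\<exists>x\<in>A. x isolated_in A))"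

end

theory Submission
  imports Defs
begin

text \<open>
  Let \<open>a > 0\<close> be the essential norm of \<open>T\<close>. The functionals \<open>\<psi> \<circ> T\<close>, for \<open>\<psi>\<close> in the unit ball of
  the dual of \<open>X\<close>, live on \<open>C\<^sub>0(K)\<close>, and since \<open>K\<close> is scattered each of them is carried by a
  finite set up to a small error (\<open>scattered_functional_finitely_carried\<close>); this is what is
  needed from the identification of the dual of \<open>C\<^sub>0(K)\<close> with \<open>\<ell>\<^sup>1(K)\<close>.

  For a finite set \<open>F \<subseteq> K\<close> take bumps \<open>k\<^sub>x\<close>, \<open>x \<in> F\<close>, with disjoint supports. The finite rank operator
  \<open>f \<mapsto> \<Sum>\<^sub>x f(x) \<cdot> T k\<^sub>x\<close> is at distance at least \<open>a\<close> from \<open>T\<close>, and \<open>f - \<Sum>\<^sub>x f(x) k\<^sub>x\<close> vanishes on \<open>F\<close> and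
  has norm at most \<open>2 \<parallel>f\<parallel>\<close>. Hence the unit ball contains functions that vanish on \<open>F\<close> and
  whose images have norm almost \<open>a / 2\<close> (\<open>essential_norm_vanishing_witness\<close>). Norming these images and
  enlarging \<open>F\<close> step by step gives functionals \<open>\<psi>\<^sub>n\<close> in the dual unit ball with humps of height about \<open>a / 2\<close>
  carried by disjoint finite sets, and a subsequence has humps \<open>g\<^sub>n\<close> with disjoint supports
  (\<open>disjointify\<close>). Then \<open>V\<^sub>0 x = \<Sum>\<^sub>n x\<^sub>n g\<^sub>n\<close> has norm at most \<open>1\<close> and \<open>\<psi>\<^sub>n (T (V\<^sub>0 x))\<close> is close to \<open>\<beta> x\<^sub>n\<close>,
  where \<open>\<beta>\<close> is as close to \<open>a / 2\<close> as desired (\<open>nearly_diagonal_operator\<close>).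

  The sequence \<open>\<psi>\<^sub>n\<close> need not be weak-star null. However, it has convex combinations
  \<open>\<phi>\<^sub>n\<close> over successive blocks of indices that converge pointwise: by weak-star sequential compactness, or, if \<open>X\<close> does
  not contain \<open>\<ell>\<^sup>1\<close>, by a theorem of Bourgain (\<open>no_l1_imp_Cauchy_tail_block\<close>). The differences
  \<open>\<phi>\<^bsub>2n\<^esub> - \<phi>\<^bsub>2n+1\<^esub>\<close> are weak-star null and have norm at most \<open>2\<close>. Summing the humps of the block \<open>2n\<close> and
  subtracting those of the block \<open>2n+1\<close> gives functions that are still of norm at most \<open>1\<close> with disjoint supports,
  and on them the differences take values about \<open>2 \<beta>\<close>, almost \<open>a\<close>. So passing to differences
  doubles the norm of the functionals and the height of the humps alike; this is why
  the constant is \<open>2 / a\<close>. A Neumann series turns the resulting approximate factorization into an exact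
  one (\<open>left_inverse_of_perturbation\<close>).
\<close>

section \<open>The scalar field and the completeness of \<open>c\<^sub>0\<close>\<close>

text \<open>
  A fixed embedding of the scalars as one of the two subfields of the complex numbers.
\<close>

definition embed :: "'k::real_or_complex \<Rightarrow> complex" where
  "embed = (SOME h. (\<forall>a b. h (a + b) = h a + h b) \<and> (\<forall>a b. h (a * b) = h a * h b) \<and>
       (\<forall>a. cmod (h a) = norm a) \<and> (range h = \<real> \<or> range h = UNIV))"

lemma
  shows embed_add: "embed (a + b) = embed a + embed (b :: 'k::real_or_complex)"
    and embed_mult: "embed (a * b) = embed a * embed b"
    and norm_embed: "cmod (embed a) = norm a"
    and range_embed: "range (embed :: 'k \<Rightarrow> complex) = \<real> \<or> range (embed :: 'k \<Rightarrow> complex) = UNIV"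
  using someI_ex[OF ex_real_or_complex_iso[where 'a = 'k]] unfolding embed_def by blast+

lemma embed_0 [simp]: "embed (0 :: 'k::real_or_complex) = 0"
  using norm_embed[of "0 :: 'k"] by simp

lemma embed_diff: "embed (a - b) = embed a - embed (b :: 'k::real_or_complex)"
  using embed_add[of "a - b" b] by simp

lemma embed_minus: "embed (- a) = - embed (a :: 'k::real_or_complex)"
  using embed_diff[of 0 a] by simp

lemma embed_1 [simp]: "embed (1 :: 'k::real_or_complex) = 1"
proof -
  have "embed (1 :: 'k) * embed (1 :: 'k) = embed (1 :: 'k)"
    using embed_mult[of "1 :: 'k" 1] by simp
  moreover have "embed (1 :: 'k) \<noteq> 0"
    using norm_embed[of "1 :: 'k"] by auto
  ultimately show ?thesis by simp
qed

text \<open>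
  The embedding is isometric and fixes \<open>1\<close>, and a complex number having the same distances from
  \<open>0\<close> and \<open>1\<close> as the real number \<open>r\<close> is equal to \<open>r\<close>.
\<close>

lemma embed_of_real [simp]: "embed (of_real r :: 'k::real_or_complex) = of_real r"
proof -
  define c where "c = embed (of_real r :: 'k)"
  have "cmod c = \<bar>r\<bar>" by (simp add: c_def norm_embed)
  moreover have "cmod (c - 1) = \<bar>r - 1\<bar>"
    using norm_embed[of "of_real r - 1 :: 'k"] norm_of_real[of "r - 1", where 'a = 'k]
    by (simp add: c_def embed_diff)
  ultimately have "(cmod c)\<^sup>2 = r\<^sup>2" "(cmod (c - 1))\<^sup>2 = (r - 1)\<^sup>2"
    by simp_all
  then have "(Re c)\<^sup>2 + (Im c)\<^sup>2 = r\<^sup>2" "(Re c - 1)\<^sup>2 + (Im c)\<^sup>2 = (r - 1)\<^sup>2"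
    by (simp_all only: cmod_power2 minus_complex.simps one_complex.simps diff_zero)
  moreover from this have "Re c = r"
    by (simp add: power2_eq_square algebra_simps)
  ultimately have "Re c = r" "Im c = 0"
    by simp_all
  then show ?thesis by (simp add: c_def complex_eq_iff)
qed

lemma embed_eq_iff [simp]: "embed a = embed b \<longleftrightarrow> a = (b :: 'k::real_or_complex)"
  using norm_embed[of "a - b"] by (auto simp: embed_diff)

text \<open>
  The real part of a scalar, taken along the embedding into the complex numbers.
\<close>

definition re :: "'k::real_or_complex \<Rightarrow> real" where "re a = Re (embed a)"

lemma re_add: "re (a + b) = re a + re b" and re_of_real [simp]: "re (of_real r) = r"
  and re_0 [simp]: "re 0 = 0"
  by (simp_all add: re_def embed_add)

lemma re_of_real_mult: "re (of_real r * a) = r * re a"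
  by (simp add: re_def embed_mult)

lemma re_sum: "re (\<Sum>i\<in>I. f i) = (\<Sum>i\<in>I. re (f i))"
  by (induction I rule: infinite_finite_induct) (auto simp: re_add)

lemma abs_re_le: "\<bar>re a\<bar> \<le> norm a"
  by (metis re_def abs_Re_le_cmod norm_embed)

lemma norm_diff_of_real_sq: "(norm (a - of_real r :: 'k::real_or_complex))\<^sup>2 = (norm a)\<^sup>2 - 2 * r * re a + r\<^sup>2"
proof -
  have "(cmod (embed a - of_real r))\<^sup>2 = (cmod (embed a))\<^sup>2 - 2 * r * Re (embed a) + r\<^sup>2"
    unfolding cmod_power2 by (simp add: power2_eq_square algebra_simps)
  then show ?thesis
    using norm_embed[of "a - of_real r"] by (simp add: embed_diff norm_embed re_def)
qed

lemma phase: obtains w :: "'k::real_or_complex" where "norm w = 1" "w * a = of_real (norm a)"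
proof (cases "a = 0")
  case True
  then show ?thesis using that[of 1] by simp
next
  case False
  then show ?thesis using that[of "of_real (norm a) / a"] by (simp add: norm_divide)
qed

lemma closed_range_embed: "closed (range (embed :: 'k::real_or_complex \<Rightarrow> complex))"
  using range_embed[where 'k='k] closed_complex_Reals by auto

instance real_or_complex \<subseteq> heine_borel
proof
  fix f :: "nat \<Rightarrow> 'a"
  assume "bounded (range f)"
  then obtain B where "\<And>n. norm (f n) \<le> B" by (auto simp: bounded_iff)
  then have "bounded (range (\<lambda>n. embed (f n)))" by (auto simp: bounded_iff norm_embed)
  then obtain l r where r: "strict_mono (r :: nat \<Rightarrow> nat)" "((\<lambda>n. embed (f n)) \<circ> r) \<longlonglongrightarrow> l"
    using bounded_imp_convergent_subsequence by blast
  have "l \<in> range (embed :: 'a \<Rightarrow> complex)"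
    using closed_sequentially[OF closed_range_embed _ r(2)] by auto
  then obtain a :: 'a where l: "l = embed a" by auto
  have "(\<lambda>n. cmod (embed (f (r n)) - embed a)) \<longlonglongrightarrow> 0"
    using r(2) unfolding l by (simp add: LIM_zero_iff o_def tendsto_norm_zero_iff)
  then have "(\<lambda>n. norm (f (r n) - a)) \<longlonglongrightarrow> 0"
    by (simp add: embed_diff[symmetric] norm_embed)
  then have "(f \<circ> r) \<longlonglongrightarrow> a"
    by (simp add: LIM_zero_iff o_def tendsto_norm_zero_iff)
  then show "\<exists>l r. strict_mono r \<and> (f \<circ> r) \<longlonglongrightarrow> l"
    using r(1) by blast
qed

instance real_or_complex \<subseteq> banach ..

text \<open>
  The terms of a null sequence, as an element of \<open>c\<^sub>0\<close>.
\<close>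

abbreviation c0_apply :: "'k::real_normed_vector c0 \<Rightarrow> nat \<Rightarrow> 'k" where
  "c0_apply x \<equiv> apply_bcontfun (bcontfun_of_c0 x)"

lemma c0_apply_tendsto: "c0_apply x \<longlonglongrightarrow> 0"
  using bcontfun_of_c0[of x] by simp

lemma norm_c0_apply_le: "norm (c0_apply x n) \<le> norm x"
  by (simp add: norm_c0.rep_eq norm_bounded)

lemma norm_c0_le: "(\<And>n. norm (c0_apply x n) \<le> B) \<Longrightarrow> norm x \<le> B"
  by (simp add: norm_c0.rep_eq norm_bound)

lemma c0_eqI: "(\<And>n. c0_apply x n = c0_apply y n) \<Longrightarrow> x = y"
  by (metis bcontfun_eqI bcontfun_of_c0_inject)

lemma c0_apply_add: "c0_apply (x + y) n = c0_apply x n + c0_apply y n"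
  and c0_apply_diff: "c0_apply (x - y) n = c0_apply x n - c0_apply y n"
  by (simp_all add: plus_c0.rep_eq minus_c0.rep_eq)

lemma c0_apply_scale: "c0_apply (c0_scale a x) n = a * c0_apply x n"
  by (simp add: c0_scale.rep_eq)

text \<open>
  The element of \<open>c\<^sub>0\<close> with given terms; meaningful only for sequences tending to \<open>0\<close>.
\<close>

definition c0_of :: "(nat \<Rightarrow> 'k::real_normed_vector) \<Rightarrow> 'k c0" where
  "c0_of f = Abs_c0 (Bcontfun f)"

lemma c0_apply_c0_of: 
  assumes "f \<longlonglongrightarrow> (0 :: 'k::real_normed_vector)"
  shows "c0_apply (c0_of f) n = f n"
proof -
  have "bounded (range f)"
    using assms convergent_imp_bounded by blast
  then have "f \<in> bcontfun"
    by (simp add: bcontfun_def)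
  then have "apply_bcontfun (Bcontfun f) = f" by (simp add: Bcontfun_inverse)
  then show ?thesis using assms by (simp add: c0_of_def Abs_c0_inverse)
qed

instance c0 :: (banach) banach
proof
  fix X :: "nat \<Rightarrow> 'a c0"
  assume X: "Cauchy X"
  have le: "norm (c0_apply (X m) k - c0_apply (X n) k) \<le> norm (X m - X n)" for m n k
    using norm_c0_apply_le[of "X m - X n" k] by (simp add: c0_apply_diff)
  have "Cauchy (\<lambda>n. c0_apply (X n) k)" for k
    using X le unfolding Cauchy_iff by (meson order_le_less_trans)
  then have "\<exists>l. (\<lambda>n. c0_apply (X n) k) \<longlonglongrightarrow> l" for k
    using Cauchy_convergent[of "\<lambda>n. c0_apply (X n) k"] unfolding convergent_def by blast
  then obtain f where f: "\<And>k. (\<lambda>n. c0_apply (X n) k) \<longlonglongrightarrow> f k" by metis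
  have unif: "\<exists>N. \<forall>n\<ge>N. \<forall>k. norm (c0_apply (X n) k - f k) \<le> e" if "e > 0" for e
  proof -
    obtain N where N: "\<And>m n. m \<ge> N \<Longrightarrow> n \<ge> N \<Longrightarrow> norm (X m - X n) < e"
      using X \<open>e > 0\<close> unfolding Cauchy_iff by blast
    have "norm (c0_apply (X n) k - f k) \<le> e" if "n \<ge> N" for n k
    proof (rule tendsto_upperbound)
      show "(\<lambda>m. norm (c0_apply (X n) k - c0_apply (X m) k)) \<longlonglongrightarrow> norm (c0_apply (X n) k - f k)"
        by (intro tendsto_intros f)
      show "\<forall>\<^sub>F m in sequentially. norm (c0_apply (X n) k - c0_apply (X m) k) \<le> e"
        using N[OF that] le by (intro eventually_sequentiallyI[of N]) (meson less_imp_le order_trans)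
    qed simp
    then show ?thesis by blast
  qed
  have f0: "f \<longlonglongrightarrow> 0"
  proof (rule LIMSEQ_I)
    fix e :: real assume "e > 0"
    then obtain n where n: "\<And>k. norm (c0_apply (X n) k - f k) \<le> e / 2"
      using unif[of "e / 2"] by auto
    obtain N where N: "\<And>k. k \<ge> N \<Longrightarrow> norm (c0_apply (X n) k) < e / 2"
      using LIMSEQ_D[OF c0_apply_tendsto, of "e / 2" "X n"] \<open>e > 0\<close> by auto
    have "norm (f k - 0) < e" if "k \<ge> N" for k
      using N[OF that] n[of k] norm_triangle_ineq4[of "c0_apply (X n) k" "c0_apply (X n) k - f k"] by simp
    then show "\<exists>no. \<forall>n\<ge>no. norm (f n - 0) < e" by blast
  qed
  have "X \<longlonglongrightarrow> c0_of f"
  proof (rule LIMSEQ_I)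
    fix e :: real assume "e > 0"
    then obtain N where "\<And>n k. n \<ge> N \<Longrightarrow> norm (c0_apply (X n) k - f k) \<le> e / 2"
      using unif[of "e / 2"] by auto
    then have "norm (X n - c0_of f) \<le> e / 2" if "n \<ge> N" for n
      using that by (intro norm_c0_le) (simp add: c0_apply_diff c0_apply_c0_of[OF f0])
    then show "\<exists>no. \<forall>n\<ge>no. norm (X n - c0_of f) < e"
      using \<open>e > 0\<close> by (intro exI[of _ N]) force
  qed
  then show "convergent X" by (rule convergentI)
qed


section \<open>Norming functionals\<close>

text \<open>
  Subadditivity and positive homogeneity; as the scaling inequality for the factor \<open>1 / c\<close> gives the converse one for
  \<open>c\<close>, an inequality suffices in the second condition.
\<close>

definition sublinear :: "('x::real_vector \<Rightarrow> real) \<Rightarrow> bool" where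
  "sublinear p \<longleftrightarrow> (\<forall>x y. p (x + y) \<le> p x + p y) \<and> (\<forall>c>0. \<forall>x. p (c *\<^sub>R x) \<le> c * p x)"

lemma sublinear_add: "sublinear p \<Longrightarrow> p (x + y) \<le> p x + p y"
  by (simp add: sublinear_def)

lemma sublinear_scaleR:
  assumes "sublinear p" "c > 0"
  shows "p (c *\<^sub>R x) = c * p x"
proof (rule antisym)
  show "p (c *\<^sub>R x) \<le> c * p x" using assms by (simp add: sublinear_def)
  have "p (inverse c *\<^sub>R (c *\<^sub>R x)) \<le> inverse c * p (c *\<^sub>R x)"
    using assms unfolding sublinear_def by (meson inverse_positive_iff_positive)
  then show "c * p x \<le> p (c *\<^sub>R x)" using assms(2) by (simp add: field_simps)
qed

lemma sublinear_0: "sublinear p \<Longrightarrow> p 0 = 0"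
  using sublinear_scaleR[of p 2 0] by simp

lemma sublinear_minus: "sublinear p \<Longrightarrow> - p (- x) \<le> p x"
  using sublinear_add[of p x "- x"] sublinear_0[of p] by simp

text \<open>
  For sublinear \<open>p\<close>, this is the largest sublinear functional \<open>q \<le> p\<close> with \<open>q (- y) \<le> - p y\<close>.
\<close>

definition ray_reduct :: "('x::real_vector \<Rightarrow> real) \<Rightarrow> 'x \<Rightarrow> 'x \<Rightarrow> real" where
  "ray_reduct p y x = Inf ((\<lambda>t. p (x + t *\<^sub>R y) - t * p y) ` {0..})"

lemma ray_reduct_lower:
  assumes "sublinear p" "t \<ge> 0"
  shows "- p (- x) \<le> p (x + t *\<^sub>R y) - t * p y"
proof -
  have "p (t *\<^sub>R y) = t * p y"
    using assms by (cases "t = 0") (auto simp: sublinear_0 sublinear_scaleR)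
  then show ?thesis
    using sublinear_add[OF assms(1), of "x + t *\<^sub>R y" "- x"] by simp
qed

lemma ray_reduct_le:
  assumes "sublinear p" "t \<ge> 0"
  shows "ray_reduct p y x \<le> p (x + t *\<^sub>R y) - t * p y"
  unfolding ray_reduct_def
proof (rule cInf_lower)
  show "bdd_below ((\<lambda>t. p (x + t *\<^sub>R y) - t * p y) ` {0..})"
    using ray_reduct_lower[OF assms(1)] by (intro bdd_belowI[of _ "- p (- x)"]) auto
qed (use assms in auto)

lemma ray_reduct_greatest:
  "(\<And>t. t \<ge> 0 \<Longrightarrow> b \<le> p (x + t *\<^sub>R y) - t * p y) \<Longrightarrow> b \<le> ray_reduct p y x"
  unfolding ray_reduct_def by (rule cInf_greatest) auto

lemma sublinear_ray_reduct:
  assumes p: "sublinear p"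
  shows "sublinear (ray_reduct p y)"
  unfolding sublinear_def
proof (intro conjI allI impI)
  fix x x' :: 'a
  have "ray_reduct p y (x + x') - (p (x' + t' *\<^sub>R y) - t' * p y) \<le> p (x + t *\<^sub>R y) - t * p y"
    if "t \<ge> 0" "t' \<ge> 0" for t t'
    using ray_reduct_le[OF p, of "t + t'" y "x + x'"] that
      sublinear_add[OF p, of "x + t *\<^sub>R y" "x' + t' *\<^sub>R y"]
    by (simp add: algebra_simps)
  then have "ray_reduct p y (x + x') - (p (x' + t' *\<^sub>R y) - t' * p y) \<le> ray_reduct p y x"
    if "t' \<ge> 0" for t' using that by (intro ray_reduct_greatest)
  then have "ray_reduct p y (x + x') - ray_reduct p y x \<le> p (x' + t' *\<^sub>R y) - t' * p y"
    if "t' \<ge> 0" for t' using that by (simp add: algebra_simps)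
  then have "ray_reduct p y (x + x') - ray_reduct p y x \<le> ray_reduct p y x'"
    by (intro ray_reduct_greatest)
  then show "ray_reduct p y (x + x') \<le> ray_reduct p y x + ray_reduct p y x'" by simp
next
  fix c :: real and x :: 'a
  assume c: "c > 0"
  have "ray_reduct p y (c *\<^sub>R x) / c \<le> p (x + t *\<^sub>R y) - t * p y" if "t \<ge> 0" for t
  proof -
    have "ray_reduct p y (c *\<^sub>R x) \<le> p (c *\<^sub>R (x + t *\<^sub>R y)) - (c * t) * p y"
      using ray_reduct_le[OF p, of "c * t" y "c *\<^sub>R x"] c that by (simp add: algebra_simps)
    also have "\<dots> = c * (p (x + t *\<^sub>R y) - t * p y)"
      by (simp only: sublinear_scaleR[OF p c]) (simp add: algebra_simps)
    finally show ?thesis using c by (simp add: field_simps)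
  qed
  then have "ray_reduct p y (c *\<^sub>R x) / c \<le> ray_reduct p y x"
    by (rule ray_reduct_greatest)
  then show "ray_reduct p y (c *\<^sub>R x) \<le> c * ray_reduct p y x"
    using c by (simp add: field_simps)
qed

text \<open>
  Zorn's lemma for the pointwise order: the infimum of a chain of sublinear functionals below \<open>p\<^sub>0\<close> is finite at
  \<open>x\<close>, because all of them are at least \<open>- p\<^sub>0 (- x)\<close> there, and it is sublinear.
\<close>

lemma minimal_sublinear:
  fixes p0 :: "'x::real_vector \<Rightarrow> real"
  assumes p0: "sublinear p0"
  obtains p where "sublinear p" "\<And>x. p x \<le> p0 x"
    "\<And>q. sublinear q \<Longrightarrow> (\<And>x. q x \<le> p x) \<Longrightarrow> q = p"
proof -
  define A where "A = {p. sublinear p \<and> (\<forall>x. p x \<le> p0 x)}"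
  define P where "P = (\<lambda>p q :: 'x \<Rightarrow> real. \<forall>x. q x \<le> p x)"
  have "\<exists>m\<in>A. \<forall>a\<in>A. P m a \<longrightarrow> a = m"
  proof (rule predicate_Zorn)
    show "partial_order_on A (relation_of P A)"
      by (rule partial_order_on_relation_ofI)
        (auto simp: P_def fun_eq_iff intro: order_trans antisym)
    fix C assume C: "C \<in> Chains (relation_of P A)"
    then have CA: "C \<subseteq> A" and tot: "\<And>p q. p \<in> C \<Longrightarrow> q \<in> C \<Longrightarrow> P p q \<or> P q p"
      by (auto simp: Chains_def relation_of_def)
    show "\<exists>u\<in>A. \<forall>a\<in>C. P a u"
    proof (cases "C = {}")
      case True
      then show ?thesis using p0 by (auto simp: A_def)
    next
      case False
      define u where "u = (\<lambda>x. INF p\<in>C. p x)"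
      have "- p0 (- x) \<le> p x" if "p \<in> C" for p x
      proof -
        have "sublinear p" "p (- x) \<le> p0 (- x)" using that CA by (auto simp: A_def)
        then show ?thesis using sublinear_minus[of p x] by linarith
      qed
      then have bdd: "bdd_below ((\<lambda>p. p x) ` C)" for x
        by (intro bdd_belowI[of _ "- p0 (- x)"]) auto
      have le: "u x \<le> p x" if "p \<in> C" for p x
        unfolding u_def using that bdd by (intro cINF_lower) auto
      have ge: "b \<le> u x" if "\<And>p. p \<in> C \<Longrightarrow> b \<le> p x" for b x
        unfolding u_def using that False by (intro cINF_greatest) auto
      have sub: "u (x + y) \<le> p x + q y" if pq: "p \<in> C" "q \<in> C" for p q x y
      proof -
        obtain r where r: "r \<in> C" "r x \<le> p x" "r y \<le> q y"
          using tot[OF pq] pq by (auto simp: P_def)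
        then show ?thesis
          using le[OF r(1), of "x + y"] sublinear_add[of r x y] CA by (auto simp: A_def)
      qed
      have "u (x + y) - q y \<le> u x" if "q \<in> C" for q x y
        using sub that by (intro ge) (simp add: diff_le_eq)
      then have "u (x + y) - u x \<le> u y" for x y
        by (intro ge) (simp add: diff_le_eq add.commute)
      moreover have "u (c *\<^sub>R x) \<le> c * u x" if c: "c > 0" for c x
      proof -
        have "u (c *\<^sub>R x) / c \<le> u x"
        proof (rule ge)
          fix p assume "p \<in> C"
          then show "u (c *\<^sub>R x) / c \<le> p x"
            using le[of p "c *\<^sub>R x"] CA sublinear_scaleR[of p c x] c by (auto simp: A_def field_simps)
        qed
        then show ?thesis using c by (simp add: field_simps)
      qed
      ultimately have "sublinear u"
        by (simp add: sublinear_def algebra_simps)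
      moreover have "u x \<le> p0 x" for x
      proof -
        obtain p where "p \<in> C" using False by blast
        then have "u x \<le> p x" "p x \<le> p0 x" using le CA by (auto simp: A_def)
        then show ?thesis by linarith
      qed
      ultimately have "u \<in> A" by (simp add: A_def)
      then show ?thesis using le by (auto simp: P_def)
    qed
  qed
  then obtain m where m: "m \<in> A" "\<And>a. a \<in> A \<Longrightarrow> P m a \<Longrightarrow> a = m" by blast
  show ?thesis
  proof
    fix q assume "sublinear q" "\<And>x. q x \<le> m x"
    then show "q = m"
      using m(1) by (intro m(2)) (auto simp: A_def P_def intro: order_trans)
  qed (use m in \<open>auto simp: A_def\<close>)
qed

text \<open>
  The Hahn-Banach theorem. A minimal sublinear functional \<open>p\<close> is linear, since \<open>ray_reduct p y = p\<close> for every \<open>y\<close>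
  forces \<open>p x + p y \<le> p (x + y)\<close>.
\<close>

theorem sublinear_ge_linear:
  fixes p0 :: "'x::real_vector \<Rightarrow> real"
  assumes "sublinear p0"
  obtains \<rho> where "linear \<rho>" "\<And>x. \<rho> x \<le> p0 x"
proof -
  obtain p where p: "sublinear p" "\<And>x. p x \<le> p0 x"
    and min: "\<And>q. sublinear q \<Longrightarrow> (\<And>x. q x \<le> p x) \<Longrightarrow> q = p"
    using minimal_sublinear[OF assms] by blast
  have add: "p (x + y) = p x + p y" for x y
  proof -
    have "ray_reduct p y = p"
      using ray_reduct_le[OF p(1), of 0 y] by (intro min sublinear_ray_reduct p(1)) simp
    then show ?thesis
      using ray_reduct_le[OF p(1), of 1 y x] sublinear_add[OF p(1), of x y] by simp
  qed
  have minus: "p (- x) = - p x" for x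
    using add[of x "- x"] sublinear_0[OF p(1)] by simp
  have "p (c *\<^sub>R x) = c * p x" for c x
  proof (cases c "0 :: real" rule: linorder_cases)
    case less
    then show ?thesis using sublinear_scaleR[OF p(1), of "- c" x] minus[of "(- c) *\<^sub>R x"] by simp
  qed (use sublinear_scaleR[OF p(1)] sublinear_0[OF p(1)] in auto)
  then have "linear p" using add by (intro linearI) auto
  then show ?thesis using p(2) that by blast
qed

theorem real_norming_functional:
  fixes y :: "'x::real_normed_vector"
  obtains \<rho> where "linear \<rho>" "\<And>x. \<rho> x \<le> norm x" "\<rho> y = norm y"
proof -
  have n: "sublinear (norm :: 'x \<Rightarrow> real)"
    by (auto simp: sublinear_def norm_triangle_ineq)
  obtain \<rho> where \<rho>: "linear \<rho>" "\<And>x. \<rho> x \<le> ray_reduct norm y x"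
    using sublinear_ge_linear[OF sublinear_ray_reduct[OF n]] by blast
  have le: "\<rho> x \<le> norm x" for x
    using \<rho>(2)[of x] ray_reduct_le[OF n, of 0 y x] by simp
  have "- \<rho> y \<le> - norm y"
    using \<rho>(2)[of "- y"] ray_reduct_le[OF n, of 1 y "- y"] linear_neg[OF \<rho>(1), of y] by simp
  then show ?thesis
    using that[OF \<rho>(1) le] le[of y] by simp
qed

lemma (in normed_space) operatorsI:
  fixes f :: "'x \<Rightarrow> 'y::real_normed_vector" and t :: "'k \<Rightarrow> 'y \<Rightarrow> 'y"
  assumes t: "normed_space t"
    and add: "\<And>x y. f (x + y) = f x + f y" and scale: "\<And>a x. f (scale a x) = t a (f x)"
    and bound: "\<And>x. norm (f x) \<le> B * norm x"
  obtains F where "F \<in> operators scale t" "blinfun_apply F = f"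
proof -
  have "f (r *\<^sub>R x) = r *\<^sub>R f x" for r x
    using scale[of "of_real r" x] by (simp add: scale_of_real normed_space.scale_of_real[OF t])
  then have "bounded_linear f"
    using bound add by (intro bounded_linear_intro[of f B]) (auto simp: mult.commute)
  then have F: "blinfun_apply (Blinfun f) = f" by (rule bounded_linear_Blinfun_apply)
  interpret t: normed_space t by (rule t)
  have "Vector_Spaces.linear scale t f"
    by unfold_locales (auto simp: add scale)
  then show ?thesis using that[of "Blinfun f"] F by (simp add: operators_def)
qed

lemma operators_scale: "F \<in> operators s t \<Longrightarrow> blinfun_apply F (s a x) = t a (blinfun_apply F x)"
  by (simp add: operators_def Vector_Spaces.linear_iff)

text \<open>
  Over the complex numbers, \<open>\<rho> x - \<i> \<rho> (\<i> x)\<close> is the complex-linear functional with real part \<open>\<rho>\<close>; over the reals, \<open>\<rho>\<close> itself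
  is linear over the scalars. The norms agree because scalars can be rotated onto the positive real axis.
\<close>

lemma (in normed_space) norming_functional:
  obtains \<psi> where "\<psi> \<in> dual scale" "norm \<psi> \<le> 1" "norm (blinfun_apply \<psi> y) = norm y"
proof -
  obtain \<rho> where \<rho>: "linear \<rho>" "\<And>x. \<rho> x \<le> norm x" "\<rho> y = norm y"
    using real_norming_functional[of y] by blast
  note lin = linear_add[OF \<rho>(1)] linear_scale[OF \<rho>(1)] linear_neg[OF \<rho>(1)]
  obtain f :: "'x \<Rightarrow> 'k" where add: "\<And>x z. f (x + z) = f x + f z"
    and sc: "\<And>a x. f (scale a x) = a * f x" and re: "\<And>x. re (f x) = \<rho> x"
  proof (cases "range (embed :: 'k \<Rightarrow> complex) = \<real>")
    case True
    have dec: "of_real (re a) = a" for a :: 'k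
    proof -
      have "embed a \<in> \<real>" using True by auto
      then have "embed (of_real (re a) :: 'k) = embed a" by (simp add: re_def)
      then show ?thesis by (simp only: embed_eq_iff)
    qed
    have "of_real (\<rho> (scale a x)) = a * of_real (\<rho> x)" for a :: 'k and x
    proof -
      have "\<rho> (scale (of_real (re a)) x) = re a * \<rho> x"
        by (simp only: scale_of_real lin real_scaleR_def)
      then have "of_real (\<rho> (scale a x)) = of_real (re a) * (of_real (\<rho> x) :: 'k)"
        by (simp only: dec of_real_mult)
      then show ?thesis by (simp only: dec)
    qed
    then show ?thesis
      by (intro that[of "\<lambda>x. of_real (\<rho> x)"]) (simp_all only: lin of_real_add re_of_real)
  next
    case False
    then have "\<i> \<in> range (embed :: 'k \<Rightarrow> complex)" using range_embed[where 'k = 'k] by auto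
    then obtain \<iota> :: 'k where "\<i> = embed \<iota>" by (rule imageE)
    then have \<iota>: "embed \<iota> = \<i>" by simp
    have \<iota>2: "\<iota> * \<iota> = - 1"
      by (rule embed_eq_iff[THEN iffD1]) (simp add: embed_mult embed_minus \<iota>)
    define im :: "'k \<Rightarrow> real" where "im = (\<lambda>a. Im (embed a))"
    have dec: "a = of_real (re a) + \<iota> * of_real (im a)" for a :: 'k
      by (rule embed_eq_iff[THEN iffD1]) (simp add: embed_mult embed_add \<iota> re_def im_def complex_eq_iff)
    define f where "f = (\<lambda>x. of_real (\<rho> x) - \<iota> * of_real (\<rho> (scale \<iota> x)))"
    have f\<iota>: "f (scale \<iota> x) = \<iota> * f x" for x
    proof -
      have "scale \<iota> (scale \<iota> x) = - x" by (simp add: \<iota>2)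
      moreover have "\<iota> * (\<iota> * z) = - z" for z by (simp add: \<iota>2 flip: mult.assoc)
      ultimately show ?thesis by (simp only: f_def lin right_diff_distrib) simp
    qed
    have fadd: "f (x + z) = f x + f z" for x z
      by (simp add: f_def lin scale_right_distrib algebra_simps)
    have fr: "f (scale (of_real r) x) = of_real r * f x" for r x
    proof -
      have "scale \<iota> (scale (of_real r) x) = r *\<^sub>R scale \<iota> x"
        by (simp add: mult.commute flip: scale_of_real)
      then show ?thesis by (simp add: f_def scale_of_real lin algebra_simps)
    qed
    have "f (scale a x) = a * f x" for a x
    proof -
      have "f (scale a x) = f (scale (of_real (re a)) x + scale \<iota> (scale (of_real (im a)) x))"
        by (subst dec[of a]) (simp only: scale_left_distrib scale_scale)
      also have "\<dots> = (of_real (re a) + \<iota> * of_real (im a)) * f x"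
        by (simp only: fadd f\<iota> fr algebra_simps)
      finally show ?thesis using dec[of a] by simp
    qed
    moreover have "re (f x) = \<rho> x" for x
      by (simp add: f_def re_def embed_diff embed_mult \<iota>)
    ultimately show ?thesis using that fadd by blast
  qed
  have le: "norm (f x) \<le> 1 * norm x" for x
  proof -
    obtain w where w: "norm w = 1" "w * f x = of_real (norm (f x))" by (rule phase)
    have "norm (f x) = \<rho> (scale w x)" using w(2) by (simp flip: re add: sc)
    also have "\<dots> \<le> norm x" using \<rho>(2)[of "scale w x"] w(1) by (simp add: norm_scale)
    finally show ?thesis by simp
  qed
  obtain \<psi> where \<psi>: "\<psi> \<in> dual scale" "blinfun_apply \<psi> = f"
    using operatorsI[OF normed_space_scalars add sc le] by blast
  show ?thesis
  proof
    show "norm \<psi> \<le> 1" by (rule norm_blinfun_bound) (use le in \<open>auto simp: \<psi>\<close>)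
    show "norm (blinfun_apply \<psi> y) = norm y"
      using le[of y] abs_re_le[of "f y"] by (simp add: \<psi> re \<rho>(3))
  qed (rule \<psi>)
qed


section \<open>Convex block sequences and their oscillation\<close>

text \<open>
  \<open>tail_block \<xi> \<psi>\<close>: far enough out, the terms of \<open>\<xi>\<close> are convex combinations of terms of \<open>\<psi>\<close> with arbitrarily large
  indices. In contrast to convex block subsequences, successive combinations may overlap; this makes
  the relation transitive and stable under averaging, and disjoint blocks can be selected
  afterwards.
\<close>

definition tail_block :: "(nat \<Rightarrow> 'a::real_vector) \<Rightarrow> (nat \<Rightarrow> 'a) \<Rightarrow> bool" where
  "tail_block \<xi> \<psi> \<longleftrightarrow> (\<forall>N. \<exists>M. \<forall>n\<ge>M. \<xi> n \<in> convex hull (\<psi> ` {N..}))"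

lemma tail_blockD:
  assumes "tail_block \<xi> \<psi>"
  obtains M where "\<And>n. n \<ge> M \<Longrightarrow> \<xi> n \<in> convex hull (\<psi> ` {N..})"
proof -
  have "\<exists>M. \<forall>n\<ge>M. \<xi> n \<in> convex hull (\<psi> ` {N..})" using assms by (simp add: tail_block_def)
  then obtain M where "\<forall>n\<ge>M. \<xi> n \<in> convex hull (\<psi> ` {N..})" ..
  then show thesis by (intro that[of M]) simp
qed

lemma tail_block_refl: "tail_block \<xi> \<xi>"
  unfolding tail_block_def
proof (intro allI exI impI)
  fix N n :: nat assume "n \<ge> N"
  then show "\<xi> n \<in> convex hull (\<xi> ` {N..})" by (intro hull_inc) auto
qed

lemma tail_block_trans:
  assumes "tail_block \<xi> \<psi>" "tail_block \<psi> \<phi>"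
  shows "tail_block \<xi> \<phi>"
  unfolding tail_block_def
proof (intro allI)
  fix N
  obtain M where M: "\<And>n. n \<ge> M \<Longrightarrow> \<psi> n \<in> convex hull (\<phi> ` {N..})"
    using tail_blockD[OF assms(2), of N] by blast
  then have hull: "convex hull (\<psi> ` {M..}) \<subseteq> convex hull (\<phi> ` {N..})"
    by (intro hull_minimal) auto
  obtain L where "\<And>n. n \<ge> L \<Longrightarrow> \<xi> n \<in> convex hull (\<psi> ` {M..})"
    using tail_blockD[OF assms(1), of M] by blast
  then show "\<exists>M. \<forall>n\<ge>M. \<xi> n \<in> convex hull (\<phi> ` {N..})"
    using hull by blast
qed

lemma tail_block_reindex:
  assumes "tail_block \<xi> \<psi>" "\<And>k. k \<le> r k"
  shows "tail_block (\<lambda>k. \<xi> (r k)) \<psi>"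
  using assms unfolding tail_block_def by (meson order_trans)

lemma tail_block_average:
  assumes I: "finite I" "I \<noteq> {}" and X: "\<And>i. i \<in> I \<Longrightarrow> tail_block (X i) \<psi>"
  shows "tail_block (\<lambda>n. \<Sum>i\<in>I. (1 / card I) *\<^sub>R X i n) \<psi>"
  unfolding tail_block_def
proof (intro allI)
  fix N
  have "\<forall>i\<in>I. \<exists>M. \<forall>n\<ge>M. X i n \<in> convex hull (\<psi> ` {N..})"
    using X unfolding tail_block_def by blast
  then obtain M where M: "\<And>i n. i \<in> I \<Longrightarrow> n \<ge> M i \<Longrightarrow> X i n \<in> convex hull (\<psi> ` {N..})"
    by metis
  have "(\<Sum>i\<in>I. (1 / card I) *\<^sub>R X i n) \<in> convex hull (\<psi> ` {N..})" if "n \<ge> Max (M ` I)" for n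
    using that I M by (intro convex_sum) auto
  then show "\<exists>M. \<forall>n\<ge>M. (\<Sum>i\<in>I. (1 / card I) *\<^sub>R X i n) \<in> convex hull (\<psi> ` {N..})" by blast
qed

text \<open>
  The \<open>k\<close>-th term is taken from the \<open>k\<close>-th sequence, far enough out to be a convex combination of terms with indices
  \<open>\<ge> k\<close> of all the previous sequences.
\<close>

lemma tail_block_diagonal:
  assumes X: "\<And>k. tail_block (X (Suc k)) (X k)"
  obtains \<xi> where "\<And>k. tail_block \<xi> (X k)" "range \<xi> \<subseteq> (\<Union>k. range (X k))"
proof -
  have mono: "tail_block (X k) (X j)" if "j \<le> k" for j k
    using that by (induction rule: dec_induct) (auto intro: tail_block_refl tail_block_trans X)
  have "\<exists>n. \<forall>j\<le>k. X k n \<in> convex hull (X j ` {k..})" for k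
  proof -
    have "\<forall>j\<in>{..k}. \<exists>M. \<forall>n\<ge>M. X k n \<in> convex hull (X j ` {k..})"
      using mono unfolding tail_block_def by blast
    then obtain M where M: "\<And>j n. j \<le> k \<Longrightarrow> n \<ge> M j \<Longrightarrow> X k n \<in> convex hull (X j ` {k..})"
      by (metis atMost_iff)
    then have "\<forall>j\<le>k. X k (Max (M ` {..k})) \<in> convex hull (X j ` {k..})" by auto
    then show ?thesis by blast
  qed
  then obtain n where n: "\<And>j k. j \<le> k \<Longrightarrow> X k (n k) \<in> convex hull (X j ` {k..})" by metis
  define \<xi> where "\<xi> = (\<lambda>k. X k (n k))"
  have tails: "\<exists>M. \<forall>k\<ge>M. \<xi> k \<in> convex hull (X j ` {N..})" for j N
  proof (intro exI allI impI)
    fix k assume "k \<ge> max j N"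
    then have "convex hull (X j ` {k..}) \<subseteq> convex hull (X j ` {N..})" "j \<le> k"
      by (auto intro!: hull_mono)
    then show "\<xi> k \<in> convex hull (X j ` {N..})" using n[of j k] by (auto simp: \<xi>_def)
  qed
  show ?thesis
  proof
    show "tail_block \<xi> (X k)" for k
      unfolding tail_block_def using tails[of k] by blast
    show "range \<xi> \<subseteq> (\<Union>k. range (X k))" by (auto simp: \<xi>_def)
  qed
qed

text \<open>
  \<open>osc_le \<xi> d\<close>: at every point of the unit ball, any two values of \<open>\<xi>\<close> far enough out differ by at most \<open>d\<close>, up to
  an arbitrarily small error.
\<close>

definition osc_le :: "(nat \<Rightarrow> 'x::real_normed_vector \<Rightarrow>\<^sub>L 'k::real_normed_vector) \<Rightarrow> real \<Rightarrow> bool" where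
  "osc_le \<xi> d \<longleftrightarrow> (\<forall>x. norm x \<le> 1 \<longrightarrow> (\<forall>e>0. \<exists>N. \<forall>m\<ge>N. \<forall>n\<ge>N.
     norm (blinfun_apply (\<xi> m) x - blinfun_apply (\<xi> n) x) \<le> d + e))"

text \<open>
  The oscillation of a sequence of functionals: the infimum of the bounds as above. A sequence in the unit ball of
  oscillation \<open>0\<close> is pointwise Cauchy.
\<close>

definition osc :: "(nat \<Rightarrow> 'x::real_normed_vector \<Rightarrow>\<^sub>L 'k::real_normed_vector) \<Rightarrow> real" where
  "osc \<xi> = Inf {d. 0 \<le> d \<and> osc_le \<xi> d}"

lemma convex_hull_blinfun_dist_le:
  assumes "u \<in> convex hull S" "\<And>v. v \<in> S \<Longrightarrow> norm (blinfun_apply v x - c) \<le> r"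
  shows "norm (blinfun_apply u x - c) \<le> r"
proof -
  have "linear (\<lambda>u :: 'a \<Rightarrow>\<^sub>L 'b. blinfun_apply u x)"
    by (simp add: linear_iff blinfun.add_left blinfun.scaleR_left)
  then have "convex ((\<lambda>u :: 'a \<Rightarrow>\<^sub>L 'b. blinfun_apply u x) -` cball c r)"
    by (rule convex_linear_vimage) simp
  then have "convex hull S \<subseteq> (\<lambda>u :: 'a \<Rightarrow>\<^sub>L 'b. blinfun_apply u x) -` cball c r"
    using assms(2) by (intro hull_minimal) (auto simp: dist_norm norm_minus_commute)
  then show ?thesis using assms(1) by (auto simp: dist_norm norm_minus_commute)
qed

lemma osc_le_two_tail_blocks:
  assumes "tail_block \<xi> \<psi>" "tail_block \<zeta> \<psi>" "osc_le \<psi> d" and x: "norm x \<le> 1" and e: "e > 0"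
  shows "\<exists>N. \<forall>m\<ge>N. \<forall>n\<ge>N. norm (blinfun_apply (\<xi> m) x - blinfun_apply (\<zeta> n) x) \<le> d + e"
proof -
  obtain N where N: "\<And>m n. m \<ge> N \<Longrightarrow> n \<ge> N \<Longrightarrow>
      norm (blinfun_apply (\<psi> m) x - blinfun_apply (\<psi> n) x) \<le> d + e"
    using assms(3) x e unfolding osc_le_def by meson
  have 1: "norm (blinfun_apply u x - blinfun_apply (\<psi> n) x) \<le> d + e"
    if "u \<in> convex hull (\<psi> ` {N..})" "n \<ge> N" for u n
    using that(1) by (rule convex_hull_blinfun_dist_le) (use N that(2) in auto)
  have 2: "norm (blinfun_apply v x - blinfun_apply u x) \<le> d + e"
    if "u \<in> convex hull (\<psi> ` {N..})" "v \<in> convex hull (\<psi> ` {N..})" for u v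
    using that(2) by (rule convex_hull_blinfun_dist_le) (use 1[OF that(1)] in \<open>auto simp: norm_minus_commute\<close>)
  obtain M where M: "\<And>n. n \<ge> M \<Longrightarrow> \<xi> n \<in> convex hull (\<psi> ` {N..})"
    using tail_blockD[OF assms(1), of N] by metis
  obtain M' where M': "\<And>n. n \<ge> M' \<Longrightarrow> \<zeta> n \<in> convex hull (\<psi> ` {N..})"
    using tail_blockD[OF assms(2), of N] by metis
  show ?thesis
    by (rule exI[of _ "max M M'"]) (auto intro!: 2 M M')
qed

lemma osc_le_tail_block: "tail_block \<xi> \<psi> \<Longrightarrow> osc_le \<psi> d \<Longrightarrow> osc_le \<xi> d"
  using osc_le_two_tail_blocks[of \<xi> \<psi> \<xi>] unfolding osc_le_def by simp

lemma osc_le_unit_ball: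
  assumes "range \<xi> \<subseteq> cball 0 1"
  shows "osc_le \<xi> 2"
  unfolding osc_le_def
proof (intro allI impI exI)
  fix x :: 'a and e :: real and m n assume x: "norm x \<le> 1" and "e > 0"
  have 1: "norm (blinfun_apply (\<xi> k) x) \<le> 1" for k
  proof -
    have "norm (\<xi> k) \<le> 1" using assms by (auto simp: image_subset_iff)
    then show ?thesis
      using norm_blinfun[of "\<xi> k" x] mult_mono[of "norm (\<xi> k)" 1 "norm x" 1] x by simp
  qed
  show "norm (blinfun_apply (\<xi> m) x - blinfun_apply (\<xi> n) x) \<le> 2 + e"
    using norm_triangle_ineq4[of "blinfun_apply (\<xi> m) x" "blinfun_apply (\<xi> n) x"] 1[of m] 1[of n] \<open>e > 0\<close>
    by linarith
qed

lemma bdd_below_osc: "bdd_below {d. 0 \<le> d \<and> osc_le \<xi> d}"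
  by (rule bdd_belowI[of _ 0]) simp

lemma osc_least: "0 \<le> d \<Longrightarrow> osc_le \<xi> d \<Longrightarrow> osc \<xi> \<le> d"
  unfolding osc_def by (rule cInf_lower) (auto simp: bdd_below_osc)

lemma osc_nonneg: "osc_le \<xi> d \<Longrightarrow> 0 \<le> d \<Longrightarrow> 0 \<le> osc \<xi>"
  unfolding osc_def by (rule cInf_greatest) auto

lemma osc_le_osc:
  assumes "osc_le \<xi> d" "0 \<le> d"
  shows "osc_le \<xi> (osc \<xi>)"
  unfolding osc_le_def
proof (intro allI impI)
  fix x :: 'a and e :: real assume x: "norm x \<le> 1" and e: "e > 0"
  obtain d' where d': "osc_le \<xi> d'" "d' < osc \<xi> + e / 2"
    using cInf_lessD[of "{d. 0 \<le> d \<and> osc_le \<xi> d}" "osc \<xi> + e / 2"] assms e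
    by (auto simp: osc_def)
  then obtain N where "\<forall>m\<ge>N. \<forall>n\<ge>N.
     norm (blinfun_apply (\<xi> m) x - blinfun_apply (\<xi> n) x) \<le> d' + e / 2"
    using x e unfolding osc_le_def by (meson half_gt_zero)
  then show "\<exists>N. \<forall>m\<ge>N. \<forall>n\<ge>N. norm (blinfun_apply (\<xi> m) x - blinfun_apply (\<xi> n) x) \<le> osc \<xi> + e"
    using d'(2) by (intro exI[of _ N]) force
qed

lemma osc_tail_block_le:
  assumes "tail_block \<xi> \<psi>" "range \<psi> \<subseteq> cball 0 1"
  shows "osc \<xi> \<le> osc \<psi>"
  using osc_le_unit_ball[OF assms(2)] 
  by (intro osc_least osc_nonneg osc_le_tail_block[OF assms(1)] osc_le_osc) auto

text \<open>
  Passing to tail blocks can only decrease the oscillation. After infinitely many steps, each of which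
  almost attains the infimum of what is still possible, a diagonal sequence has an oscillation that no further step in
  \<open>D\<close> changes.
\<close>

lemma osc_stable_tail_block:
  assumes D: "range \<psi> \<subseteq> D" "D \<subseteq> cball 0 1"
  obtains \<xi> where "tail_block \<xi> \<psi>" "range \<xi> \<subseteq> D"
    "\<And>\<phi>. tail_block \<phi> \<xi> \<Longrightarrow> range \<phi> \<subseteq> D \<Longrightarrow> osc \<phi> = osc \<xi>"
proof -
  have nonneg: "0 \<le> osc \<phi>" if "range \<phi> \<subseteq> D" for \<phi> :: "nat \<Rightarrow> 'a \<Rightarrow>\<^sub>L 'b"
    using osc_nonneg[OF osc_le_unit_ball] order_trans[OF that D(2)] by simp
  have mono: "osc \<phi> \<le> osc \<phi>'" if "tail_block \<phi> \<phi>'" "range \<phi>' \<subseteq> D" for \<phi> \<phi>' :: "nat \<Rightarrow> 'a \<Rightarrow>\<^sub>L 'b"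
    using osc_tail_block_le[OF that(1) order_trans[OF that(2) D(2)]] .
  define Q where "Q = (\<lambda>(n::nat) X Y. tail_block Y X \<and>
        (\<forall>\<phi>. tail_block \<phi> X \<longrightarrow> range \<phi> \<subseteq> D \<longrightarrow> osc Y \<le> osc \<phi> + 1 / Suc n))"
  have step: "\<exists>Y. range Y \<subseteq> D \<and> Q n X Y" if "range X \<subseteq> D" for X n
  proof -
    define S where "S = {osc \<phi> |\<phi>. tail_block \<phi> X \<and> range \<phi> \<subseteq> D}"
    have bdd: "bdd_below S" using nonneg by (intro bdd_belowI[of _ 0]) (auto simp: S_def)
    have "S \<noteq> {}" using tail_block_refl[of X] that by (auto simp: S_def)
    then obtain s where "s \<in> S" "s < Inf S + 1 / Suc n"
      using cInf_lessD[of S "Inf S + 1 / Suc n"] by auto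
    then obtain Y where Y: "tail_block Y X" "range Y \<subseteq> D" "osc Y < Inf S + 1 / Suc n"
      by (auto simp: S_def)
    have "osc Y \<le> osc \<phi> + 1 / Suc n" if "tail_block \<phi> X" "range \<phi> \<subseteq> D" for \<phi>
    proof -
      have "osc \<phi> \<in> S" using that by (auto simp: S_def)
      then show ?thesis using cInf_lower[OF _ bdd, of "osc \<phi>"] Y(3) by linarith
    qed
    then show ?thesis unfolding Q_def using Y(1,2) by (intro exI[of _ Y]) simp
  qed
  have "\<exists>X. \<forall>n. (range (X n) \<subseteq> D \<and> (n = 0 \<longrightarrow> X n = \<psi>)) \<and> Q n (X n) (X (Suc n))"
  proof (rule dependent_nat_choice)
    show "\<exists>X. range X \<subseteq> D \<and> ((0 :: nat) = 0 \<longrightarrow> X = \<psi>)" using D(1) by simp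
    show "\<exists>Y. (range Y \<subseteq> D \<and> (Suc n = 0 \<longrightarrow> Y = \<psi>)) \<and> Q n X Y"
      if "range X \<subseteq> D \<and> (n = 0 \<longrightarrow> X = \<psi>)" for X n
      using step[of X n] that by simp
  qed
  then obtain X where X: "\<forall>n. (range (X n) \<subseteq> D \<and> (n = 0 \<longrightarrow> X n = \<psi>)) \<and> Q n (X n) (X (Suc n))" ..
  have X0: "X 0 = \<psi>" and XD: "range (X n) \<subseteq> D" and XS: "tail_block (X (Suc n)) (X n)" for n
    using X by (simp_all add: Q_def)
  have Xosc: "osc (X (Suc n)) \<le> osc \<phi> + 1 / Suc n" if "tail_block \<phi> (X n)" "range \<phi> \<subseteq> D" for n \<phi>
    using X that by (simp add: Q_def)
  obtain \<xi> where \<xi>: "\<And>k. tail_block \<xi> (X k)" "range \<xi> \<subseteq> (\<Union>k. range (X k))"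
    by (rule tail_block_diagonal[of X, OF XS]) (rule that)
  have \<xi>D: "range \<xi> \<subseteq> D" using \<xi>(2) XD by fast
  show ?thesis
  proof
    show "tail_block \<xi> \<psi>" using \<xi>(1)[of 0] X0 by simp
    show "range \<xi> \<subseteq> D" by (fact \<xi>D)
    fix \<phi> assume \<phi>: "tail_block \<phi> \<xi>" "range \<phi> \<subseteq> D"
    have "osc \<xi> \<le> osc \<phi> + 1 / Suc n" for n
      using mono[OF \<xi>(1)[of "Suc n"] XD] Xosc[OF tail_block_trans[OF \<phi>(1) \<xi>(1)] \<phi>(2), of n]
      by linarith
    then have "osc \<xi> \<le> osc \<phi> + e" if e: "e > 0" for e
    proof -
      obtain n where "inverse (real (Suc n)) < e" using reals_Archimedean[OF e] ..
      with \<open>osc \<xi> \<le> osc \<phi> + 1 / Suc n\<close> show ?thesis unfolding inverse_eq_divide by linarith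
    qed
    then have "osc \<xi> \<le> osc \<phi>" by (rule field_le_epsilon)
    then show "osc \<phi> = osc \<xi>" using mono[OF \<phi>(1) \<xi>D] by simp
  qed
qed

lemma finite_family_convergent_subsequence:
  fixes u :: "'i \<Rightarrow> nat \<Rightarrow> 'k::heine_borel"
  assumes "finite I" "\<And>i. i \<in> I \<Longrightarrow> bounded (range (u i))"
  obtains r l where "strict_mono (r :: nat \<Rightarrow> nat)" "\<And>i. i \<in> I \<Longrightarrow> (\<lambda>n. u i (r n)) \<longlonglongrightarrow> l i"
  using assms
proof (induction I arbitrary: thesis rule: finite_induct)
  case empty
  then show ?case using strict_mono_id by blast
next
  case (insert i I)
  obtain r l where r: "strict_mono (r :: nat \<Rightarrow> nat)" "\<And>j. j \<in> I \<Longrightarrow> (\<lambda>n. u j (r n)) \<longlonglongrightarrow> l j"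
    using insert.IH insert.prems(2) by blast
  have "bounded (range (\<lambda>n. u i (r n)))"
    by (rule bounded_subset[OF insert.prems(2)[of i]]) auto
  then obtain a q where q: "strict_mono (q :: nat \<Rightarrow> nat)" "((\<lambda>n. u i (r n)) \<circ> q) \<longlonglongrightarrow> a"
    using bounded_imp_convergent_subsequence by blast
  show ?case
  proof (rule insert.prems(1))
    show "strict_mono (r \<circ> q)" using r(1) q(1) by (rule strict_mono_o)
    fix j assume "j \<in> insert i I"
    then show "(\<lambda>n. u j ((r \<circ> q) n)) \<longlonglongrightarrow> (l(i := a)) j"
      using q(2) LIMSEQ_subseq_LIMSEQ[OF r(2)[of j] q(1)] insert.hyps(2) by (auto simp: o_def)
  qed
qed

text \<open>
  Scalars of modulus at most \<open>\<delta>\<close> whose average is almost \<open>\<delta>\<close> are all close to \<open>\<delta>\<close>.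
\<close>

lemma close_to_bound_of_average:
  fixes y :: "'i \<Rightarrow> 'k::real_or_complex" and \<delta> \<kappa> :: real
  assumes J: "finite J" "j \<in> J" and y: "\<And>i. i \<in> J \<Longrightarrow> norm (y i) \<le> \<delta>"
    and avg: "card J * (\<delta> - \<kappa>) \<le> re (\<Sum>i\<in>J. y i)" and \<delta>: "\<delta> \<ge> 0"
  shows "(norm (y j - of_real \<delta>))\<^sup>2 \<le> 2 * \<delta> * (card J * \<kappa>)"
proof -
  have "re (y i) \<le> \<delta>" if "i \<in> J" for i
    using y[OF that] abs_re_le[of "y i"] by linarith
  then have "(\<Sum>i\<in>J - {j}. re (y i)) \<le> (\<Sum>i\<in>J - {j}. \<delta>)"
    by (intro sum_mono) auto
  then have "(\<Sum>i\<in>J - {j}. re (y i)) \<le> (real (card J) - 1) * \<delta>"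
    using card.remove[OF J] by simp
  moreover have "(\<Sum>i\<in>J. re (y i)) = re (y j) + (\<Sum>i\<in>J - {j}. re (y i))"
    using J by (rule sum.remove)
  ultimately have "\<delta> - card J * \<kappa> \<le> re (y j)"
    using avg by (simp add: re_sum algebra_simps)
  then have "\<delta> * (\<delta> - card J * \<kappa>) \<le> \<delta> * re (y j)"
    using \<delta> by (rule mult_left_mono)
  moreover have "(norm (y j))\<^sup>2 \<le> \<delta>\<^sup>2" using y[OF J(2)] by (intro power_mono) auto
  ultimately show ?thesis
    unfolding norm_diff_of_real_sq by (simp add: power2_eq_square algebra_simps)
qed


section \<open>Weak-star convergent convex blocks\<close>

lemma (in normed_space) convex_dual_ball: "convex (dual scale \<inter> cball 0 1)"
proof (rule convex_Int)
  interpret k: normed_space "(*) :: 'k \<Rightarrow> 'k \<Rightarrow> 'k" by (rule normed_space_scalars)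
  show "convex (dual scale)"
  proof (rule convexI)
    fix \<phi> \<psi> and u v :: real assume "\<phi> \<in> dual scale" "\<psi> \<in> dual scale"
    then show "u *\<^sub>R \<phi> + v *\<^sub>R \<psi> \<in> dual scale"
      by (simp add: operators_def Vector_Spaces.linear_iff blinfun.add_left blinfun.scaleR_left
          scaleR_conv_of_real algebra_simps)
  qed
qed simp

text \<open>
  Let \<open>\<xi>\<close> have a stable oscillation \<open>\<delta> > 0\<close>. Then one vector \<open>x\<close> splits finitely many tail blocks of \<open>\<xi>\<close> at the same
  time, and at a common level: along two subsequences of indices, the values at \<open>x\<close> of any two members of the
  family differ by nearly \<open>\<delta>\<close>. By stability, the average of the family still oscillates by \<open>\<delta>\<close>, while all limits of
  values involved are at distance at most \<open>\<delta>\<close> from each other. So an average of scalars of modulus at most \<open>\<delta>\<close> has modulus almost \<open>\<delta>\<close>,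
  which forces all of them to be nearly equal, and after a rotation of \<open>x\<close> nearly equal to \<open>\<delta>\<close>.
\<close>

lemma (in normed_space) separate_family:
  fixes \<xi> :: "nat \<Rightarrow> 'x \<Rightarrow>\<^sub>L 'k" and X :: "'i \<Rightarrow> nat \<Rightarrow> 'x \<Rightarrow>\<^sub>L 'k"
  assumes D: "range \<xi> \<subseteq> dual scale \<inter> cball 0 1"
    and stable: "\<And>\<phi>. tail_block \<phi> \<xi> \<Longrightarrow> range \<phi> \<subseteq> dual scale \<inter> cball 0 1 \<Longrightarrow> osc \<phi> = osc \<xi>"
    and pos: "osc \<xi> > 0"
    and I: "finite I" "I \<noteq> {}"
    and X: "\<And>i. i \<in> I \<Longrightarrow> tail_block (X i) \<xi>"
    and XD: "\<And>i. i \<in> I \<Longrightarrow> range (X i) \<subseteq> dual scale \<inter> cball 0 1"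
    and \<eta>: "\<eta> > 0"
  obtains x r s where "norm x \<le> 1" "\<And>k. k \<le> r k" "\<And>k. k \<le> s k"
    "\<And>i j m n. i \<in> I \<Longrightarrow> j \<in> I \<Longrightarrow>
      norm (blinfun_apply (X i (r m)) x - blinfun_apply (X j (s n)) x - of_real (osc \<xi>)) \<le> \<eta>"
proof -
  define \<delta> where "\<delta> = osc \<xi>"
  define L where "L = real (card I)"
  have L: "L \<ge> 1" using I by (auto simp: L_def Suc_le_eq card_gt_0_iff)
  define \<kappa> where "\<kappa> = min \<delta> (\<eta>\<^sup>2 / (32 * \<delta> * L\<^sup>2))"
  have \<delta>: "\<delta> > 0" using pos by (simp add: \<delta>_def)
  have \<kappa>: "\<kappa> > 0" "\<kappa> \<le> \<delta>" using \<delta> \<eta> L by (auto simp: \<kappa>_def)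
  have "2 * \<delta> * (L\<^sup>2 * \<kappa>) \<le> 2 * \<delta> * (L\<^sup>2 * (\<eta>\<^sup>2 / (32 * \<delta> * L\<^sup>2)))"
    using \<delta> by (intro mult_left_mono) (auto simp: \<kappa>_def)
  also have "\<dots> = (\<eta> / 4)\<^sup>2" using \<delta> L by (simp add: field_simps power2_eq_square)
  finally have \<kappa>2: "2 * \<delta> * (L\<^sup>2 * \<kappa>) \<le> (\<eta> / 4)\<^sup>2" .
  have osc_le: "osc_le \<xi> \<delta>"
    unfolding \<delta>_def by (rule osc_le_osc[OF osc_le_unit_ball]) (use D in auto)

  \<comment> \<open>By stability, the averaged sequence still oscillates by almost \<open>\<delta>\<close> at some \<open>x\<close>.\<close>
  define A where "A = (\<lambda>n. \<Sum>i\<in>I. (1 / real (card I)) *\<^sub>R X i n)"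
  have "range A \<subseteq> dual scale \<inter> cball 0 1"
  proof (rule image_subsetI)
    fix n show "A n \<in> dual scale \<inter> cball 0 1"
      unfolding A_def
    proof (rule convex_sum[OF I(1) convex_dual_ball])
      show "X i n \<in> dual scale \<inter> cball 0 1" if "i \<in> I" for i
        using XD[OF that] by (rule range_subsetD)
    qed (use I in auto)
  qed
  then have "osc A = \<delta>"
    unfolding \<delta>_def A_def by (intro stable tail_block_average I X)
  then have "\<not> osc_le A (\<delta> - \<kappa>)" using osc_least[of "\<delta> - \<kappa>" A] \<kappa> by auto
  then obtain x e where x: "norm x \<le> 1" "e > 0"
    "\<And>N. \<exists>m\<ge>N. \<exists>n\<ge>N. norm (blinfun_apply (A m) x - blinfun_apply (A n) x) > \<delta> - \<kappa> + e"
    unfolding osc_le_def by (auto simp: not_le)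
  then obtain m n where mn: "\<And>k. k \<le> m k" "\<And>k. k \<le> n k"
    "\<And>k. norm (blinfun_apply (A (m k)) x - blinfun_apply (A (n k)) x) > \<delta> - \<kappa> + e" by metis
  have bound: "norm (blinfun_apply (X i k) x) \<le> 1" if "i \<in> I" for i k
  proof -
    have "norm (X i k) \<le> 1" using range_subsetD[OF XD[OF that], of k] by simp
    then show ?thesis
      using norm_blinfun[of "X i k" x] mult_mono[of "norm (X i k)" 1 "norm x" 1] x(1) by simp
  qed
  obtain q l where q: "strict_mono (q :: nat \<Rightarrow> nat)"
    "\<And>c. c \<in> I \<times> {m, n} \<Longrightarrow> (\<lambda>k. blinfun_apply (X (fst c) (snd c (q k))) x) \<longlonglongrightarrow> l c"
  proof (rule finite_family_convergent_subsequence)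
    show "finite (I \<times> {m, n})" using I by simp
    show "bounded (range (\<lambda>k. blinfun_apply (X (fst c) (snd c k)) x))" if "c \<in> I \<times> {m, n}" for c
      using bound[of "fst c"] that unfolding bounded_iff by (intro exI[of _ 1]) auto
  qed (rule that)
  define a b where "a = (\<lambda>i. l (i, m))" and "b = (\<lambda>i. l (i, n))"
  have a: "(\<lambda>k. blinfun_apply (X i (m (q k))) x) \<longlonglongrightarrow> a i" if "i \<in> I" for i
    using q(2)[of "(i, m)"] that by (simp add: a_def)
  have b: "(\<lambda>k. blinfun_apply (X i (n (q k))) x) \<longlonglongrightarrow> b i" if "i \<in> I" for i
    using q(2)[of "(i, n)"] that by (simp add: b_def)
  have qk: "k \<le> q k" for k using q(1) by (rule seq_suble)

  have ab: "norm (a i - b j) \<le> \<delta>" if ij: "i \<in> I" "j \<in> I" for i j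
  proof (rule field_le_epsilon)
    fix e' :: real assume "e' > 0"
    then obtain N where N: "\<forall>k\<ge>N. \<forall>k'\<ge>N. norm (blinfun_apply (X i k) x - blinfun_apply (X j k') x) \<le> \<delta> + e'"
      using osc_le_two_tail_blocks[OF X X osc_le x(1), of i j e'] ij by blast
    show "norm (a i - b j) \<le> \<delta> + e'"
    proof (rule tendsto_upperbound)
      show "(\<lambda>k. norm (blinfun_apply (X i (m (q k))) x - blinfun_apply (X j (n (q k))) x)) \<longlonglongrightarrow> norm (a i - b j)"
        by (intro tendsto_intros a b ij)
      show "\<forall>\<^sub>F k in sequentially. norm (blinfun_apply (X i (m (q k))) x - blinfun_apply (X j (n (q k))) x) \<le> \<delta> + e'"
        using N mn(1,2) qk by (intro eventually_sequentiallyI[of N]) (meson order_trans)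
    qed simp
  qed
  define z where "z = (\<Sum>i\<in>I. a i) - (\<Sum>i\<in>I. b i)"
  have "\<delta> - \<kappa> \<le> norm ((1 / L) *\<^sub>R z)"
  proof (rule tendsto_lowerbound)
    have "(\<lambda>k. \<Sum>i\<in>I. (1 / L) *\<^sub>R blinfun_apply (X i (m (q k))) x) \<longlonglongrightarrow> (\<Sum>i\<in>I. (1 / L) *\<^sub>R a i)"
      "(\<lambda>k. \<Sum>i\<in>I. (1 / L) *\<^sub>R blinfun_apply (X i (n (q k))) x) \<longlonglongrightarrow> (\<Sum>i\<in>I. (1 / L) *\<^sub>R b i)"
      by (intro tendsto_intros a b; simp)+
    then have "(\<lambda>k. norm ((\<Sum>i\<in>I. (1 / L) *\<^sub>R blinfun_apply (X i (m (q k))) x) -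
        (\<Sum>i\<in>I. (1 / L) *\<^sub>R blinfun_apply (X i (n (q k))) x)))
      \<longlonglongrightarrow> norm ((\<Sum>i\<in>I. (1 / L) *\<^sub>R a i) - (\<Sum>i\<in>I. (1 / L) *\<^sub>R b i))"
      by (rule tendsto_norm[OF tendsto_diff])
    then show "(\<lambda>k. norm (blinfun_apply (A (m (q k))) x - blinfun_apply (A (n (q k))) x))
      \<longlonglongrightarrow> norm ((1 / L) *\<^sub>R z)"
      by (simp add: A_def z_def blinfun.sum_left blinfun.scaleR_left L_def scaleR_right.sum
          scaleR_right_diff_distrib)
    show "\<forall>\<^sub>F k in sequentially. \<delta> - \<kappa> \<le> norm (blinfun_apply (A (m (q k))) x - blinfun_apply (A (n (q k))) x)"
      using mn(3) x(2) by (intro always_eventually allI) (smt (verit))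
  qed simp
  then have z: "L * (\<delta> - \<kappa>) \<le> norm z" using L by (simp add: field_simps)
  obtain w where w: "norm w = 1" "w * (of_real L * z) = of_real (norm (of_real L * z))"
    by (rule phase)
  define y where "y = (\<lambda>(i, j). w * (a i - b j))"
  have yclose: "norm (y (i, j) - of_real \<delta>) \<le> \<eta> / 4" if ij: "i \<in> I" "j \<in> I" for i j
  proof -
    have "(\<Sum>c\<in>I \<times> I. y c) = (\<Sum>i\<in>I. \<Sum>j\<in>I. w * (a i - b j))"
      by (simp add: sum.cartesian_product y_def)
    also have "\<dots> = w * (of_real L * z)"
      by (simp add: z_def L_def sum_subtractf sum_distrib_left sum_distrib_right right_diff_distrib ac_simps)
    finally have "re (\<Sum>c\<in>I \<times> I. y c) = norm (of_real L * z)"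
      by (simp only: w(2) re_of_real)
    then have "re (\<Sum>c\<in>I \<times> I. y c) = L * norm z"
      using L by (simp add: norm_mult)
    moreover have "L * (L * (\<delta> - \<kappa>)) \<le> L * norm z" using z L by (intro mult_left_mono) auto
    ultimately have "(norm (y (i, j) - of_real \<delta>))\<^sup>2 \<le> 2 * \<delta> * (real (card (I \<times> I)) * \<kappa>)"
      using I ij ab \<delta> w(1)
      by (intro close_to_bound_of_average)
        (auto simp: y_def norm_mult card_cartesian_product L_def mult.assoc)
    also have "\<dots> \<le> (\<eta> / 4)\<^sup>2" using \<kappa>2 by (simp add: card_cartesian_product L_def power2_eq_square)
    finally show ?thesis by (rule power2_le_imp_le) (use \<eta> in simp)
  qed
  have "\<forall>\<^sub>F k in sequentially. \<forall>i\<in>I. norm (blinfun_apply (X i (m (q k))) x - a i) < \<eta> / 4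
      \<and> norm (blinfun_apply (X i (n (q k))) x - b i) < \<eta> / 4"
    using \<eta> by (intro eventually_ball_finite I ballI eventually_conj)
      (use tendstoD[OF a, of _ "\<eta> / 4"] tendstoD[OF b, of _ "\<eta> / 4"] in \<open>auto simp: dist_norm\<close>)
  then obtain K where K: "\<And>k i. k \<ge> K \<Longrightarrow> i \<in> I \<Longrightarrow> norm (blinfun_apply (X i (m (q k))) x - a i) < \<eta> / 4"
    "\<And>k i. k \<ge> K \<Longrightarrow> i \<in> I \<Longrightarrow> norm (blinfun_apply (X i (n (q k))) x - b i) < \<eta> / 4"
    unfolding eventually_sequentially by auto
  show ?thesis
  proof (rule that)
    show "norm (scale w x) \<le> 1" using x(1) w(1) by (simp add: norm_scale)
    show "k \<le> m (q (k + K))" "k \<le> n (q (k + K))" for k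
      using mn qk[of "k + K"] by (meson add_leD1 order_trans)+
    fix i j k k' assume ij: "i \<in> I" "j \<in> I"
    define p p' where "p = blinfun_apply (X i (m (q (k + K)))) x - a i"
      and "p' = blinfun_apply (X j (n (q (k' + K)))) x - b j"
    have "X i (m (q (k + K))) \<in> dual scale" "X j (n (q (k' + K))) \<in> dual scale"
      using XD ij by blast+
    then have "blinfun_apply (X i (m (q (k + K)))) (scale w x) - blinfun_apply (X j (n (q (k' + K)))) (scale w x)
        - of_real (osc \<xi>) = w * p - w * p' + (y (i, j) - of_real \<delta>)"
      by (simp add: operators_scale p_def p'_def y_def \<delta>_def algebra_simps)
    also have "norm \<dots> \<le> norm (w * p) + norm (w * p') + norm (y (i, j) - of_real \<delta>)"
      by (rule order_trans[OF norm_triangle_ineq]) (simp add: norm_triangle_ineq4)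
    also have "\<dots> \<le> \<eta>"
      using K(1)[of "k + K" i] K(2)[of "k' + K" j] ij yclose[OF ij] w(1) \<eta>
      by (simp add: norm_mult p_def p'_def)
    finally show "norm (blinfun_apply (X i (m (q (k + K)))) (scale w x) -
      blinfun_apply (X j (n (q (k' + K)))) (scale w x) - of_real (osc \<xi>)) \<le> \<eta>" .
  qed
qed

text \<open>
  Iterated splitting produces a dyadic tree of sequences: at level \<open>k\<close> they are indexed by the subsets of \<open>{..<k}\<close>,
  and the vector \<open>x k\<close> separates the sequences whose index contains \<open>k\<close> from the others. A set \<open>S\<close> and its complement in
  \<open>{..<m}\<close> then give two functionals whose difference takes values close to \<open>\<plusminus> osc \<xi>\<close> on the first \<open>m\<close> vectors, with
  signs prescribed by \<open>S\<close>.
\<close>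

lemma (in normed_space) independent_vectors:
  fixes \<xi> :: "nat \<Rightarrow> 'x \<Rightarrow>\<^sub>L 'k"
  assumes D: "range \<xi> \<subseteq> dual scale \<inter> cball 0 1"
    and stable: "\<And>\<phi>. tail_block \<phi> \<xi> \<Longrightarrow> range \<phi> \<subseteq> dual scale \<inter> cball 0 1 \<Longrightarrow> osc \<phi> = osc \<xi>"
    and pos: "osc \<xi> > 0"
  obtains x :: "nat \<Rightarrow> 'x" where "\<And>k. norm (x k) \<le> 1"
    "\<And>m S. S \<subseteq> {..<m} \<Longrightarrow> \<exists>\<phi>\<in>dual scale \<inter> cball 0 1. \<exists>\<psi>\<in>dual scale \<inter> cball 0 1. \<forall>k<m.
       norm (blinfun_apply \<phi> (x k) - blinfun_apply \<psi> (x k) -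
         of_real (if k \<in> S then osc \<xi> else - osc \<xi>)) \<le> osc \<xi> / 4"
proof -
  let ?D = "dual scale \<inter> cball 0 1"
  define P where "P = (\<lambda>k (X, x :: 'x). \<forall>S\<subseteq>{..<k::nat}. tail_block (X S) \<xi> \<and> range (X S) \<subseteq> ?D)"
  define Q where "Q = (\<lambda>k (X :: nat set \<Rightarrow> nat \<Rightarrow> 'x \<Rightarrow>\<^sub>L 'k, x :: 'x) (X' :: nat set \<Rightarrow> nat \<Rightarrow> 'x \<Rightarrow>\<^sub>L 'k, x' :: 'x). norm x' \<le> 1 \<and>
     (\<forall>S\<subseteq>{..<Suc k}. range (X' S) \<subseteq> range (X (S - {k}))) \<and>
     (\<forall>S\<subseteq>{..<Suc k}. \<forall>S'\<subseteq>{..<Suc k}. k \<in> S \<longrightarrow> k \<notin> S' \<longrightarrow> (\<forall>m n.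
        norm (blinfun_apply (X' S m) x' - blinfun_apply (X' S' n) x' - of_real (osc \<xi>)) \<le> osc \<xi> / 4)))"
  have "\<exists>st. \<forall>k. P k (st k) \<and> Q k (st k) (st (Suc k))"
  proof (rule dependent_nat_choice)
    show "\<exists>st. P 0 st"
      using D tail_block_refl by (intro exI[of _ "(\<lambda>S. \<xi>, 0)"]) (simp add: P_def)
    fix st k assume "P k st"
    moreover obtain X x where st: "st = (X, x)" by (cases st)
    ultimately have X: "\<And>S. S \<subseteq> {..<k} \<Longrightarrow> tail_block (X S) \<xi>" "\<And>S. S \<subseteq> {..<k} \<Longrightarrow> range (X S) \<subseteq> ?D"
      by (auto simp: P_def)
    obtain x' r s where x': "norm x' \<le> 1" and rs: "\<And>k. k \<le> r k" "\<And>k. k \<le> s k"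
      and sep: "\<And>S S' m n. S \<in> Pow {..<k} \<Longrightarrow> S' \<in> Pow {..<k} \<Longrightarrow>
        norm (blinfun_apply (X S (r m)) x' - blinfun_apply (X S' (s n)) x' - of_real (osc \<xi>)) \<le> osc \<xi> / 4"
    proof (rule separate_family[OF D stable pos, of "Pow {..<k}" X "osc \<xi> / 4"])
      show "Pow {..<k} \<noteq> {}" by blast
    qed (use X pos in auto)
    define X' where "X' = (\<lambda>S n. if k \<in> S then X (S - {k}) (r n) else X (S - {k}) (s n))"
    have sub: "S - {k} \<subseteq> {..<k}" if "S \<subseteq> {..<Suc k}" for S
      using that by (auto simp: less_Suc_eq)
    have "tail_block (X' S) \<xi>" if "S \<subseteq> {..<Suc k}" for S
      using tail_block_reindex[of "X (S - {k})" \<xi> r] tail_block_reindex[of "X (S - {k})" \<xi> s] rs X(1)[OF sub[OF that]]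
      by (cases "k \<in> S") (simp_all add: X'_def)
    moreover have ran: "range (X' S) \<subseteq> range (X (S - {k}))" for S
      by (auto simp: X'_def)
    ultimately have "P (Suc k) (X', x')"
      unfolding P_def prod.case using order_trans[OF ran X(2)[OF sub]] by simp
    moreover have "Q k st (X', x')"
      unfolding Q_def st prod.case
    proof (intro conjI allI impI)
      fix S S' m n assume "S \<subseteq> {..<Suc k}" "S' \<subseteq> {..<Suc k}" "k \<in> S" "k \<notin> S'"
      then show "norm (blinfun_apply (X' S m) x' - blinfun_apply (X' S' n) x' - of_real (osc \<xi>)) \<le> osc \<xi> / 4"
        using sep[of "S - {k}" "S' - {k}" m n] sub[of S] sub[of S'] by (simp add: X'_def)
    qed (use x' ran in auto)
    ultimately show "\<exists>st'. P (Suc k) st' \<and> Q k st st'" by blast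
  qed
  then obtain st where st: "\<And>k. P k (st k)" "\<And>k. Q k (st k) (st (Suc k))" by blast
  define X where "X = (\<lambda>k. fst (st k))"
  define x where "x = (\<lambda>k. snd (st (Suc k)))"
  have stX: "st k = (X k, snd (st k))" for k by (simp add: X_def)
  have XD: "range (X k S) \<subseteq> ?D" if "S \<subseteq> {..<k}" for k S
    using st(1)[of k] that by (subst (asm) stX) (simp add: P_def)
  have x1: "norm (x k) \<le> 1"
    and Xran: "S \<subseteq> {..<Suc k} \<Longrightarrow> range (X (Suc k) S) \<subseteq> range (X k (S - {k}))"
    and Xsep: "S \<subseteq> {..<Suc k} \<Longrightarrow> S' \<subseteq> {..<Suc k} \<Longrightarrow> k \<in> S \<Longrightarrow> k \<notin> S' \<Longrightarrow>
      norm (blinfun_apply (X (Suc k) S m) (x k) - blinfun_apply (X (Suc k) S' n) (x k) - of_real (osc \<xi>)) \<le> osc \<xi> / 4"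
    for k S S' m n
    using st(2)[of k] by (auto simp: Q_def X_def x_def split_beta)
  have ran: "range (X m S) \<subseteq> range (X k (S \<inter> {..<k}))" if "k \<le> m" "S \<subseteq> {..<m}" for k m S
    using that
  proof (induction m arbitrary: S rule: dec_induct)
    case base
    then have "S \<inter> {..<k} = S" by auto
    then show ?case by simp
  next
    case (step m)
    have "S - {m} \<subseteq> {..<m}" using step.prems by (auto simp: less_Suc_eq)
    moreover have "(S - {m}) \<inter> {..<k} = S \<inter> {..<k}" using step.hyps by auto
    ultimately show ?case using Xran[OF step.prems] step.IH[of "S - {m}"] by simp
  qed
  show ?thesis
  proof (rule that)
    show "norm (x k) \<le> 1" for k by (fact x1)
    fix m :: nat and S assume S: "S \<subseteq> {..<m}"
    define \<phi> \<psi> where "\<phi> = X m S 0" and "\<psi> = X m ({..<m} - S) 0"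
    have "\<phi> \<in> ?D" "\<psi> \<in> ?D"
      using XD[of S m] XD[of "{..<m} - S" m] S unfolding \<phi>_def \<psi>_def by blast+
    moreover have "norm (blinfun_apply \<phi> (x k) - blinfun_apply \<psi> (x k) -
         of_real (if k \<in> S then osc \<xi> else - osc \<xi>)) \<le> osc \<xi> / 4" if km: "k < m" for k
    proof -
      define S1 S2 where "S1 = S \<inter> {..<Suc k}" and "S2 = ({..<m} - S) \<inter> {..<Suc k}"
      have S12: "S1 \<subseteq> {..<Suc k}" "S2 \<subseteq> {..<Suc k}" "k \<in> S1 \<longleftrightarrow> k \<in> S" "k \<in> S2 \<longleftrightarrow> k \<notin> S"
        using km by (auto simp: S1_def S2_def)
      obtain i where i: "\<phi> = X (Suc k) S1 i"
        using range_subsetD[OF ran[OF Suc_leI[OF km] S], of 0] by (auto simp: \<phi>_def S1_def)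
      obtain j where j: "\<psi> = X (Suc k) S2 j"
        using range_subsetD[OF ran[OF Suc_leI[OF km] Diff_subset[of _ S]], of 0] by (auto simp: \<psi>_def S2_def)
      show ?thesis
      proof (cases "k \<in> S")
        case True
        then show ?thesis using Xsep[of S1 k S2 i j] S12 by (simp add: i j)
      next
        case False
        have "norm (blinfun_apply \<phi> (x k) - blinfun_apply \<psi> (x k) - of_real (- osc \<xi>))
            = norm (- (blinfun_apply \<psi> (x k) - blinfun_apply \<phi> (x k) - of_real (osc \<xi>)))"
          by (rule arg_cong[of _ _ norm]) simp
        then show ?thesis using Xsep[of S2 k S1 j i] S12 False by (simp only: norm_minus_cancel i j) simp
      qed
    qed
    ultimately show "\<exists>\<phi>\<in>?D. \<exists>\<psi>\<in>?D. \<forall>k<m. norm (blinfun_apply \<phi> (x k) - blinfun_apply \<psi> (x k) -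
         of_real (if k \<in> S then osc \<xi> else - osc \<xi>)) \<le> osc \<xi> / 4" by blast
  qed
qed

lemma rotate_to_real_part:
  fixes a :: "'i \<Rightarrow> 'k::real_or_complex"
  obtains w :: 'k where "norm w = 1" "(\<Sum>i\<in>I. norm (a i)) / 2 \<le> (\<Sum>i\<in>I. \<bar>re (w * a i)\<bar>)"
proof (cases "range (embed :: 'k \<Rightarrow> complex) = \<real>")
  case True
  have "norm (b :: 'k) = \<bar>re b\<bar>" for b
  proof -
    have "embed b \<in> \<real>" using True by auto
    then show ?thesis using norm_embed[of b] by (auto simp: re_def Reals_def)
  qed
  then have "(\<Sum>i\<in>I. norm (a i)) = (\<Sum>i\<in>I. \<bar>re (1 * a i)\<bar>)" by simp
  moreover have "0 \<le> (\<Sum>i\<in>I. norm (a i))" by (rule sum_nonneg) simp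
  ultimately show ?thesis using that[of 1] by (simp add: field_simps)
next
  case False
  then have "- \<i> \<in> range (embed :: 'k \<Rightarrow> complex)" using range_embed[where 'k = 'k] by auto
  then obtain w :: 'k where "- \<i> = embed w" by (rule imageE)
  then have w: "embed w = - \<i>" by simp
  then have w1: "norm w = 1" using norm_embed[of w] by simp
  have "norm b \<le> \<bar>re (1 * b)\<bar> + \<bar>re (w * b)\<bar>" for b
    using cmod_le[of "embed b"] by (simp add: re_def embed_mult w norm_embed)
  then have "(\<Sum>i\<in>I. norm (a i)) \<le> (\<Sum>i\<in>I. \<bar>re (1 * a i)\<bar> + \<bar>re (w * a i)\<bar>)"
    by (intro sum_mono)
  also have "\<dots> = (\<Sum>i\<in>I. \<bar>re (1 * a i)\<bar>) + (\<Sum>i\<in>I. \<bar>re (w * a i)\<bar>)"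
    by (rule sum.distrib)
  finally have "(\<Sum>i\<in>I. norm (a i)) / 2 \<le> (\<Sum>i\<in>I. \<bar>re (1 * a i)\<bar>) \<or>
      (\<Sum>i\<in>I. norm (a i)) / 2 \<le> (\<Sum>i\<in>I. \<bar>re (w * a i)\<bar>)" by linarith
  then show ?thesis using that[of 1, OF norm_one] that[of w, OF w1] by blast
qed

text \<open>
  The factor \<open>8\<close>: rotating to the real part costs a factor \<open>2\<close>, the error \<open>\<delta> / 4\<close> halves what is left, and the
  difference of two functionals in the unit ball has norm up to \<open>2\<close>.
\<close>

lemma (in normed_space) l1_lower_bound:
  fixes x :: "nat \<Rightarrow> 'x" and a :: "nat \<Rightarrow> 'k"
  assumes \<delta>: "\<delta> > 0"
    and sep: "\<And>S. S \<subseteq> {..<m} \<Longrightarrow> \<exists>\<phi>\<in>dual scale \<inter> cball 0 1. \<exists>\<psi>\<in>dual scale \<inter> cball 0 1. \<forall>k<m.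
       norm (blinfun_apply \<phi> (x k) - blinfun_apply \<psi> (x k) - of_real (if k \<in> S then \<delta> else - \<delta>)) \<le> \<delta> / 4"
  shows "\<delta> / 8 * (\<Sum>k<m. norm (a k)) \<le> norm (\<Sum>k<m. scale (a k) (x k))"
proof -
  obtain w where w: "norm w = 1" "(\<Sum>k<m. norm (a k)) / 2 \<le> (\<Sum>k<m. \<bar>re (w * a k)\<bar>)"
    by (rule rotate_to_real_part)
  define S where "S = {k. k < m \<and> re (w * a k) > 0}"
  have "S \<subseteq> {..<m}" by (auto simp: S_def)
  then obtain \<phi> \<psi> where D: "\<phi> \<in> dual scale \<inter> cball 0 1" "\<psi> \<in> dual scale \<inter> cball 0 1"
    and close: "\<And>k. k < m \<Longrightarrow> norm (blinfun_apply \<phi> (x k) - blinfun_apply \<psi> (x k) -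
      of_real (if k \<in> S then \<delta> else - \<delta>)) \<le> \<delta> / 4"
    using sep by blast
  define v where "v = (\<Sum>k<m. scale (a k) (x k))"
  define b where "b = (\<lambda>k. blinfun_apply \<phi> (x k) - blinfun_apply \<psi> (x k))"
  have \<phi>v: "blinfun_apply \<phi> v = (\<Sum>k<m. a k * blinfun_apply \<phi> (x k))"
    and \<psi>v: "blinfun_apply \<psi> v = (\<Sum>k<m. a k * blinfun_apply \<psi> (x k))"
    using D by (simp_all add: v_def blinfun.sum_right operators_scale[where t = "(*)"])
  have summand: "\<delta> * \<bar>re (w * a k)\<bar> - \<delta> / 4 * norm (a k) \<le> re (w * a k * b k)" if "k < m" for k
  proof -
    define c where "c = (if k \<in> S then \<delta> else - \<delta>)"
    have "norm (w * a k * (b k - of_real c)) \<le> norm (a k) * (\<delta> / 4)"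
      using close[OF that] w(1) unfolding norm_mult b_def c_def by (simp only: mult_1) (rule mult_left_mono, simp_all)
    then have "\<bar>re (w * a k * (b k - of_real c))\<bar> \<le> norm (a k) * (\<delta> / 4)"
      using abs_re_le order_trans by blast
    moreover have "re (w * a k * b k) = re (w * a k * (b k - of_real c)) + c * re (w * a k)"
    proof -
      have "w * a k * b k = w * a k * (b k - of_real c) + of_real c * (w * a k)"
        by (simp add: algebra_simps)
      then show ?thesis by (simp only: re_add re_of_real_mult)
    qed
    moreover have "c * re (w * a k) = \<delta> * \<bar>re (w * a k)\<bar>"
      using that by (auto simp: c_def S_def)
    ultimately show ?thesis by (simp add: mult.commute abs_le_iff)
  qed
  have "\<delta> / 4 * (\<Sum>k<m. norm (a k)) \<le> \<delta> * (\<Sum>k<m. \<bar>re (w * a k)\<bar>) - \<delta> / 4 * (\<Sum>k<m. norm (a k))"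
    using mult_left_mono[OF w(2), of \<delta>] \<delta> by (simp add: field_simps)
  also have "\<dots> = (\<Sum>k<m. \<delta> * \<bar>re (w * a k)\<bar> - \<delta> / 4 * norm (a k))"
    by (simp add: sum_subtractf sum_distrib_left)
  also have "\<dots> \<le> (\<Sum>k<m. re (w * a k * b k))"
    by (intro sum_mono summand) simp
  also have "\<dots> = re (w * (blinfun_apply \<phi> v - blinfun_apply \<psi> v))"
    by (simp add: \<phi>v \<psi>v re_sum[symmetric] sum_distrib_left sum_subtractf b_def algebra_simps)
  also have "\<dots> \<le> norm (w * (blinfun_apply \<phi> v - blinfun_apply \<psi> v))"
    using abs_re_le[of "w * (blinfun_apply \<phi> v - blinfun_apply \<psi> v)"] by linarith
  also have "\<dots> \<le> norm (blinfun_apply \<phi> v) + norm (blinfun_apply \<psi> v)"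
    by (simp add: norm_mult w(1) norm_triangle_ineq4)
  also have "\<dots> \<le> 1 * norm v + 1 * norm v"
    using D by (intro add_mono order_trans[OF norm_blinfun] mult_right_mono) auto
  finally show ?thesis by (simp add: v_def)
qed

lemma contains_copy_of_l1I:
  fixes scale :: "'k::real_or_complex \<Rightarrow> 'x::banach \<Rightarrow> 'x" and x :: "nat \<Rightarrow> 'x"
  assumes ns: "normed_space scale" and x: "\<And>k. norm (x k) \<le> 1" and c: "c > 0"
    and lower: "\<And>a m. c * (\<Sum>k<m. norm (a k)) \<le> norm (\<Sum>k<m. scale (a k) (x k))"
  shows "contains_copy_of_l1 scale"
proof -
  interpret normed_space scale by (rule ns)
  interpret l1: normed_space "l1_scale :: 'k \<Rightarrow> _" by (rule normed_space_l1)
  define J :: "'k l1 \<Rightarrow> 'x" where "J = (\<lambda>f. \<Sum>k. scale (l1_apply f k) (x k))"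
  have le: "norm (scale (l1_apply f k) (x k)) \<le> norm (l1_apply f k)" for f k
    using mult_left_mono[OF x[of k], of "norm (l1_apply f k)"] by (simp add: norm_scale)
  have sn: "summable (\<lambda>k. norm (l1_apply f k))" for f :: "'k l1"
    using l1_apply[of f] by simp
  have sum_norm: "summable (\<lambda>k. norm (scale (l1_apply f k) (x k)))" for f
    by (rule summable_comparison_test'[OF sn[of f], of 0]) (simp add: le)
  then have sum: "summable (\<lambda>k. scale (l1_apply f k) (x k))" for f
    by (rule summable_norm_cancel)
  have norm_l1: "norm f = (\<Sum>k. norm (l1_apply f k))" for f :: "'k l1" by (rule norm_l1.rep_eq)
  have upper: "norm (J f) \<le> norm f" for f
    unfolding J_def norm_l1
    by (rule order_trans[OF summable_norm[OF sum_norm] suminf_le[OF le sum_norm sn]])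
  have lowerJ: "c * norm f \<le> norm (J f)" for f
  proof (rule LIMSEQ_le)
    show "(\<lambda>m. c * (\<Sum>k<m. norm (l1_apply f k))) \<longlonglongrightarrow> c * norm f"
      unfolding norm_l1 by (intro tendsto_intros summable_LIMSEQ sn)
    show "(\<lambda>m. norm (\<Sum>k<m. scale (l1_apply f k) (x k))) \<longlonglongrightarrow> norm (J f)"
      unfolding J_def by (intro tendsto_intros summable_LIMSEQ sum)
  qed (use lower in blast)
  have add: "J (f + g) = J f + J g" for f g
    unfolding J_def plus_l1.rep_eq scale_left_distrib by (rule suminf_add[OF sum sum, symmetric])
  have bl: "bounded_linear (scale a)" for a
    by (rule bounded_linear_intro[of _ "norm a"])
      (simp_all add: scale_right_distrib norm_scale mult.commute flip: scale_of_real)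
  have scale: "J (l1_scale a f) = scale a (J f)" for a f
    unfolding J_def l1_scale.rep_eq
    using bounded_linear.suminf[OF bl sum, of a f] by simp
  have lin: "Vector_Spaces.linear l1_scale scale J"
    by unfold_locales (auto simp: add scale)
  have diff: "J f - J g = J (f - g)" for f g
    using add[of "f - g" g] by simp
  have inj: "inj J"
  proof (rule injI)
    fix f g assume "J f = J g"
    then have "c * norm (f - g) \<le> 0" using lowerJ[of "f - g"] by (simp flip: diff)
    then show "f = g" using c by (simp add: mult_le_0_iff)
  qed
  have "1-lipschitz_on UNIV J"
    by (rule lipschitz_onI) (simp_all add: dist_norm diff upper)
  moreover have "(1 / c)-lipschitz_on (range J) (inv J)"
  proof (rule lipschitz_onI)
    fix y z assume "y \<in> range J" "z \<in> range J"
    then obtain f g where "y = J f" "z = J g" by blast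
    then show "dist (inv J y) (inv J z) \<le> 1 / c * dist y z"
      using lowerJ[of "f - g"] c by (simp add: inv_f_f[OF inj] dist_norm diff field_simps)
  qed (use c in simp)
  ultimately have "homeomorphism UNIV (range J) J (inv J)"
    by (auto simp: homeomorphism_def inv_f_f[OF inj] f_inv_into_f image_image intro!: lipschitz_on_continuous_on)
  moreover have "subspace (range J)"
  proof (rule subspaceI)
    show "0 \<in> range J" using scale[of 0 0] by (metis rangeI scale_zero_left)
    show "y + z \<in> range J" if "y \<in> range J" "z \<in> range J" for y z
      using that by (auto simp flip: add)
    show "scale a y \<in> range J" if "y \<in> range J" for a y
      using that by (auto simp flip: scale)
  qed
  ultimately show ?thesis
    unfolding contains_copy_of_l1_def using lin by blast
qed

text \<open>
  Bourgain's theorem: a bounded sequence of functionals on a Banach space that does not contain \<open>\<ell>\<^sup>1\<close> has a weak-star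
  convergent convex block subsequence, here in the form of a pointwise Cauchy tail block. A tail block whose oscillation is stable and positive would yield
  a sequence of vectors equivalent to the unit vector basis of \<open>\<ell>\<^sup>1\<close>.
\<close>

theorem no_l1_imp_Cauchy_tail_block:
  fixes scale :: "'k::real_or_complex \<Rightarrow> 'x::banach \<Rightarrow> 'x"
  assumes ns: "normed_space scale" and no_l1: "\<not> contains_copy_of_l1 scale"
    and \<psi>: "range \<psi> \<subseteq> dual scale \<inter> cball 0 1"
  obtains \<xi> where "tail_block \<xi> \<psi>" "\<And>x. Cauchy (\<lambda>n. blinfun_apply (\<xi> n) x)"
proof -
  interpret normed_space scale by (rule ns)
  obtain \<xi> where \<xi>: "tail_block \<xi> \<psi>" "range \<xi> \<subseteq> dual scale \<inter> cball 0 1"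
    and stable: "\<And>\<phi>. tail_block \<phi> \<xi> \<Longrightarrow> range \<phi> \<subseteq> dual scale \<inter> cball 0 1 \<Longrightarrow> osc \<phi> = osc \<xi>"
    by (rule osc_stable_tail_block[OF \<psi>]) auto
  have osc_le: "osc_le \<xi> 2" by (rule osc_le_unit_ball) (use \<xi>(2) in blast)
  have "\<not> osc \<xi> > 0"
  proof
    assume pos: "osc \<xi> > 0"
    obtain x :: "nat \<Rightarrow> 'x" where x: "\<And>k. norm (x k) \<le> 1"
      and sep: "\<And>m S. S \<subseteq> {..<m} \<Longrightarrow> \<exists>\<phi>\<in>dual scale \<inter> cball 0 1. \<exists>\<psi>\<in>dual scale \<inter> cball 0 1. \<forall>k<m.
       norm (blinfun_apply \<phi> (x k) - blinfun_apply \<psi> (x k) -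
         of_real (if k \<in> S then osc \<xi> else - osc \<xi>)) \<le> osc \<xi> / 4"
      using independent_vectors[OF \<xi>(2) stable pos] by metis
    have "contains_copy_of_l1 scale"
      by (rule contains_copy_of_l1I[OF ns x, of "osc \<xi> / 8"])
        (use pos l1_lower_bound[OF pos sep] in auto)
    with no_l1 show False ..
  qed
  then have "osc \<xi> = 0" using osc_nonneg[OF osc_le] by simp
  then have osc0: "osc_le \<xi> 0" using osc_le_osc[OF osc_le] by simp
  have "Cauchy (\<lambda>n. blinfun_apply (\<xi> n) x)" for x
  proof (rule CauchyI)
    fix e :: real assume e: "e > 0"
    define K where "K = norm x + 1"
    have K0: "K > 0" using norm_ge_zero[of x] unfolding K_def by linarith
    then have K: "K > 0" "norm ((1 / K) *\<^sub>R x) \<le> 1" by (simp_all add: K_def)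
    obtain N where N: "\<forall>m\<ge>N. \<forall>n\<ge>N. norm (blinfun_apply (\<xi> m) ((1 / K) *\<^sub>R x) -
        blinfun_apply (\<xi> n) ((1 / K) *\<^sub>R x)) \<le> 0 + e / (2 * K)"
      using osc0[unfolded osc_le_def, rule_format, OF K(2), of "e / (2 * K)"] e K(1) by auto
    have "norm (blinfun_apply (\<xi> m) x - blinfun_apply (\<xi> n) x) < e" if "m \<ge> N" "n \<ge> N" for m n
    proof -
      have "norm ((1 / K) *\<^sub>R (blinfun_apply (\<xi> m) x - blinfun_apply (\<xi> n) x)) \<le> e / (2 * K)"
        using N that by (simp add: blinfun.scaleR_right scaleR_right_diff_distrib)
      then have "norm (blinfun_apply (\<xi> m) x - blinfun_apply (\<xi> n) x) / K \<le> e / 2 / K"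
        unfolding norm_scaleR using K(1) by simp
      then have "norm (blinfun_apply (\<xi> m) x - blinfun_apply (\<xi> n) x) \<le> e / 2"
        using K(1) by (simp only: divide_le_cancel)
      then show ?thesis using e by linarith
    qed
    then show "\<exists>M. \<forall>m\<ge>M. \<forall>n\<ge>M. norm (blinfun_apply (\<xi> m) x - blinfun_apply (\<xi> n) x) < e" by blast
  qed
  then show ?thesis using that \<xi>(1) by blast
qed

lemma seq_compact_imp_Cauchy_tail_block:
  fixes scale :: "'k::real_or_complex \<Rightarrow> 'x::real_normed_vector \<Rightarrow> 'x" and \<psi> :: "nat \<Rightarrow> 'x \<Rightarrow>\<^sub>L 'k"
  assumes "dual_ball_weak_star_seq_compact scale" and \<psi>: "range \<psi> \<subseteq> dual scale \<inter> cball 0 1"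
  obtains \<xi> where "tail_block \<xi> \<psi>" "\<And>x. Cauchy (\<lambda>n. blinfun_apply (\<xi> n) x)"
proof -
  obtain r :: "nat \<Rightarrow> nat" and \<phi> where r: "strict_mono r"
    and lim: "\<forall>x. (\<lambda>n. blinfun_apply (\<psi> (r n)) x) \<longlonglongrightarrow> blinfun_apply \<phi> x"
    using assms(1)[unfolded dual_ball_weak_star_seq_compact_def, rule_format, of \<psi>] range_subsetD[OF \<psi>] by blast
  show ?thesis
  proof
    show "tail_block (\<lambda>n. \<psi> (r n)) \<psi>"
      by (rule tail_block_reindex[OF tail_block_refl seq_suble[OF r]])
    show "Cauchy (\<lambda>n. blinfun_apply (\<psi> (r n)) x)" for x
      using lim by (intro LIMSEQ_imp_Cauchy) auto
  qed
qed

lemma convex_hull_tail_finite: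
  fixes \<psi> :: "nat \<Rightarrow> 'a::real_vector"
  assumes "u \<in> convex hull (\<psi> ` {N..})"
  obtains K where "N < K" "u \<in> convex hull (\<psi> ` {N..<K})"
proof -
  define U where "U = {u. \<exists>K>N. u \<in> convex hull (\<psi> ` {N..<K})}"
  have mono: "convex hull (\<psi> ` {N..<K}) \<subseteq> convex hull (\<psi> ` {N..<K'})" if "K \<le> K'" for K K'
    using that by (intro hull_mono image_mono) auto
  have "convex hull (\<psi> ` {N..}) \<subseteq> U"
  proof (rule hull_minimal)
    show "\<psi> ` {N..} \<subseteq> U"
    proof (rule image_subsetI)
      fix n assume "n \<in> {N..}"
      then have "Suc n > N \<and> \<psi> n \<in> convex hull (\<psi> ` {N..<Suc n})"
        by (auto intro!: hull_inc)
      then show "\<psi> n \<in> U" unfolding U_def by blast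
    qed
    show "convex U"
    proof (rule convexI)
      fix x y and a b :: real assume "x \<in> U" "y \<in> U" and ab: "0 \<le> a" "0 \<le> b" "a + b = 1"
      then obtain K K' where K: "K > N" "x \<in> convex hull (\<psi> ` {N..<K})"
        and K': "K' > N" "y \<in> convex hull (\<psi> ` {N..<K'})" by (auto simp: U_def)
      have "x \<in> convex hull (\<psi> ` {N..<max K K'})" "y \<in> convex hull (\<psi> ` {N..<max K K'})"
        using K(2) K'(2) mono[of K "max K K'"] mono[of K' "max K K'"] by auto
      then have "a *\<^sub>R x + b *\<^sub>R y \<in> convex hull (\<psi> ` {N..<max K K'})"
        using ab by (intro convexD[OF convex_convex_hull])
      then show "a *\<^sub>R x + b *\<^sub>R y \<in> U"
        unfolding U_def using K(1) by (intro CollectI exI[of _ "max K K'"]) auto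
    qed
  qed
  then show ?thesis using assms that by (auto simp: U_def)
qed

text \<open>
  Selection of successive disjoint blocks; consecutive differences suffice, so no limit functional is needed.
\<close>

lemma Cauchy_tail_block_imp_null_differences:
  fixes \<psi> :: "nat \<Rightarrow> 'x::real_normed_vector \<Rightarrow>\<^sub>L 'k::real_normed_vector"
  assumes \<xi>: "tail_block \<xi> \<psi>" "\<And>x. Cauchy (\<lambda>n. blinfun_apply (\<xi> n) x)"
  obtains k \<phi> where "k 0 = 0" "strict_mono (k :: nat \<Rightarrow> nat)"
    "\<And>n. \<phi> n \<in> convex hull (\<psi> ` {k n..<k (Suc n)})"
    "\<And>x. (\<lambda>n. blinfun_apply (\<phi> (2 * n)) x - blinfun_apply (\<phi> (Suc (2 * n))) x) \<longlonglongrightarrow> 0"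
proof -
  have "\<exists>k. \<forall>n. (n = 0 \<longrightarrow> k n = 0) \<and> k n < k (Suc n) \<and> (\<exists>p\<ge>n. \<xi> p \<in> convex hull (\<psi> ` {k n..<k (Suc n)}))"
  proof -
    have "\<exists>k. \<forall>n. (n = 0 \<longrightarrow> k n = (0::nat)) \<and> (k n < k (Suc n) \<and> (\<exists>p\<ge>n. \<xi> p \<in> convex hull (\<psi> ` {k n..<k (Suc n)})))"
    proof (rule dependent_nat_choice)
      fix k n :: nat
      obtain M where "\<And>p. p \<ge> M \<Longrightarrow> \<xi> p \<in> convex hull (\<psi> ` {k..})"
        using tail_blockD[OF \<xi>(1), of k] by metis
      then have "\<xi> (max M n) \<in> convex hull (\<psi> ` {k..})" by simp
      then obtain K where "k < K" "\<xi> (max M n) \<in> convex hull (\<psi> ` {k..<K})"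
        by (rule convex_hull_tail_finite)
      then show "\<exists>K. (Suc n = 0 \<longrightarrow> K = 0) \<and> k < K \<and> (\<exists>p\<ge>n. \<xi> p \<in> convex hull (\<psi> ` {k..<K}))"
        by (intro exI[of _ K]) (auto intro!: exI[of _ "max M n"])
    qed simp
    then show ?thesis by simp
  qed
  then obtain k p where k: "k 0 = 0" "\<And>n. k n < k (Suc n)"
    and p: "\<And>n. n \<le> p n" "\<And>n. \<xi> (p n) \<in> convex hull (\<psi> ` {k n..<k (Suc n)})" by metis
  show ?thesis
  proof (rule that)
    show "k 0 = 0" "strict_mono k" using k by (auto simp: strict_mono_Suc_iff)
    show "\<xi> (p n) \<in> convex hull (\<psi> ` {k n..<k (Suc n)})" for n by (rule p)
    show "(\<lambda>n. blinfun_apply (\<xi> (p (2 * n))) x - blinfun_apply (\<xi> (p (Suc (2 * n)))) x) \<longlonglongrightarrow> 0" for x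
    proof (rule LIMSEQ_I)
      fix e :: real assume "e > 0"
      then obtain N where N: "\<And>m n. m \<ge> N \<Longrightarrow> n \<ge> N \<Longrightarrow> norm (blinfun_apply (\<xi> m) x - blinfun_apply (\<xi> n) x) < e"
        using CauchyD[OF \<xi>(2), of e x] by blast
      have "norm (blinfun_apply (\<xi> (p (2 * n))) x - blinfun_apply (\<xi> (p (Suc (2 * n)))) x - 0) < e" if "n \<ge> N" for n
        using N[of "p (2 * n)" "p (Suc (2 * n))"] p(1)[of "2 * n"] p(1)[of "Suc (2 * n)"] that by simp
      then show "\<exists>no. \<forall>n\<ge>no. norm (blinfun_apply (\<xi> (p (2 * n))) x - blinfun_apply (\<xi> (p (Suc (2 * n)))) x - 0) < e"
        by blast
    qed
  qed
qed


section \<open>Functionals on \<open>C\<^sub>0(K)\<close> for scattered \<open>K\<close>\<close>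

text \<open>
  The values of an element of \<open>C\<^sub>0(K)\<close>.
\<close>

abbreviation C0_apply :: "('p::topological_space, 'k::real_normed_vector) C0 \<Rightarrow> 'p \<Rightarrow> 'k" where
  "C0_apply f \<equiv> apply_bcontfun (bcontfun_of_C0 f)"

lemma norm_C0_apply_le: "norm (C0_apply f t) \<le> norm f"
  by (simp add: norm_C0.rep_eq norm_bounded)

lemma norm_C0_le: "(\<And>t. norm (C0_apply f t) \<le> B) \<Longrightarrow> norm f \<le> B"
  by (simp add: norm_C0.rep_eq norm_bound)

lemma C0_eqI: "(\<And>t. C0_apply f t = C0_apply g t) \<Longrightarrow> f = g"
  by (metis bcontfun_eqI bcontfun_of_C0_inject)

lemma C0_apply_0: "C0_apply 0 t = 0"
  and C0_apply_add: "C0_apply (f + g) t = C0_apply f t + C0_apply g t"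
  and C0_apply_diff: "C0_apply (f - g) t = C0_apply f t - C0_apply g t"
  and C0_apply_scaleR: "C0_apply (r *\<^sub>R f) t = r *\<^sub>R C0_apply f t"
  by (simp_all add: zero_C0.rep_eq plus_C0.rep_eq minus_C0.rep_eq scaleR_C0.rep_eq)

lemma C0_apply_sum: "C0_apply (\<Sum>i\<in>I. f i) t = (\<Sum>i\<in>I. C0_apply (f i) t)"
  by (induction I rule: infinite_finite_induct) (auto simp: C0_apply_0 C0_apply_add)

lemma C0_apply_scale: "C0_apply (C0_scale a f) t = a * C0_apply f t"
  by (simp add: C0_scale.rep_eq)

lemmas C0_apply_simps = C0_apply_0 C0_apply_add C0_apply_diff C0_apply_scaleR C0_apply_sum C0_apply_scale

lemma continuous_on_C0_apply: "continuous_on S (C0_apply f)"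
  by (rule continuous_on_apply_bcontfun)

lemma compact_C0_ge: "e > 0 \<Longrightarrow> compact {t. e \<le> norm (C0_apply f t)}"
  using bcontfun_of_C0[of f] by (simp add: vanishes_at_infinity_def)

text \<open>
  The element of \<open>C\<^sub>0(K)\<close> with given values; meaningful only for continuous functions vanishing at infinity.
\<close>

definition C0_of :: "('p::topological_space \<Rightarrow> 'k::real_normed_vector) \<Rightarrow> ('p, 'k) C0" where
  "C0_of f = Abs_C0 (Bcontfun f)"

lemma C0_apply_C0_of:
  assumes f: "continuous_on UNIV f" and compact: "\<And>e. e > 0 \<Longrightarrow> compact {t. e \<le> norm (f t)}"
  shows "C0_apply (C0_of f) = f"
proof -
  have "bounded (f ` {t. 1 \<le> norm (f t)})"
    by (intro compact_imp_bounded compact_continuous_image continuous_on_subset[OF f] compact) auto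
  then obtain B where "\<And>t. 1 \<le> norm (f t) \<Longrightarrow> norm (f t) \<le> B" by (auto simp: bounded_iff)
  then have "norm (f t) \<le> max 1 B" for t by (meson le_max_iff_disj linear)
  then have "f \<in> bcontfun" by (rule bcontfun_normI[OF f])
  then have "apply_bcontfun (Bcontfun f) = f" by (simp add: Bcontfun_inverse)
  then show ?thesis using compact by (simp add: C0_of_def Abs_C0_inverse vanishes_at_infinity_def)
qed

text \<open>
  Cut-off functions are continuous with values in \<open>[0, 1]\<close>; they need not vanish at infinity.
\<close>

definition cutoff :: "('p::topological_space \<Rightarrow> real) \<Rightarrow> bool" where
  "cutoff q \<longleftrightarrow> continuous_on UNIV q \<and> (\<forall>t. 0 \<le> q t \<and> q t \<le> 1)"

lemma cutoff_compl: "cutoff q \<Longrightarrow> cutoff (\<lambda>t. 1 - q t)"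
  by (auto simp: cutoff_def intro!: continuous_intros)

lemma cutoff_mult: "cutoff p \<Longrightarrow> cutoff q \<Longrightarrow> cutoff (\<lambda>t. p t * q t)"
  by (auto simp: cutoff_def intro!: continuous_intros mult_le_one)

text \<open>
  Multiplication of an element of \<open>C\<^sub>0(K)\<close> by a cut-off function.
\<close>

definition cut :: "('p::topological_space \<Rightarrow> real) \<Rightarrow> ('p, 'k::real_or_complex) C0 \<Rightarrow> ('p, 'k) C0" where
  "cut q f = C0_of (\<lambda>t. of_real (q t) * C0_apply f t)"

lemma C0_apply_cut:
  assumes "cutoff q"
  shows "C0_apply (cut q f) t = of_real (q t) * C0_apply f t"
proof -
  have le: "norm (of_real (q t) * C0_apply f t) \<le> norm (C0_apply f t)" for t
    using assms by (auto simp: cutoff_def norm_mult intro!: mult_left_le_one_le)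
  have cont: "continuous_on UNIV (\<lambda>t. of_real (q t) * C0_apply f t)"
    using assms by (intro continuous_intros continuous_on_C0_apply) (simp add: cutoff_def)
  have "compact {t. e \<le> norm (of_real (q t) * C0_apply f t)}" if "e > 0" for e
  proof -
    have "closed {t. e \<le> norm (of_real (q t) * C0_apply f t)}"
      by (intro closed_Collect_le continuous_intros cont)
    then have "compact ({t. e \<le> norm (C0_apply f t)} \<inter> {t. e \<le> norm (of_real (q t) * C0_apply f t)})"
      by (rule compact_Int_closed[OF compact_C0_ge[OF that]])
    also have "{t. e \<le> norm (C0_apply f t)} \<inter> {t. e \<le> norm (of_real (q t) * C0_apply f t)} =
        {t. e \<le> norm (of_real (q t) * C0_apply f t)}"
      using le order_trans by blast
    finally show ?thesis .
  qed
  then show ?thesis unfolding cut_def by (subst C0_apply_C0_of[OF cont]) auto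
qed

lemma norm_cut_apply_le: "cutoff q \<Longrightarrow> norm (C0_apply (cut q f) t) \<le> norm (C0_apply f t)"
  by (auto simp: C0_apply_cut cutoff_def norm_mult intro!: mult_left_le_one_le)

lemma norm_cut_le: "cutoff q \<Longrightarrow> norm (cut q f) \<le> norm f"
  by (rule norm_C0_le) (rule order_trans[OF norm_cut_apply_le norm_C0_apply_le])

lemma cut_split: "cutoff q \<Longrightarrow> f = cut q f + cut (\<lambda>t. 1 - q t) f"
  by (rule C0_eqI) (simp add: C0_apply_simps C0_apply_cut cutoff_compl algebra_simps)

lemma bump:
  fixes x :: "'p::t2_space"
  assumes lc: "locally_compact_space (euclidean :: 'p topology)" and "open U" "x \<in> U"
  obtains k :: "'p \<Rightarrow> real" where "cutoff k" "k x = 1" "\<And>t. t \<notin> U \<Longrightarrow> k t = 0"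
    "\<And>e. e > 0 \<Longrightarrow> compact {t. e \<le> k t}"
proof -
  have "Hausdorff_space (euclidean :: 'p topology)"
    unfolding Hausdorff_space_def disjnt_def using hausdorff by auto
  then have "completely_regular_space (euclidean :: 'p topology)"
    by (intro locally_compact_regular_imp_completely_regular_space lc disjI1)
  moreover obtain W L where W: "open W" "compact L" "x \<in> W" "W \<subseteq> L"
  proof -
    have "\<exists>W L. open W \<and> compact L \<and> x \<in> W \<and> W \<subseteq> L"
      using lc unfolding locally_compact_space_def by simp
    then show thesis using that by (elim exE conjE)
  qed
  have "closedin euclidean (- (U \<inter> W))" "x \<in> topspace euclidean - (- (U \<inter> W))"
    using assms W by auto
  ultimately obtain f :: "'p \<Rightarrow> real" where f: "continuous_map euclidean (top_of_set {0..1}) f" "f x = 0"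
    "f ` (- (U \<inter> W)) \<subseteq> {1}"
    unfolding completely_regular_space_def by blast
  have cont: "continuous_on UNIV f" and "f t \<in> {0..1}" for t
    using f(1) by (auto simp: continuous_map_in_subtopology image_subset_iff)
  then have cut: "cutoff (\<lambda>t. 1 - f t)"
    by (auto simp: cutoff_def intro!: continuous_intros)
  show ?thesis
  proof
    show "1 - f t = 0" if "t \<notin> U" for t using f(3) that by auto
    fix e :: real assume e: "e > 0"
    have "closed {t. e \<le> 1 - f t}"
      by (intro closed_Collect_le continuous_intros cont)
    then have "compact (L \<inter> {t. e \<le> 1 - f t})" by (rule compact_Int_closed[OF W(2)])
    also have "L \<inter> {t. e \<le> 1 - f t} = {t. e \<le> 1 - f t}"
      using f(3) W(4) e by fastforce
    finally show "compact {t. e \<le> 1 - f t}" .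
  qed (use cut f(2) in auto)
qed

lemma align_phase: obtains \<alpha> :: "'k::real_or_complex" where "norm \<alpha> = 1" "norm (a + \<alpha> * b) = norm a + norm b"
proof -
  obtain v where v: "norm v = 1" "v * a = of_real (norm a)" by (rule phase)
  obtain w where w: "norm w = 1" "w * b = of_real (norm b)" by (rule phase)
  have v0: "v \<noteq> 0" using v(1) by auto
  have "norm (a + inverse v * w * b) = norm (v * (a + inverse v * w * b))" using v(1) by (simp add: norm_mult)
  also have "v * (a + inverse v * w * b) = v * a + w * b" using v0 by (simp add: distrib_left flip: mult.assoc)
  also have "\<dots> = of_real (norm a + norm b)" by (simp add: v w)
  also have "norm \<dots> = norm a + norm b" by (simp only: norm_of_real)  simp
  finally show ?thesis using that[of "inverse v * w"] v w by (simp add: norm_mult norm_inverse)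
qed

lemma compact_subset_chain_member:
  assumes "compact K" "K \<subseteq> \<Union>C" "C \<noteq> {}" "subset.chain A C" "\<And>G. G \<in> C \<Longrightarrow> open G"
  obtains G where "G \<in> C" "K \<subseteq> G"
proof -
  obtain D where D: "D \<subseteq> C" "finite D" "K \<subseteq> \<Union>D"
    by (rule compactE[OF assms(1,2,5)])
  show ?thesis
  proof (cases "D = {}")
    case True
    then show ?thesis using D(3) assms(3) that by blast
  next
    case False
    have "subset.chain A D" using assms(4) D(1) unfolding subset_chain_def by (meson order_trans subsetD)
    then have "\<Union>D \<in> D" by (rule Union_in_chain[OF D(2) False])
    then show ?thesis using D that by blast
  qed
qed

text \<open>
  On the functions supported in \<open>G\<close>, the functional \<open>\<mu>\<close> is determined, up to an arbitrarily small error in norm, by the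
  values on a finite set. For open \<open>G\<close> in a locally compact Hausdorff space this says that the restriction of the measure \<open>\<mu>\<close> to \<open>G\<close> is
  purely atomic.
\<close>

definition finitely_carried_on :: "(('p::topological_space, 'k::real_or_complex) C0 \<Rightarrow>\<^sub>L 'k) \<Rightarrow> 'p set \<Rightarrow> bool" where
  "finitely_carried_on \<mu> G \<longleftrightarrow> (\<forall>\<eta>>0. \<exists>F. finite F \<and> (\<forall>f. (\<forall>t. t \<notin> G \<longrightarrow> C0_apply f t = 0) \<longrightarrow>
     (\<forall>t\<in>F. C0_apply f t = 0) \<longrightarrow> norm (\<mu> f) \<le> \<eta> * norm f))"

text \<open>
  Let \<open>f\<^sub>0\<close> almost attain the norm of \<open>\<mu>\<close> on the functions supported in the union of the chain. Up to a small error it may be replaced by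
  a function \<open>g\<close> that vanishes where \<open>f\<^sub>0\<close> is small, hence outside a compact subset of some member \<open>G\<close> of the chain. On functions
  supported away from \<open>g\<close>, the functional \<open>\<mu>\<close> is small, for otherwise \<open>g\<close> could be improved; the remaining part of a function
  lives on \<open>G\<close>.
\<close>

lemma finitely_carried_on_Union:
  fixes \<mu> :: "('p::topological_space, 'k::real_or_complex) C0 \<Rightarrow>\<^sub>L 'k"
  assumes \<mu>: "\<mu> \<in> dual C0_scale" and C: "C \<noteq> {}" "subset.chain A C"
    and carried: "\<And>G. G \<in> C \<Longrightarrow> open G \<and> finitely_carried_on \<mu> G"
  shows "finitely_carried_on \<mu> (\<Union>C)"
  unfolding finitely_carried_on_def
proof (intro allI impI)
  fix \<eta> :: real assume \<eta>: "\<eta> > 0"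
  define S where "S = {norm (\<mu> f) |f. norm f \<le> 1 \<and> (\<forall>t. t \<notin> \<Union>C \<longrightarrow> C0_apply f t = 0)}"
  have le: "norm (\<mu> f) \<le> norm \<mu>" if "norm f \<le> 1" for f
    using norm_blinfun[of \<mu> f] mult_left_mono[OF that, of "norm \<mu>"] by simp
  have bdd: "bdd_above S" using le by (intro bdd_aboveI[of _ "norm \<mu>"]) (auto simp: S_def)
  have "norm (\<mu> 0) \<in> S" unfolding S_def by (intro CollectI exI[of _ 0]) (simp add: C0_apply_0)
  then obtain s where "s \<in> S" "Sup S - \<eta> / 4 < s"
    using less_cSupD[of S "Sup S - \<eta> / 4"] \<eta> by auto
  then obtain f0 where f0: "norm f0 \<le> 1" "\<And>t. t \<notin> \<Union>C \<Longrightarrow> C0_apply f0 t = 0"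
    and f0_large: "Sup S - \<eta> / 4 < norm (\<mu> f0)"
    unfolding S_def by auto
  define \<epsilon> where "\<epsilon> = \<eta> / (4 * (norm \<mu> + 1))"
  have \<epsilon>: "\<epsilon> > 0" "norm \<mu> * \<epsilon> \<le> \<eta> / 4"
    using \<eta> by (auto simp: \<epsilon>_def field_simps add_pos_nonneg intro!: divide_pos_pos)
  \<comment> \<open>The cut-off function shrinks \<open>f\<^sub>0\<close> by \<open>\<epsilon>\<close> in modulus, down to \<open>0\<close> where \<open>\<bar>f\<^sub>0\<bar> \<le> \<epsilon>\<close>.\<close>
  define q where "q = (\<lambda>t. 1 - \<epsilon> / max \<epsilon> (norm (C0_apply f0 t)))"
  have q: "cutoff q"
    unfolding cutoff_def
  proof (intro conjI allI)
    have pos: "max \<epsilon> (norm (C0_apply f0 t)) > 0" for t using \<epsilon>(1) by auto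
    then show "continuous_on UNIV q" unfolding q_def
      by (intro continuous_intros continuous_on_C0_apply) (metis less_irrefl)
    show "0 \<le> q t" "q t \<le> 1" for t
      using pos[of t] \<epsilon>(1) by (simp_all add: q_def divide_le_eq_1)
  qed
  define g where "g = cut q f0"
  have "norm (f0 - g) \<le> \<epsilon>"
  proof (rule norm_C0_le)
    fix t
    have "C0_apply (f0 - g) t = of_real (\<epsilon> / max \<epsilon> (norm (C0_apply f0 t))) * C0_apply f0 t"
      unfolding g_def C0_apply_diff C0_apply_cut[OF q] by (simp add: q_def algebra_simps)
    also have "norm \<dots> = \<epsilon> / max \<epsilon> (norm (C0_apply f0 t)) * norm (C0_apply f0 t)"
      using \<epsilon>(1) by (simp add: norm_mult norm_divide)
    also have "\<dots> \<le> \<epsilon>" using \<epsilon>(1) by (simp add: max_def field_simps)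
    finally show "norm (C0_apply (f0 - g) t) \<le> \<epsilon>" .
  qed
  then have "norm (\<mu> (f0 - g)) \<le> \<eta> / 4"
    using norm_blinfun[of \<mu> "f0 - g"] mult_left_mono[of "norm (f0 - g)" \<epsilon> "norm \<mu>"] \<epsilon>(2) by simp
  then have g_large: "Sup S - \<eta> / 2 < norm (\<mu> g)"
    using f0_large norm_triangle_ineq2[of "\<mu> f0" "\<mu> g"]
    by (simp add: blinfun.diff_right)
  have g0: "C0_apply g t = 0" if "norm (C0_apply f0 t) \<le> \<epsilon>" for t
    using that \<epsilon>(1) unfolding g_def C0_apply_cut[OF q] by (simp add: q_def max_absorb1)
  obtain G where G: "G \<in> C" "{t. \<epsilon> / 2 \<le> norm (C0_apply f0 t)} \<subseteq> G"
  proof (rule compact_subset_chain_member[OF _ _ C])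
    show "compact {t. \<epsilon> / 2 \<le> norm (C0_apply f0 t)}" using \<epsilon>(1) by (intro compact_C0_ge) simp
    show "{t. \<epsilon> / 2 \<le> norm (C0_apply f0 t)} \<subseteq> \<Union>C"
    proof (rule subsetI, rule ccontr)
      fix t assume "t \<in> {t. \<epsilon> / 2 \<le> norm (C0_apply f0 t)}" "t \<notin> \<Union>C"
      then show False using f0(2)[of t] \<epsilon>(1) by simp
    qed
  qed (use carried in auto)
  obtain F where F: "finite F" "\<And>f. (\<And>t. t \<notin> G \<Longrightarrow> C0_apply f t = 0) \<Longrightarrow> (\<And>t. t \<in> F \<Longrightarrow> C0_apply f t = 0) \<Longrightarrow>
      norm (\<mu> f) \<le> \<eta> / 2 * norm f"
    using carried[OF G(1)] \<eta> unfolding finitely_carried_on_def by (metis half_gt_zero)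
  \<comment> \<open>Equal to \<open>1\<close> where \<open>g\<close> does not vanish, and to \<open>0\<close> where \<open>\<bar>f\<^sub>0\<bar> \<le> \<epsilon> / 2\<close>, in particular outside \<open>G\<close>.\<close>
  define k where "k = (\<lambda>t. min 1 (max 0 (2 * norm (C0_apply f0 t) / \<epsilon> - 1)))"
  have k: "cutoff k" unfolding cutoff_def k_def
    using \<epsilon> by (auto intro!: continuous_intros continuous_on_C0_apply)
  have k0: "k t = 0" if "t \<notin> G" for t
  proof -
    have "norm (C0_apply f0 t) < \<epsilon> / 2" using G(2) that by (meson mem_Collect_eq not_le subsetD)
    then have "2 * norm (C0_apply f0 t) / \<epsilon> \<le> 1" using \<epsilon>(1) by simp
    then show ?thesis by (simp add: k_def)
  qed
  have k1: "k t = 1" if "\<epsilon> < norm (C0_apply f0 t)" for t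
    using that \<epsilon>(1) by (simp add: k_def field_simps)
  have "norm (\<mu> f) \<le> \<eta> * norm f"
    if f: "\<forall>t. t \<notin> \<Union>C \<longrightarrow> C0_apply f t = 0" "\<forall>t\<in>F. C0_apply f t = 0" for f
  proof (cases "f = 0")
    case False
    define c where "c = norm f"
    have c: "c > 0" using False by (simp add: c_def)
    define v where "v = (1 / c) *\<^sub>R cut (\<lambda>t. 1 - k t) f"
    have vt: "C0_apply v t = (1 / c) *\<^sub>R (of_real (1 - k t) * C0_apply f t)" for t
      by (simp add: v_def C0_apply_simps C0_apply_cut[OF cutoff_compl[OF k]])
    have v1: "norm (C0_apply v t) \<le> 1" for t
    proof -
      have "norm (C0_apply v t) \<le> norm v" by (rule norm_C0_apply_le)
      also have "\<dots> \<le> 1" using c norm_cut_le[OF cutoff_compl[OF k], of f] by (simp add: v_def c_def)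
      finally show ?thesis .
    qed
    have "norm (\<mu> (cut k f)) \<le> \<eta> / 2 * norm (cut k f)"
      using f(2) k0 by (intro F(2)) (auto simp: C0_apply_cut[OF k])
    also have "\<dots> \<le> \<eta> / 2 * c" unfolding c_def
      using \<eta> by (intro mult_left_mono norm_cut_le[OF k]) auto
    finally have 1: "norm (\<mu> (cut k f)) \<le> \<eta> / 2 * c" .
    obtain \<alpha> where \<alpha>: "norm \<alpha> = 1"
      "norm (\<mu> g + \<alpha> * \<mu> v) = norm (\<mu> g) + norm (\<mu> v)"
      by (rule align_phase)
    define h where "h = g + C0_scale \<alpha> v"
    have "norm h \<le> 1"
    proof (rule norm_C0_le)
      fix t
      show "norm (C0_apply h t) \<le> 1"
      proof (cases "norm (C0_apply f0 t) \<le> \<epsilon>")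
        case True
        then show ?thesis using v1[of t] \<alpha>(1) by (simp add: h_def C0_apply_simps g0 norm_mult)
      next
        case False
        then have "C0_apply h t = C0_apply g t" using k1[of t] by (simp add: h_def C0_apply_simps vt)
        then show ?thesis
          using norm_cut_le[OF q, of f0] f0(1) norm_C0_apply_le[of g t] by (simp add: g_def)
      qed
    qed
    moreover have "C0_apply h t = 0" if "t \<notin> \<Union>C" for t
      using that f(1) f0(2)[OF that] by (simp add: h_def C0_apply_simps vt g_def C0_apply_cut[OF q])
    ultimately have "norm (\<mu> h) \<in> S" unfolding S_def by blast
    then have "norm (\<mu> h) \<le> Sup S" using bdd by (rule cSup_upper)
    moreover have "\<mu> h = \<mu> g + \<alpha> * \<mu> v"
      by (simp add: h_def blinfun.add_right operators_scale[OF \<mu>])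
    ultimately have v: "norm (\<mu> v) \<le> \<eta> / 2" using \<alpha>(2) g_large by simp
    have "cut (\<lambda>t. 1 - k t) f = c *\<^sub>R v" using c by (simp add: v_def)
    then have "norm (\<mu> (cut (\<lambda>t. 1 - k t) f)) = c * norm (\<mu> v)"
      using c by (simp add: blinfun.scaleR_right)
    also have "\<dots> \<le> c * (\<eta> / 2)" using v c by (intro mult_left_mono) auto
    finally have 2: "norm (\<mu> (cut (\<lambda>t. 1 - k t) f)) \<le> \<eta> / 2 * c"
      by (simp only: mult.commute)
    have "norm (\<mu> f) \<le> norm (\<mu> (cut k f)) + norm (\<mu> (cut (\<lambda>t. 1 - k t) f))"
      using norm_triangle_ineq by (subst cut_split[OF k, of f]) (simp add: blinfun.add_right)
    then show ?thesis using 1 2 by (simp add: c_def)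
  qed simp
  then show "\<exists>F. finite F \<and> (\<forall>f. (\<forall>t. t \<notin> \<Union>C \<longrightarrow> C0_apply f t = 0) \<longrightarrow> (\<forall>t\<in>F. C0_apply f t = 0) \<longrightarrow>
      norm (\<mu> f) \<le> \<eta> * norm f)"
    using F(1) by blast
qed

text \<open>
  By Zorn's lemma there is a maximal open set on which \<open>\<mu>\<close> is finitely carried. If it were not all of \<open>K\<close>, an isolated
  point of its complement could be added to it.
\<close>

theorem scattered_functional_finitely_carried:
  fixes \<mu> :: "('p::topological_space, 'k::real_or_complex) C0 \<Rightarrow>\<^sub>L 'k"
  assumes sc: "scattered (UNIV :: 'p set)" and \<mu>: "\<mu> \<in> dual C0_scale" and \<eta>: "\<eta> > 0"
  obtains F where "finite F" "\<And>f. (\<forall>t\<in>F. C0_apply f t = 0) \<Longrightarrow> norm (\<mu> f) \<le> \<eta> * norm f"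
proof -
  define A where "A = {G. open G \<and> finitely_carried_on \<mu> G}"
  have "\<exists>M\<in>A. \<forall>X\<in>A. M \<subseteq> X \<longrightarrow> X = M"
  proof (rule subset_Zorn_nonempty)
    have f0: "f = 0" if "\<forall>t. C0_apply f t = 0" for f :: "('p, 'k) C0"
      using that by (intro C0_eqI) (simp add: C0_apply_0)
    have "finitely_carried_on \<mu> {}"
      unfolding finitely_carried_on_def
    proof (intro allI impI exI[of _ "{}"] conjI)
      fix e :: real and f :: "('p, 'k) C0" assume "\<forall>t. t \<notin> {} \<longrightarrow> C0_apply f t = 0"
      then have "f = 0" using f0[of f] by simp
      then show "norm (\<mu> f) \<le> e * norm f" by simp
    qed simp
    then show "A \<noteq> {}" by (auto simp: A_def)
    fix C assume C: "C \<noteq> {}" "subset.chain A C"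
    then have "C \<subseteq> A" by (simp add: subset.chain_def)
    then have C': "open X \<and> finitely_carried_on \<mu> X" if "X \<in> C" for X using that unfolding A_def by blast
    then have "open (\<Union>C)" by (intro open_Union) simp
    then show "\<Union>C \<in> A" using finitely_carried_on_Union[OF \<mu> C C'] by (simp add: A_def)
  qed
  then obtain G where "G \<in> A" and "\<forall>X\<in>A. G \<subseteq> X \<longrightarrow> X = G" ..
  then have G: "open G" "finitely_carried_on \<mu> G" and max: "\<And>X. X \<in> A \<Longrightarrow> G \<subseteq> X \<Longrightarrow> X = G"
    by (simp_all add: A_def)
  have "G = UNIV"
  proof (rule ccontr)
    assume "G \<noteq> UNIV"
    then obtain x where x: "x \<in> - G" "x isolated_in (- G)"
      using sc[unfolded scattered_def, THEN spec[of _ "- G"]] by auto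
    then obtain T where T: "open T" "T \<inter> - G = {x}" by (auto simp: isolated_in_def)
    then have "insert x G = G \<union> T" by auto
    then have "open (insert x G)" using G(1) T(1) by auto
    moreover have "finitely_carried_on \<mu> (insert x G)"
      unfolding finitely_carried_on_def
    proof (intro allI impI)
      fix e :: real assume "e > 0"
      then obtain F where F: "finite F" "\<forall>f. (\<forall>t. t \<notin> G \<longrightarrow> C0_apply f t = 0) \<longrightarrow>
        (\<forall>t\<in>F. C0_apply f t = 0) \<longrightarrow> norm (\<mu> f) \<le> e * norm f"
        using G(2)[unfolded finitely_carried_on_def, THEN spec[of _ e]] by auto
      then show "\<exists>F. finite F \<and> (\<forall>f. (\<forall>t. t \<notin> insert x G \<longrightarrow> C0_apply f t = 0) \<longrightarrow>
        (\<forall>t\<in>F. C0_apply f t = 0) \<longrightarrow> norm (\<mu> f) \<le> e * norm f)"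
        by (intro exI[of _ "insert x F"] conjI allI impI) (simp, metis insert_iff)
    qed
    ultimately have "insert x G = G" by (intro max) (auto simp: A_def)
    then show False using x(1) by blast
  qed
  then have "finitely_carried_on \<mu> UNIV" using G(2) by simp
  then obtain F where "finite F" "\<forall>f. (\<forall>t\<in>F. C0_apply f t = 0) \<longrightarrow> norm (\<mu> f) \<le> \<eta> * norm f"
    using \<eta> by (auto simp: finitely_carried_on_def)
  then show ?thesis by (intro that[of F]) auto
qed


section \<open>The essential norm\<close>

lemma finite_t2_separation:
  fixes F :: "'p::t2_space set"
  assumes "finite F"
  obtains B where "\<And>x. x \<in> F \<Longrightarrow> open (B x)" "\<And>x. x \<in> F \<Longrightarrow> x \<in> B x"
    "\<And>x y. x \<in> F \<Longrightarrow> y \<in> F \<Longrightarrow> x \<noteq> y \<Longrightarrow> B x \<inter> B y = {}"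
proof -
  have "\<exists>W. fst p \<noteq> snd p \<longrightarrow> open (fst W) \<and> open (snd W) \<and> fst p \<in> fst W \<and> snd p \<in> snd W \<and> fst W \<inter> snd W = {}"
    for p :: "'p \<times> 'p"
  proof (cases "fst p = snd p")
    case False
    then obtain U V where "open U" "open V" "fst p \<in> U" "snd p \<in> V" "U \<inter> V = {}"
      using hausdorff[of "fst p" "snd p"] by auto
    then show ?thesis by (intro exI[of _ "(U, V)"]) simp
  qed simp
  then have "\<exists>W. \<forall>p :: 'p \<times> 'p. fst p \<noteq> snd p \<longrightarrow> open (fst (W p)) \<and> open (snd (W p)) \<and>
      fst p \<in> fst (W p) \<and> snd p \<in> snd (W p) \<and> fst (W p) \<inter> snd (W p) = {}"
    by (intro choice allI)
  then obtain W where W: "\<forall>p :: 'p \<times> 'p. fst p \<noteq> snd p \<longrightarrow> open (fst (W p)) \<and> open (snd (W p)) \<and>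
      fst p \<in> fst (W p) \<and> snd p \<in> snd (W p) \<and> fst (W p) \<inter> snd (W p) = {}" ..
  define U V where "U = (\<lambda>x y. fst (W (x, y)))" and "V = (\<lambda>x y. snd (W (x, y)))"
  have UV: "open (U x y)" "open (V x y)" "x \<in> U x y" "y \<in> V x y" "U x y \<inter> V x y = {}" if "x \<noteq> y" for x y
    using W[rule_format, of "(x, y)"] that by (simp_all add: U_def V_def)
  define B where "B = (\<lambda>x. \<Inter>y\<in>F - {x}. U x y \<inter> V y x)"
  show ?thesis
  proof (rule that)
    show "open (B x)" if "x \<in> F" for x
      unfolding B_def using assms by (intro open_INT ballI open_Int UV) auto
    show "x \<in> B x" if "x \<in> F" for x
      unfolding B_def by (intro INT_I IntI UV) auto
    show "B x \<inter> B y = {}" if "x \<in> F" "y \<in> F" "x \<noteq> y" for x y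
    proof -
      have "B x \<subseteq> U x y" "B y \<subseteq> V x y" using that by (auto simp: B_def)
      then show ?thesis using UV(5)[OF that(3)] by blast
    qed
  qed
qed

lemma blinfun_norm_gtE:
  assumes "c < norm A" "0 \<le> c"
  obtains x where "norm x \<le> 1" "c < norm (blinfun_apply A x)"
proof -
  have "\<exists>x. norm x \<le> 1 \<and> c < norm (blinfun_apply A x)"
  proof (rule ccontr)
    assume neg: "\<not> ?thesis"
    have "norm A \<le> c"
    proof (rule norm_blinfun_bound[OF assms(2)])
      fix x
      show "norm (blinfun_apply A x) \<le> c * norm x"
      proof (cases "x = 0")
        case False
        have "norm ((1 / norm x) *\<^sub>R x) \<le> 1" using False by simp
        with neg have "norm (blinfun_apply A ((1 / norm x) *\<^sub>R x)) \<le> c"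
          by (meson not_less)
        then have "norm (blinfun_apply A x) / norm x \<le> c"
          by (simp add: blinfun.scaleR_right)
        then show ?thesis using False by (simp add: divide_le_eq)
      qed simp
    qed
    then show False using assms(1) by simp
  qed
  then show ?thesis using that by (elim exE conjE)
qed

lemma (in normed_space) compact_finite_combinations:
  assumes "finite F"
  shows "compact {\<Sum>i\<in>F. scale (a i) (y i) |a. \<forall>i\<in>F. norm (a i) \<le> 1}"
  using assms
proof (induction F)
  case empty
  then show ?case by simp
next
  case (insert j F)
  let ?S = "\<lambda>F. {\<Sum>i\<in>F. scale (a i) (y i) |a. \<forall>i\<in>F. norm (a i) \<le> 1}"
  have bl: "bounded_linear (\<lambda>a. scale a (y j))"
  proof (rule bounded_linear_intro[of _ "norm (y j)"])
    show "scale (r *\<^sub>R a) (y j) = r *\<^sub>R scale a (y j)" for r a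
      using scale_of_real[of r "scale a (y j)"] by (simp add: scaleR_conv_of_real)
  qed (simp_all add: scale_left_distrib norm_scale)
  have "continuous_on (cball (0 :: 'k) 1 \<times> ?S F) (\<lambda>p. scale (fst p) (y j) + snd p)"
    by (intro continuous_on_add bounded_linear.continuous_on[OF bl] continuous_on_fst continuous_on_snd continuous_on_id)
  then have "compact ((\<lambda>p. scale (fst p) (y j) + snd p) ` (cball (0 :: 'k) 1 \<times> ?S F))"
    by (rule compact_continuous_image) (intro compact_Times compact_cball insert.IH)
  moreover have "(\<lambda>p. scale (fst p) (y j) + snd p) ` (cball (0 :: 'k) 1 \<times> ?S F) = ?S (insert j F)"
    (is "?L = ?R")
  proof
    show "?L \<subseteq> ?R"
    proof
      fix z assume "z \<in> ?L"
      then obtain c a where ca: "norm (c :: 'k) \<le> 1" "\<forall>i\<in>F. norm (a i) \<le> 1"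
        "z = scale c (y j) + (\<Sum>i\<in>F. scale (a i) (y i))"
        by (elim imageE SigmaE CollectE exE conjE) (rule that; simp)
      have "(\<Sum>i\<in>F. scale ((a(j := c)) i) (y i)) = (\<Sum>i\<in>F. scale (a i) (y i))"
        using insert.hyps by (intro sum.cong) auto
      then have "z = (\<Sum>i\<in>insert j F. scale ((a(j := c)) i) (y i))"
        using ca(3) insert.hyps by (subst sum.insert) simp_all
      moreover have "\<forall>i\<in>insert j F. norm ((a(j := c)) i) \<le> 1" using ca by auto
      ultimately show "z \<in> ?R" by (intro CollectI exI[of _ "a(j := c)"] conjI)
    qed
    show "?R \<subseteq> ?L"
    proof
      fix z assume "z \<in> ?R"
      then obtain a where a: "\<forall>i\<in>insert j F. norm (a i :: 'k) \<le> 1" "z = (\<Sum>i\<in>insert j F. scale (a i) (y i))"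
        by (elim CollectE exE conjE) (rule that)
      then have "z = scale (a j) (y j) + (\<Sum>i\<in>F. scale (a i) (y i))" using insert.hyps by simp
      then show "z \<in> ?L"
        using a(1) by (intro image_eqI[of _ _ "(a j, \<Sum>i\<in>F. scale (a i) (y i))"] SigmaI CollectI exI[of _ a]) simp_all
    qed
  qed
  ultimately show ?case by simp
qed

lemma essential_norm_le:
  assumes "S \<in> compact_operators s t"
  shows "essential_norm s t T \<le> norm (T - S)"
  unfolding essential_norm_def
  by (rule cInf_lower) (use assms in \<open>auto intro!: bdd_belowI[of _ 0]\<close>)

text \<open>
  The compact operators into a Banach space form a closed set.
\<close>

lemma essential_norm_pos:
  fixes T :: "'x::real_normed_vector \<Rightarrow>\<^sub>L 'y::banach"
  assumes s: "normed_space s" and t: "normed_space t"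
    and T: "T \<in> operators s t" "T \<notin> compact_operators s t"
  shows "essential_norm s t T > 0"
proof (rule ccontr)
  assume "\<not> essential_norm s t T > 0"
  then have le0: "essential_norm s t T \<le> 0" by simp
  interpret s: normed_space s by (rule s)
  interpret t: normed_space t by (rule t)
  have "0 \<in> compact_operators s t"
    by (simp add: compact_operators_def operators_def Vector_Spaces.linear_iff s.vector_space_axioms
        t.vector_space_axioms image_constant_conv)
  then have ne: "{norm (T - S) |S. S \<in> compact_operators s t} \<noteq> {}" by blast
  have close: "\<exists>S\<in>compact_operators s t. norm (T - S) < e" if "e > 0" for e
    using cInf_lessD[OF ne, of e] le0 that by (auto simp: essential_norm_def)
  let ?C = "closure (blinfun_apply T ` cball 0 1)"
  have "\<exists>k. finite k \<and> ?C \<subseteq> (\<Union>x\<in>k. ball x e)" if e: "e > 0" for e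
  proof -
    obtain S where S: "S \<in> compact_operators s t" "norm (T - S) < e / 4" using close[of "e / 4"] e by auto
    then have "compact (closure (blinfun_apply S ` cball 0 1))" by (simp add: compact_operators_def)
    then obtain k where k: "finite k" "closure (blinfun_apply S ` cball 0 1) \<subseteq> (\<Union>x\<in>k. ball x (e / 4))"
      using e unfolding compact_eq_totally_bounded by (auto dest!: spec[of _ "e / 4"])
    have "blinfun_apply T ` cball 0 1 \<subseteq> (\<Union>x\<in>k. cball x (e / 2))"
    proof (rule image_subsetI)
      fix z :: 'x assume z: "z \<in> cball 0 1"
      then have "S z \<in> closure (blinfun_apply S ` cball 0 1)"
        by (intro subsetD[OF closure_subset]) auto
      then obtain x where x: "x \<in> k" "dist x (S z) < e / 4" using k(2) by auto
      have "dist (S z) (T z) = norm ((T - S) z)"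
        by (simp add: dist_norm norm_minus_commute blinfun.diff_left)
      also have "\<dots> \<le> norm (T - S) * 1"
        using z by (intro order_trans[OF norm_blinfun] mult_left_mono) auto
      finally have "dist x (T z) \<le> e / 2"
        using x(2) S(2) dist_triangle[of x "T z" "S z"] by simp
      then show "T z \<in> (\<Union>x\<in>k. cball x (e / 2))" using x(1) by auto
    qed
    then have "?C \<subseteq> (\<Union>x\<in>k. cball x (e / 2))" using k(1) by (intro closure_minimal closed_UN) auto
    also have "\<dots> \<subseteq> (\<Union>x\<in>k. ball x e)" using e by (intro UN_mono) (auto simp: mem_ball mem_cball)
    finally show ?thesis using k(1) by blast
  qed
  then have "compact ?C" unfolding compact_eq_totally_bounded by (simp add: complete_eq_closed)
  then show False using T by (simp add: compact_operators_def)
qed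

text \<open>
  The distance of \<open>T\<close> from the finite rank operator \<open>f \<mapsto> \<Sum>x\<in>F. f x \<cdot> T (K x)\<close> exceeds \<open>c\<close>, where the bumps \<open>K x\<close> have
  disjoint supports. The factor \<open>1 / 2\<close> normalizes \<open>f - (\<Sum>x\<in>F. f x \<cdot> K x)\<close>, whose norm may be twice that of \<open>f\<close>.
\<close>

lemma essential_norm_vanishing_witness:
  fixes T :: "('p::t2_space, 'k::real_or_complex) C0 \<Rightarrow>\<^sub>L 'x::real_normed_vector"
  assumes lc: "locally_compact_space (euclidean :: 'p topology)" and s: "normed_space s"
    and T: "T \<in> operators C0_scale s" and F: "finite F"
    and c: "0 \<le> c" "c < essential_norm C0_scale s T"
  obtains f where "norm f \<le> 1" "\<And>t. t \<in> F \<Longrightarrow> C0_apply f t = 0" "c / 2 < norm (T f)"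
proof -
  interpret s: normed_space s by (rule s)
  interpret C0: normed_space "C0_scale :: 'k \<Rightarrow> ('p, 'k) C0 \<Rightarrow> _" by (rule normed_space_C0)
  obtain B where B: "\<And>x. x \<in> F \<Longrightarrow> open (B x)" "\<And>x. x \<in> F \<Longrightarrow> x \<in> B x"
    "\<And>x y. x \<in> F \<Longrightarrow> y \<in> F \<Longrightarrow> x \<noteq> y \<Longrightarrow> B x \<inter> B y = {}"
    by (rule finite_t2_separation[OF F]) (rule that)
  have "\<forall>x\<in>F. \<exists>k. cutoff k \<and> k x = 1 \<and> (\<forall>t. t \<notin> B x \<longrightarrow> k t = 0) \<and> (\<forall>e>0. compact {t. e \<le> k t})"
  proof
    fix x assume "x \<in> F"
    obtain k where "cutoff k" "k x = 1" "\<And>t. t \<notin> B x \<Longrightarrow> k t = 0" "\<And>e. e > 0 \<Longrightarrow> compact {t. e \<le> k t}"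
      by (rule bump[OF lc B(1,2)[OF \<open>x \<in> F\<close>]]) (rule that)
    then show "\<exists>k. cutoff k \<and> k x = 1 \<and> (\<forall>t. t \<notin> B x \<longrightarrow> k t = 0) \<and> (\<forall>e>0. compact {t. e \<le> k t})"
      by (intro exI[of _ k] conjI allI impI)
  qed
  from bchoice[OF this] obtain k where kk: "\<forall>x\<in>F. cutoff (k x) \<and> k x x = 1 \<and>
    (\<forall>t. t \<notin> B x \<longrightarrow> k x t = 0) \<and> (\<forall>e>0. compact {t. e \<le> k x t})" ..
  note k = kk[THEN bspec, THEN conjunct1] kk[THEN bspec, THEN conjunct2, THEN conjunct1]
    kk[THEN bspec, THEN conjunct2, THEN conjunct2, THEN conjunct1, rule_format]
    kk[THEN bspec, THEN conjunct2, THEN conjunct2, THEN conjunct2, rule_format]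
  define K :: "'p \<Rightarrow> ('p, 'k) C0" where "K = (\<lambda>x. C0_of (\<lambda>t. of_real (k x t)))"
  have K: "C0_apply (K x) t = of_real (k x t)" if "x \<in> F" for x t
  proof -
    have cut: "continuous_on UNIV (k x)" "\<And>t. 0 \<le> k x t" using k(1)[OF that] by (auto simp: cutoff_def)
    have "C0_apply (C0_of (\<lambda>t. of_real (k x t) :: 'k)) = (\<lambda>t. of_real (k x t))"
      by (rule C0_apply_C0_of) (use cut k(4)[OF that] in \<open>auto intro!: continuous_intros\<close>)
    then show ?thesis by (simp add: K_def)
  qed
  have other: "k x t = 0" if "x \<in> F" "y \<in> F" "x \<noteq> y" "k y t \<noteq> 0" for x y t
  proof (rule k(3)[OF that(1)])
    have "t \<in> B y" using k(3)[OF that(2)] that(4) by metis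
    then show "t \<notin> B x" using B(3)[OF that(1-3)] by auto
  qed

  define S where "S = (\<lambda>f. \<Sum>x\<in>F. s (C0_apply f x) (T (K x)))"
  obtain S' where S': "S' \<in> operators C0_scale s" "blinfun_apply S' = S"
  proof (rule C0.operatorsI[OF s])
    show "S (f + g) = S f + S g" for f g
      by (simp add: S_def C0_apply_simps s.scale_left_distrib sum.distrib)
    show "S (C0_scale a f) = s a (S f)" for a f
      by (simp add: S_def C0_apply_simps s.scale_sum_right)
    show "norm (S f) \<le> (\<Sum>x\<in>F. norm (T (K x))) * norm f" for f
      unfolding S_def sum_distrib_right
      by (rule order_trans[OF norm_sum sum_mono])
        (unfold s.norm_scale, subst (2) mult.commute, rule mult_right_mono[OF norm_C0_apply_le norm_ge_zero])
  qed (rule that)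
  let ?S = "{\<Sum>x\<in>F. s (a x) (T (K x)) |a. \<forall>x\<in>F. norm (a x) \<le> 1}"
  have "blinfun_apply S' ` cball 0 1 \<subseteq> ?S"
  proof (rule image_subsetI)
    fix f :: "('p, 'k) C0" assume "f \<in> cball 0 1"
    then have "\<forall>x\<in>F. norm (C0_apply f x) \<le> 1" by (auto intro: order_trans[OF norm_C0_apply_le])
    then show "blinfun_apply S' f \<in> ?S"
      unfolding S'(2) S_def by (intro CollectI exI[of _ "C0_apply f"] conjI refl)
  qed
  moreover have comp: "compact ?S" by (rule s.compact_finite_combinations[OF F])
  ultimately have "closure (blinfun_apply S' ` cball 0 1) \<subseteq> ?S"
    by (intro closure_minimal compact_imp_closed)
  then have "compact (closure (blinfun_apply S' ` cball 0 1))"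
    using compact_Int_closed[OF comp, of "closure (blinfun_apply S' ` cball 0 1)"] by (simp add: Int_absorb1)
  then have "S' \<in> compact_operators C0_scale s" using S'(1) by (simp add: compact_operators_def)
  then have "c < norm (T - S')" using c(2) essential_norm_le less_le_trans by blast
  then obtain f0 where f0: "norm f0 \<le> 1" "c < norm ((T - S') f0)"
    by (rule blinfun_norm_gtE[OF _ c(1)])
  define h where "h = f0 - (\<Sum>x\<in>F. C0_scale (C0_apply f0 x) (K x))"
  have ht: "C0_apply h t = C0_apply f0 t - (\<Sum>x\<in>F. C0_apply f0 x * of_real (k x t))" for t
    by (simp add: h_def C0_apply_simps K)
  have single: "(\<Sum>x\<in>F. C0_apply f0 x * of_real (k x t)) = C0_apply f0 y * of_real (k y t)"
    if "y \<in> F" "k y t \<noteq> 0" for y t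
  proof -
    have "(\<Sum>x\<in>F. C0_apply f0 x * of_real (k x t)) = (\<Sum>x\<in>{y}. C0_apply f0 x * of_real (k x t))"
      using F that other[of _ y t] by (intro sum.mono_neutral_right) auto
    then show ?thesis by simp
  qed
  have "norm h \<le> 2"
  proof (rule norm_C0_le)
    fix t
    have f01: "norm (C0_apply f0 x) \<le> 1" for x by (rule order_trans[OF norm_C0_apply_le f0(1)])
    have "norm (\<Sum>x\<in>F. C0_apply f0 x * of_real (k x t)) \<le> 1"
    proof (cases "\<exists>y\<in>F. k y t \<noteq> 0")
      case True
      then obtain y where y: "y \<in> F" "k y t \<noteq> 0" ..
      have "\<bar>k y t\<bar> \<le> 1" using k(1)[OF y(1), unfolded cutoff_def, THEN conjunct2, THEN spec[of _ t]] by linarith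
      then have "norm (C0_apply f0 y) * \<bar>k y t\<bar> \<le> 1" using f01[of y] by (intro mult_le_one) auto
      then show ?thesis by (simp only: single[OF y] norm_mult norm_of_real)
    next
      case False
      then have "(\<Sum>x\<in>F. C0_apply f0 x * of_real (k x t)) = 0" by (intro sum.neutral) auto
      then show ?thesis by (simp only: norm_zero zero_le_one)
    qed
    then show "norm (C0_apply h t) \<le> 2"
      unfolding ht using norm_triangle_ineq4[of "C0_apply f0 t" "\<Sum>x\<in>F. C0_apply f0 x * of_real (k x t)"] f01[of t]
      by linarith
  qed
  moreover have "C0_apply h t = 0" if "t \<in> F" for t
    using single[OF that, of t] k(2)[OF that] by (simp add: ht)
  moreover have "T h = (T - S') f0"
    by (simp add: h_def blinfun.diff_left blinfun.diff_right blinfun.sum_right operators_scale[OF T] S'(2) S_def)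
  ultimately show ?thesis
    using that[of "(1 / 2) *\<^sub>R h"] f0(2) by (simp add: C0_apply_simps blinfun.scaleR_right)
qed


section \<open>Disjoint supports\<close>

text \<open>
  Functions with disjoint supports in the unit ball can be rotated and added without leaving it.
\<close>

lemma sum_norm_disjoint_le:
  fixes \<mu> :: "('p::topological_space, 'k::real_or_complex) C0 \<Rightarrow>\<^sub>L 'k"
  assumes \<mu>: "\<mu> \<in> dual C0_scale" and Q: "finite Q"
    and f: "\<And>n. n \<in> Q \<Longrightarrow> norm (f n) \<le> 1"
    and disj: "\<And>m n t. m \<in> Q \<Longrightarrow> n \<in> Q \<Longrightarrow> m \<noteq> n \<Longrightarrow> C0_apply (f m) t \<noteq> 0 \<Longrightarrow> C0_apply (f n) t = 0"
  shows "(\<Sum>n\<in>Q. norm (\<mu> (f n))) \<le> norm \<mu>"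
proof -
  have "\<exists>w. norm w = 1 \<and> w * \<mu> (f n) = of_real (norm (\<mu> (f n)))" for n
    by (rule phase[of "\<mu> (f n)"]) (intro exI conjI)
  then have "\<exists>w. \<forall>n. norm (w n) = 1 \<and> w n * \<mu> (f n) = of_real (norm (\<mu> (f n)))"
    by (intro choice allI)
  then obtain w where w: "\<forall>n. norm (w n) = 1 \<and> w n * \<mu> (f n) = of_real (norm (\<mu> (f n)))" ..
  define h where "h = (\<Sum>n\<in>Q. C0_scale (w n) (f n))"
  have "norm h \<le> 1"
  proof (rule norm_C0_le)
    fix t
    have ht: "C0_apply h t = (\<Sum>n\<in>Q. w n * C0_apply (f n) t)" by (simp add: h_def C0_apply_simps)
    show "norm (C0_apply h t) \<le> 1"
    proof (cases "\<exists>m\<in>Q. C0_apply (f m) t \<noteq> 0")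
      case True
      then obtain m where m: "m \<in> Q" "C0_apply (f m) t \<noteq> 0" ..
      have "C0_apply h t = (\<Sum>n\<in>{m}. w n * C0_apply (f n) t)"
        unfolding ht using Q m disj[OF m(1) _ _ m(2)] by (intro sum.mono_neutral_right) auto
      then have "norm (C0_apply h t) = norm (C0_apply (f m) t)" using w by (simp add: norm_mult)
      also have "\<dots> \<le> 1" by (rule order_trans[OF norm_C0_apply_le f[OF m(1)]])
      finally show ?thesis .
    next
      case False
      then have "C0_apply h t = 0" unfolding ht by (intro sum.neutral) auto
      then show ?thesis by simp
    qed
  qed
  then have "norm (\<mu> h) \<le> norm \<mu>"
    using norm_blinfun[of \<mu> h] mult_left_mono[of "norm h" 1 "norm \<mu>"] by simp
  moreover have "\<mu> h = of_real (\<Sum>n\<in>Q. norm (\<mu> (f n)))"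
    unfolding h_def blinfun.sum_right operators_scale[OF \<mu>] using w by simp
  ultimately have "\<bar>\<Sum>n\<in>Q. norm (\<mu> (f n))\<bar> \<le> norm \<mu>"
    by (simp only: norm_of_real)
  then show ?thesis by linarith
qed

lemma finite_bump:
  fixes H :: "'p::t2_space set"
  assumes lc: "locally_compact_space (euclidean :: 'p topology)" and "finite H" "open U" "H \<subseteq> U"
  obtains k where "cutoff k" "\<And>t. t \<in> H \<Longrightarrow> k t = 1" "\<And>t. t \<notin> U \<Longrightarrow> k t = 0"
proof -
  have "\<exists>k. cutoff k \<and> (\<forall>t\<in>H. k t = 1) \<and> (\<forall>t. t \<notin> U \<longrightarrow> k t = 0)"
    using assms(2,4)
  proof (induction H)
    case empty
    have "cutoff (\<lambda>t :: 'p. 0)" by (simp add: cutoff_def)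
    then show ?case by (intro exI[of _ "\<lambda>t. 0"]) simp
  next
    case (insert x H)
    then obtain k where k: "cutoff k" "\<forall>t\<in>H. k t = 1" "\<forall>t. t \<notin> U \<longrightarrow> k t = 0" by auto
    have "x \<in> U" using insert.prems by simp
    then obtain j where j: "cutoff j" "j x = 1" "\<And>t. t \<notin> U \<Longrightarrow> j t = 0"
      by (rule bump[OF lc assms(3)]) (rule that)
    have "cutoff (\<lambda>t. 1 - (1 - k t) * (1 - j t))"
      by (intro cutoff_compl cutoff_mult k j)
    then show ?case
      using k j by (intro exI[of _ "\<lambda>t. 1 - (1 - k t) * (1 - j t)"]) simp
  qed
  then show ?thesis using that by (elim exE conjE) simp
qed

lemma infinite_subset_card:
  assumes "infinite N"
  obtains Q where "Q \<subseteq> N" "finite Q" "card Q = n"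
  using infinite_arbitrarily_large[OF assms, of n] that by auto

text \<open>
  One step of the selection. The cut-off function \<open>P\<close> is \<open>1\<close> on the supports of the humps chosen so far, and the functionals
  with index in \<open>N\<close> have little mass on it. The sets \<open>F (Suc n) - F n\<close> carry the humps and are pairwise
  disjoint, so finitely many of them have disjoint neighbourhoods outside \<open>{P = 1}\<close>. Each functional has small mass on one of these
  neighbourhoods, hence infinitely many functionals have small mass on the same one: the hump living there is chosen, and only those
  functionals are kept.
\<close>

lemma disjointify_step:
  fixes \<mu> :: "nat \<Rightarrow> ('p::t2_space, 'k::real_or_complex) C0 \<Rightarrow>\<^sub>L 'k"
  assumes lc: "locally_compact_space (euclidean :: 'p topology)"
    and \<mu>: "\<And>n. \<mu> n \<in> dual C0_scale" "\<And>n. norm (\<mu> n) \<le> M"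
    and F: "\<And>n. finite (F n)" "\<And>n. F n \<subseteq> F (Suc n)"
    and f: "\<And>n. norm (f n) \<le> 1" "\<And>n t. t \<in> F n \<Longrightarrow> C0_apply (f n) t = 0"
    and small: "\<And>n h. (\<And>t. t \<in> F (Suc n) \<Longrightarrow> C0_apply h t = 0) \<Longrightarrow> norm ((\<mu> n) h) \<le> \<eta> * norm h"
    and large: "\<And>n. b \<le> norm ((\<mu> n) (f n))" and \<eta>: "\<eta> \<ge> 0"
    and N: "infinite N" and P: "cutoff P"
    and \<epsilon>: "\<epsilon> \<ge> 0" "\<And>n h. n \<in> N \<Longrightarrow> norm ((\<mu> n) (cut P h)) \<le> \<epsilon> * norm h"
    and \<epsilon>': "\<epsilon>' > 0"
  obtains i N' p g where "i \<in> N" "N' \<subseteq> N" "infinite N'" "\<And>n. n \<in> N' \<Longrightarrow> i < n"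
    "cutoff p" "norm g \<le> 1" "\<And>t. p t \<noteq> 1 \<Longrightarrow> C0_apply g t = 0" "\<And>t. P t = 1 \<Longrightarrow> C0_apply g t = 0"
    "\<And>t. t \<in> F i \<Longrightarrow> C0_apply g t = 0" "b - \<eta> - \<epsilon> \<le> norm ((\<mu> i) g)"
    "\<And>n h. n \<in> N' \<Longrightarrow> norm ((\<mu> n) (cut (\<lambda>t. P t + (1 - P t) * p t) h)) \<le> (\<epsilon> + \<epsilon>') * norm h"
proof -
  obtain m where m: "M < real m * \<epsilon>'" using reals_Archimedean3[OF \<epsilon>'] by blast
  obtain Q where Q: "Q \<subseteq> N" "finite Q" "card Q = m" by (rule infinite_subset_card[OF N])
  define H where "H = (\<lambda>n. F (Suc n) - F n - {t. P t = 1})"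
  have Fmono: "F n \<subseteq> F n'" if "n \<le> n'" for n n' using that by (rule lift_Suc_mono_le[of F, OF F(2)])
  have H_disj: "H n \<inter> H n' = {}" if "n < n'" for n n'
    using Fmono[of "Suc n" n'] that by (auto simp: H_def)
  then have H_disj: "H n \<inter> H n' = {}" if "n \<noteq> n'" for n n'
    using that by (cases n n' rule: linorder_cases) auto
  define Z where "Z = (\<Union>n\<in>Q. H n)"
  have "finite Z" using Q(2) F(1) by (auto simp: Z_def H_def)
  then obtain B where B: "\<And>x. x \<in> Z \<Longrightarrow> open (B x)" "\<And>x. x \<in> Z \<Longrightarrow> x \<in> B x"
    "\<And>x y. x \<in> Z \<Longrightarrow> y \<in> Z \<Longrightarrow> x \<noteq> y \<Longrightarrow> B x \<inter> B y = {}"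
    by (rule finite_t2_separation) (rule that)
  have "closed {t. P t = 1}"
    using P by (intro closed_Collect_eq continuous_intros) (simp add: cutoff_def)
  define U where "U = (\<lambda>n. (\<Union>z\<in>H n. B z) - {t. P t = 1})"
  have HZ: "H n \<subseteq> Z" if "n \<in> Q" for n using that by (auto simp: Z_def)
  have openU: "open (U n)" if "n \<in> Q" for n
    unfolding U_def using HZ[OF that] B(1) \<open>closed {t. P t = 1}\<close> by (intro open_Diff open_UN ballI) auto
  have HU: "H n \<subseteq> U n" if "n \<in> Q" for n
  proof
    fix z assume z: "z \<in> H n"
    then have "z \<in> B z" using HZ[OF that] B(2) by auto
    then show "z \<in> U n" using z by (auto simp: U_def H_def)
  qed
  have U_disj: "t \<notin> U n'" if nn': "n \<in> Q" "n' \<in> Q" "n \<noteq> n'" and t: "t \<in> U n" for n n' t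
  proof
    assume "t \<in> U n'"
    then obtain z' where z': "z' \<in> H n'" "t \<in> B z'" by (auto simp: U_def)
    obtain z where z: "z \<in> H n" "t \<in> B z" using t by (auto simp: U_def)
    have "z \<noteq> z'" using H_disj[OF nn'(3)] z z' by auto
    then have "B z \<inter> B z' = {}" using B(3) HZ nn' z z' by auto
    then show False using z z' by auto
  qed

  \<comment> \<open>The masses of one functional on the \<open>m\<close> disjoint open sets add up to at most \<open>M < m \<epsilon>'\<close>,
    so one of the masses is at most \<open>\<epsilon>'\<close>.\<close>
  define small_on where "small_on = (\<lambda>n n'. \<forall>h. (\<forall>t. t \<notin> U n \<longrightarrow> C0_apply h t = 0) \<longrightarrow>
      norm ((\<mu> n') h) \<le> \<epsilon>' * norm h)"
  have ex: "\<exists>n\<in>Q. small_on n n'" for n'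
  proof (rule ccontr)
    assume neg: "\<not> ?thesis"
    have "\<forall>n\<in>Q. \<exists>h. norm h \<le> 1 \<and> (\<forall>t. t \<notin> U n \<longrightarrow> C0_apply h t = 0) \<and> \<epsilon>' \<le> norm ((\<mu> n') h)"
    proof
      fix n assume "n \<in> Q"
      with neg have "\<not> small_on n n'" by auto
      then obtain h where h: "\<forall>t. t \<notin> U n \<longrightarrow> C0_apply h t = 0" "\<epsilon>' * norm h < norm ((\<mu> n') h)"
        by (auto simp: small_on_def not_le)
      then have "h \<noteq> 0" by auto
      then have "\<epsilon>' \<le> norm ((\<mu> n') ((1 / norm h) *\<^sub>R h))" "norm ((1 / norm h) *\<^sub>R h) \<le> 1"
        using h(2) by (simp_all add: blinfun.scaleR_right le_divide_eq)
      moreover have "\<forall>t. t \<notin> U n \<longrightarrow> C0_apply ((1 / norm h) *\<^sub>R h) t = 0" using h(1) by (simp add: C0_apply_simps)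
      ultimately show "\<exists>h. norm h \<le> 1 \<and> (\<forall>t. t \<notin> U n \<longrightarrow> C0_apply h t = 0) \<and> \<epsilon>' \<le> norm ((\<mu> n') h)"
        by (intro exI[of _ "(1 / norm h) *\<^sub>R h"] conjI)
    qed
    from bchoice[OF this] obtain h where h: "\<forall>n\<in>Q. norm (h n) \<le> 1 \<and>
      (\<forall>t. t \<notin> U n \<longrightarrow> C0_apply (h n) t = 0) \<and> \<epsilon>' \<le> norm ((\<mu> n') (h n))" ..
    have "real m * \<epsilon>' \<le> (\<Sum>n\<in>Q. norm ((\<mu> n') (h n)))"
      using sum_mono[of Q "\<lambda>n. \<epsilon>'" "\<lambda>n. norm ((\<mu> n') (h n))"] h Q(3) by simp
    also have "\<dots> \<le> norm (\<mu> n')"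
    proof (rule sum_norm_disjoint_le[OF \<mu>(1) Q(2)])
      show "C0_apply (h n2) t = 0" if "n1 \<in> Q" "n2 \<in> Q" "n1 \<noteq> n2" "C0_apply (h n1) t \<noteq> 0" for n1 n2 t
      proof -
        have "t \<in> U n1" using h that(1,4) by auto
        then have "t \<notin> U n2" by (rule U_disj[OF that(1-3)])
        then show ?thesis using h that(2) by auto
      qed
    qed (use h in auto)
    also have "\<dots> < real m * \<epsilon>'" using \<mu>(2)[of n'] m by linarith
    finally show False by simp
  qed
  have "infinite (\<Union>n\<in>Q. {n'\<in>N. small_on n n'})"
  proof -
    have "N \<subseteq> (\<Union>n\<in>Q. {n'\<in>N. small_on n n'})" using ex by auto
    then show ?thesis using N finite_subset by auto
  qed
  then obtain i where i: "i \<in> Q" "infinite {n'\<in>N. small_on i n'}" using Q(2) by auto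
  define N' where "N' = {n'\<in>N. small_on i n'} - {..i}"
  have N': "infinite N'" unfolding N'_def using i(2) by (rule Diff_infinite_finite[rotated]) simp

  have "finite (H i)" using F(1) by (simp add: H_def)
  then obtain k where k: "cutoff k" "\<And>t. t \<in> H i \<Longrightarrow> k t = 1" "\<And>t. t \<notin> U i \<Longrightarrow> k t = 0"
    by (rule finite_bump[OF lc _ openU[OF i(1)] HU[OF i(1)]]) (rule that)
  have kc: "continuous_on UNIV k" "0 \<le> k t" "k t \<le> 1" for t using k(1) by (simp_all add: cutoff_def)
  \<comment> \<open>Where \<open>r\<close> does not vanish, \<open>p\<close> is already \<open>1\<close>.\<close>
  define p r where "p = (\<lambda>t. min 1 (2 * k t))" and "r = (\<lambda>t. max 0 (2 * k t - 1))"
  have p: "cutoff p" and r: "cutoff r"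
    using kc by (auto simp: cutoff_def p_def r_def intro!: continuous_intros)
  define g where "g = cut r (f i)"
  have gt: "C0_apply g t = of_real (r t) * C0_apply (f i) t" for t
    by (simp add: g_def C0_apply_cut[OF r])
  have "norm ((\<mu> i) (f i - g)) \<le> \<epsilon> + \<eta>"
  proof -
    define u where "u = cut (\<lambda>t. 1 - r t) (f i)"
    have u1: "norm u \<le> 1" unfolding u_def by (rule order_trans[OF norm_cut_le[OF cutoff_compl[OF r]] f(1)])
    have "f i - g = u" unfolding g_def u_def using cut_split[OF r, of "f i"] by (metis add_diff_cancel_left')
    have "norm ((\<mu> i) (cut P u)) \<le> \<epsilon> * norm u" by (rule \<epsilon>(2)) (use i Q in auto)
    also have "\<dots> \<le> \<epsilon> * 1" using u1 \<epsilon>(1) by (rule mult_left_mono)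
    finally have 1: "norm ((\<mu> i) (cut P u)) \<le> \<epsilon>" by simp
    have "norm ((\<mu> i) (cut (\<lambda>t. 1 - P t) u)) \<le> \<eta> * norm (cut (\<lambda>t. 1 - P t) u)"
    proof (rule small)
      fix t assume t: "t \<in> F (Suc i)"
      have "C0_apply (cut (\<lambda>t. 1 - P t) u) t = of_real (1 - P t) * (of_real (1 - r t) * C0_apply (f i) t)"
        by (simp add: u_def C0_apply_cut[OF cutoff_compl[OF P]] C0_apply_cut[OF cutoff_compl[OF r]])
      moreover have "P t = 1 \<or> r t = 1 \<or> C0_apply (f i) t = 0"
        using t k(2)[of t] f(2)[of t i]
        by (cases "t \<in> F i"; cases "P t = 1") (simp_all add: H_def r_def)
      ultimately show "C0_apply (cut (\<lambda>t. 1 - P t) u) t = 0" by auto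
    qed
    also have "\<dots> \<le> \<eta> * 1"
      using order_trans[OF norm_cut_le[OF cutoff_compl[OF P]] u1] \<eta> by (rule mult_left_mono)
    finally have 2: "norm ((\<mu> i) (cut (\<lambda>t. 1 - P t) u)) \<le> \<eta>" by simp
    have eq: "(\<mu> i) u = (\<mu> i) (cut P u) + (\<mu> i) (cut (\<lambda>t. 1 - P t) u)"
      by (subst cut_split[OF P, of u]) (rule blinfun.add_right)
    show ?thesis
      unfolding \<open>f i - g = u\<close> eq
      using norm_triangle_ineq[of "(\<mu> i) (cut P u)" "(\<mu> i) (cut (\<lambda>t. 1 - P t) u)"] 1 2
      by linarith
  qed
  then have g_large: "b - \<eta> - \<epsilon> \<le> norm ((\<mu> i) g)"
    using large[of i] norm_triangle_ineq2[of "(\<mu> i) (f i)" "(\<mu> i) g"]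
    unfolding blinfun.diff_right by linarith

  show ?thesis
  proof (rule that)
    show "i \<in> N" using i Q by auto
    show "N' \<subseteq> N" "\<And>n. n \<in> N' \<Longrightarrow> i < n" by (auto simp: N'_def)
    show "infinite N'" "cutoff p" by (fact N' p)+
    show "norm g \<le> 1" unfolding g_def by (rule order_trans[OF norm_cut_le[OF r] f(1)])
    show "C0_apply g t = 0" if "p t \<noteq> 1" for t using that by (auto simp: gt p_def r_def)
    show "C0_apply g t = 0" if "P t = 1" for t using that k(3)[of t] by (simp add: gt r_def U_def)
    show "C0_apply g t = 0" if "t \<in> F i" for t using f(2)[OF that] by (simp add: gt)
    show "b - \<eta> - \<epsilon> \<le> norm ((\<mu> i) g)" by (fact g_large)
    fix n and h :: "('p, 'k) C0" assume n: "n \<in> N'"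
    define h' where "h' = cut (\<lambda>t. 1 - P t) h"
    have cut': "cutoff (\<lambda>t. P t + (1 - P t) * p t)"
    proof -
      have "cutoff (\<lambda>t. 1 - (1 - P t) * (1 - p t))" by (intro cutoff_compl cutoff_mult P p)
      also have "(\<lambda>t. 1 - (1 - P t) * (1 - p t)) = (\<lambda>t. P t + (1 - P t) * p t)"
        by (simp add: algebra_simps fun_eq_iff)
      finally show ?thesis .
    qed
    have "cut (\<lambda>t. P t + (1 - P t) * p t) h = cut P h + cut p h'"
      by (rule C0_eqI)
        (simp only: h'_def C0_apply_add C0_apply_cut[OF cut'] C0_apply_cut[OF P] C0_apply_cut[OF p]
          C0_apply_cut[OF cutoff_compl[OF P]], simp add: algebra_simps)
    then have "norm ((\<mu> n) (cut (\<lambda>t. P t + (1 - P t) * p t) h)) \<le>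
        norm ((\<mu> n) (cut P h)) + norm ((\<mu> n) (cut p h'))"
      by (simp add: blinfun.add_right norm_triangle_ineq)
    also have "norm ((\<mu> n) (cut P h)) \<le> \<epsilon> * norm h" using n by (intro \<epsilon>(2)) (simp add: N'_def)
    also have "norm ((\<mu> n) (cut p h')) \<le> \<epsilon>' * norm (cut p h')"
    proof -
      have "\<forall>t. t \<notin> U i \<longrightarrow> C0_apply (cut p h') t = 0"
        using k(3) unfolding C0_apply_cut[OF p] by (simp add: p_def)
      then show ?thesis using n by (simp add: N'_def small_on_def)
    qed
    also have "\<epsilon>' * norm (cut p h') \<le> \<epsilon>' * norm h"
      unfolding h'_def using \<epsilon>' by (intro mult_left_mono order_trans[OF norm_cut_le[OF p] norm_cut_le[OF cutoff_compl[OF P]]]) simp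
    finally show "norm ((\<mu> n) (cut (\<lambda>t. P t + (1 - P t) * p t) h)) \<le> (\<epsilon> + \<epsilon>') * norm h"
      by (simp add: distrib_right)
  qed
qed

text \<open>
  The last conclusion says that \<open>\<mu> (i m)\<close> is small on functions supported by the other humps. On the earlier humps this is due to the cut-off
  functions of the selection, and the later humps vanish on the finite set that carries \<open>\<mu> (i m)\<close>.
\<close>

theorem disjointify:
  fixes \<mu> :: "nat \<Rightarrow> ('p::t2_space, 'k::real_or_complex) C0 \<Rightarrow>\<^sub>L 'k"
  assumes lc: "locally_compact_space (euclidean :: 'p topology)"
    and \<mu>: "\<And>n. \<mu> n \<in> dual C0_scale" "\<And>n. norm (\<mu> n) \<le> M"
    and F: "\<And>n. finite (F n)" "\<And>n. F n \<subseteq> F (Suc n)"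
    and f: "\<And>n. norm (f n) \<le> 1" "\<And>n t. t \<in> F n \<Longrightarrow> C0_apply (f n) t = 0"
    and small: "\<And>n h. (\<And>t. t \<in> F (Suc n) \<Longrightarrow> C0_apply h t = 0) \<Longrightarrow> norm ((\<mu> n) h) \<le> \<eta> * norm h"
    and large: "\<And>n. b \<le> norm ((\<mu> n) (f n))" and \<eta>: "\<eta> > 0"
  obtains i g where "strict_mono (i :: nat \<Rightarrow> nat)" "\<And>k. norm (g k) \<le> 1"
    "\<And>k m t. k \<noteq> m \<Longrightarrow> C0_apply (g k) t \<noteq> 0 \<Longrightarrow> C0_apply (g m) t = 0"
    "\<And>k. b - 2 * \<eta> \<le> norm ((\<mu> (i k)) (g k))"
    "\<And>m h. (\<forall>t. C0_apply h t \<noteq> 0 \<longrightarrow> (\<exists>k. k \<noteq> m \<and> C0_apply (g k) t \<noteq> 0)) \<Longrightarrow>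
       norm ((\<mu> (i m)) h) \<le> 2 * \<eta> * norm h"
proof -
  \<comment> \<open>The \<open>k\<close>-th step may use up \<open>\<eta> / 2 ^ (k + 1)\<close> of the total error \<open>\<eta>\<close>.\<close>
  define e where "e = (\<lambda>k::nat. \<eta> * (1 - (1 / 2) ^ k))"
  have e: "0 \<le> e k" "e k \<le> \<eta>" "e k + \<eta> * (1 / 2) ^ Suc k = e (Suc k)" for k
    using \<eta> by (auto simp: e_def power_le_one right_diff_distrib)
  define A where "A = (\<lambda>k (N, P, i :: nat, g :: ('p, 'k) C0). infinite N \<and> cutoff P \<and>
    (\<forall>n\<in>N. \<forall>h. norm ((\<mu> n) (cut P h)) \<le> e k * norm h))"
  define R where "R = (\<lambda>(k::nat) (N :: nat set, P :: 'p \<Rightarrow> real, i :: nat, g :: ('p, 'k) C0)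
      (N' :: nat set, P' :: 'p \<Rightarrow> real, i', g').
    i' \<in> N \<and> N' \<subseteq> N \<and> (\<forall>n\<in>N'. i' < n) \<and> norm g' \<le> 1 \<and> (\<forall>t. P' t \<noteq> 1 \<longrightarrow> C0_apply g' t = 0) \<and>
    (\<forall>t. P t = 1 \<longrightarrow> P' t = 1 \<and> C0_apply g' t = 0) \<and> (\<forall>t\<in>F i'. C0_apply g' t = 0) \<and>
    b - 2 * \<eta> \<le> norm ((\<mu> i') g'))"
  have "\<exists>st. \<forall>k. A k (st k) \<and> R k (st k) (st (Suc k))"
  proof (rule dependent_nat_choice)
    have "cutoff (\<lambda>t :: 'p. 0)" by (simp add: cutoff_def)
    moreover have "cut (\<lambda>t :: 'p. 0) h = 0" for h :: "('p, 'k) C0"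
      by (rule C0_eqI) (simp add: C0_apply_simps C0_apply_cut cutoff_def)
    ultimately have "A 0 (UNIV, \<lambda>t. 0, 0, 0)" by (simp add: A_def e_def)
    then show "\<exists>st. A 0 st" ..
    fix st k assume A: "A k st"
    obtain N P i0 g0 where st: "st = (N, P, i0, g0)" by (cases st)
    have N: "infinite N" and P: "cutoff P"
      and bound: "\<And>n h. n \<in> N \<Longrightarrow> norm ((\<mu> n) (cut P h)) \<le> e k * norm h"
      using A by (simp_all add: A_def st)
    have pos: "\<eta> * (1 / 2) ^ Suc k > 0" using \<eta> by simp
    obtain i N' p g where *: "i \<in> N" "N' \<subseteq> N" "infinite N'" "\<And>n. n \<in> N' \<Longrightarrow> i < n"
      "cutoff p" "norm g \<le> 1" "\<And>t. p t \<noteq> 1 \<Longrightarrow> C0_apply g t = 0" "\<And>t. P t = 1 \<Longrightarrow> C0_apply g t = 0"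
      "\<And>t. t \<in> F i \<Longrightarrow> C0_apply g t = 0" "b - \<eta> - e k \<le> norm ((\<mu> i) g)"
      "\<And>n h. n \<in> N' \<Longrightarrow> norm ((\<mu> n) (cut (\<lambda>t. P t + (1 - P t) * p t) h)) \<le>
        (e k + \<eta> * (1 / 2) ^ Suc k) * norm h"
      by (rule disjointify_step[where f = f and \<mu> = \<mu> and F = F and M = M and b = b and \<eta> = \<eta>
          and N = N and P = P and \<epsilon> = "e k" and \<epsilon>' = "\<eta> * (1 / 2) ^ Suc k",
        OF lc \<mu> F f small large less_imp_le[OF \<eta>] N P e(1) bound pos]) (assumption | rule that)+
    define P' where "P' = (\<lambda>t. P t + (1 - P t) * p t)"
    have "cutoff (\<lambda>t. 1 - (1 - P t) * (1 - p t))" by (intro cutoff_compl cutoff_mult P *(5))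
    also have "(\<lambda>t. 1 - (1 - P t) * (1 - p t)) = P'" by (simp add: P'_def algebra_simps fun_eq_iff)
    finally have "cutoff P'" .
    then have "A (Suc k) (N', P', i, g)" using *(3) *(11)[unfolded e(3)] by (simp add: A_def P'_def)
    moreover have "R k st (N', P', i, g)"
    proof -
      have "C0_apply g t = 0" if "P' t \<noteq> 1" for t
      proof (rule *(7))
        show "p t \<noteq> 1" using that by (auto simp: P'_def)
      qed
      moreover have "P' t = 1" if "P t = 1" for t using that by (simp add: P'_def)
      moreover have "b - 2 * \<eta> \<le> norm ((\<mu> i) g)" using *(10) e(2)[of k] by linarith
      ultimately show ?thesis
        unfolding R_def st prod.case using *(1,2,4,6,8,9) by simp
    qed
    ultimately show "\<exists>st'. A (Suc k) st' \<and> R k st st'" by (intro exI conjI)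
  qed
  then obtain st where st: "\<forall>k. A k (st k) \<and> R k (st k) (st (Suc k))" ..
  define N P where "N = (\<lambda>k. fst (st k))" and "P = (\<lambda>k. fst (snd (st k)))"
  define i g where "i = (\<lambda>k. fst (snd (snd (st (Suc k)))))" and "g = (\<lambda>k. snd (snd (snd (st (Suc k)))))"
  have P: "cutoff (P k)" and NP: "n \<in> N k \<Longrightarrow> norm ((\<mu> n) (cut (P k) h)) \<le> e k * norm h" for k n h
    using st[THEN spec[of _ k]] by (simp_all add: A_def N_def P_def split_beta)
  have i: "i k \<in> N k" "N (Suc k) \<subseteq> N k" "n \<in> N (Suc k) \<Longrightarrow> i k < n"
    and g: "norm (g k) \<le> 1" "P (Suc k) t \<noteq> 1 \<Longrightarrow> C0_apply (g k) t = 0" "P k t = 1 \<Longrightarrow> P (Suc k) t = 1"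
      "P k t = 1 \<Longrightarrow> C0_apply (g k) t = 0" "t \<in> F (i k) \<Longrightarrow> C0_apply (g k) t = 0"
      "b - 2 * \<eta> \<le> norm ((\<mu> (i k)) (g k))" for k n t
    using st[THEN spec[of _ k]] by (simp_all add: R_def N_def P_def i_def g_def split_beta)
  have mono: "strict_mono i"
    using i(3)[OF i(1)] by (simp add: strict_mono_Suc_iff)
  have P1: "P m t = 1" if "C0_apply (g k) t \<noteq> 0" "k < m" for k m t
  proof -
    have "Suc k \<le> m" using that(2) by simp
    then show ?thesis
    proof (induction m rule: dec_induct)
      case base
      then show ?case using g(2)[of k t] that(1) by blast
    next
      case (step m)
      then show ?case using g(3)[of m t] by blast
    qed
  qed
  have Fmono: "F n \<subseteq> F n'" if "n \<le> n'" for n n' using that by (rule lift_Suc_mono_le[of F, OF F(2)])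
  show ?thesis
  proof (rule that[of i g])
    show "C0_apply (g m) t = 0" if "k \<noteq> m" "C0_apply (g k) t \<noteq> 0" for k m t
    proof (cases "k < m")
      case True
      then show ?thesis using P1[OF that(2)] g(4) by blast
    next
      case False
      then have "m < k" using that(1) by simp
      then show ?thesis using P1[of m t k] g(4)[of k t] that(2) by blast
    qed
    fix m and h :: "('p, 'k) C0"
    assume h: "\<forall>t. C0_apply h t \<noteq> 0 \<longrightarrow> (\<exists>k. k \<noteq> m \<and> C0_apply (g k) t \<noteq> 0)"
    have "norm ((\<mu> (i m)) (cut (P m) h)) \<le> e m * norm h" by (rule NP[OF i(1)])
    also have "\<dots> \<le> \<eta> * norm h" using e(2) by (rule mult_right_mono) simp
    finally have 1: "norm ((\<mu> (i m)) (cut (P m) h)) \<le> \<eta> * norm h" .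
    have "norm ((\<mu> (i m)) (cut (\<lambda>t. 1 - P m t) h)) \<le> \<eta> * norm (cut (\<lambda>t. 1 - P m t) h)"
    proof (rule small)
      fix t assume t: "t \<in> F (Suc (i m))"
      have "P m t = 1 \<or> C0_apply h t = 0"
      proof (cases "C0_apply h t = 0")
        case False
        then obtain k where k: "k \<noteq> m" "C0_apply (g k) t \<noteq> 0" using h by blast
        have "k < m"
        proof (rule ccontr)
          assume "\<not> k < m"
          then have "i m < i k" using k(1) mono by (simp add: strict_mono_less)
          then have "t \<in> F (i k)" using Fmono[of "Suc (i m)" "i k"] t by auto
          then show False using g(5) k(2) by blast
        qed
        then show ?thesis using P1[OF k(2)] by blast
      qed simp
      then show "C0_apply (cut (\<lambda>t. 1 - P m t) h) t = 0"
        unfolding C0_apply_cut[OF cutoff_compl[OF P]] by auto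
    qed
    also have "\<dots> \<le> \<eta> * norm h"
      using norm_cut_le[OF cutoff_compl[OF P]] less_imp_le[OF \<eta>] by (rule mult_left_mono)
    finally have 2: "norm ((\<mu> (i m)) (cut (\<lambda>t. 1 - P m t) h)) \<le> \<eta> * norm h" .
    have eq: "(\<mu> (i m)) h =
        (\<mu> (i m)) (cut (P m) h) + (\<mu> (i m)) (cut (\<lambda>t. 1 - P m t) h)"
      by (subst cut_split[OF P, of h m]) (rule blinfun.add_right)
    show "norm ((\<mu> (i m)) h) \<le> 2 * \<eta> * norm h"
      unfolding eq
      using norm_triangle_ineq[of "(\<mu> (i m)) (cut (P m) h)"
          "(\<mu> (i m)) (cut (\<lambda>t. 1 - P m t) h)"] 1 2 by linarith
  qed (fact mono g)+
qed

text \<open>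
  The operator \<open>x \<mapsto> \<Sum>k. x k \<cdot> g k\<close>; the sum converges uniformly because \<open>x\<close> is a null sequence.
\<close>

lemma disjoint_c0_embedding:
  fixes g :: "nat \<Rightarrow> ('p::topological_space, 'k::real_or_complex) C0"
  assumes g: "\<And>k. norm (g k) \<le> 1"
    and disj: "\<And>k m t. k \<noteq> m \<Longrightarrow> C0_apply (g k) t \<noteq> 0 \<Longrightarrow> C0_apply (g m) t = 0"
  obtains V where "V \<in> operators c0_scale C0_scale" "norm V \<le> 1"
    "\<And>x t k. C0_apply (g k) t \<noteq> 0 \<Longrightarrow> C0_apply (V x) t = c0_apply x k * C0_apply (g k) t"
    "\<And>x t. (\<forall>k. C0_apply (g k) t = 0) \<Longrightarrow> C0_apply (V x) t = 0"
proof -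
  interpret c0: normed_space "c0_scale :: 'k \<Rightarrow> _" by (rule normed_space_c0)
  define K where "K = (\<lambda>t. SOME k. C0_apply (g k) t \<noteq> 0)"
  define v where "v = (\<lambda>x t. c0_apply x (K t) * C0_apply (g (K t)) t)"
  have K: "K t = k" if "C0_apply (g k) t \<noteq> 0" for k t
  proof -
    have "C0_apply (g (K t)) t \<noteq> 0" unfolding K_def using that by (rule someI)
    then show ?thesis using disj[of "K t" k t] that by blast
  qed
  have v1: "v x t = c0_apply x k * C0_apply (g k) t" if "C0_apply (g k) t \<noteq> 0" for x k t
    using K[OF that] by (simp add: v_def)
  have v0: "v x t = 0" if "\<And>k. C0_apply (g k) t = 0" for x t
    using that by (simp add: v_def)
  have g1: "norm (C0_apply (g k) t) \<le> 1" for k t by (rule order_trans[OF norm_C0_apply_le g])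
  have vle: "norm (v x t) \<le> norm (c0_apply x (K t))" for x t
    using g1[of "K t" t] by (simp add: v_def norm_mult mult_left_le)
  have partial: "(\<Sum>k<n. c0_apply x k * C0_apply (g k) t) = (if K t < n then v x t else 0)" for x n t
  proof -
    have "(\<Sum>k<n. c0_apply x k * C0_apply (g k) t) = (\<Sum>k<n. if k = K t then v x t else 0)"
    proof (rule sum.cong[OF refl])
      fix k show "c0_apply x k * C0_apply (g k) t = (if k = K t then v x t else 0)"
        using K[of k t] by (cases "C0_apply (g k) t = 0") (auto simp: v_def)
    qed
    then show ?thesis by simp
  qed
  have tail: "\<exists>n. \<forall>k\<ge>n. norm (c0_apply x k) < e" if "e > 0" for x :: "'k c0" and e
    using LIMSEQ_D[OF c0_apply_tendsto that] by simp
  have cont: "continuous_on UNIV (v x)" for x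
  proof (rule uniform_limit_theorem)
    show "uniform_limit UNIV (\<lambda>n t. \<Sum>k<n. c0_apply x k * C0_apply (g k) t) (v x) sequentially"
    proof (rule uniform_limitI)
      fix e :: real assume "e > 0"
      then obtain n0 where n0: "\<forall>k\<ge>n0. norm (c0_apply x k) < e" using tail by blast
      have "dist (\<Sum>k<n. c0_apply x k * C0_apply (g k) t) (v x t) < e" if "n \<ge> n0" for n t
      proof (cases "K t < n")
        case False
        then have "norm (c0_apply x (K t)) < e" using n0 that by simp
        then show ?thesis using vle[of x t] False by (simp add: partial)
      qed (use \<open>e > 0\<close> in \<open>simp add: partial\<close>)
      then show "\<forall>\<^sub>F n in sequentially. \<forall>t\<in>UNIV. dist (\<Sum>k<n. c0_apply x k * C0_apply (g k) t) (v x t) < e"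
        by (intro eventually_sequentiallyI[of n0]) simp
    qed
    show "\<forall>\<^sub>F n in sequentially. continuous_on UNIV (\<lambda>t. \<Sum>k<n. c0_apply x k * C0_apply (g k) t)"
      by (intro always_eventually allI continuous_intros continuous_on_C0_apply)
  qed simp
  have compact: "compact {t. e \<le> norm (v x t)}" if e: "e > 0" for x e
  proof -
    obtain n where n: "\<forall>k\<ge>n. norm (c0_apply x k) < e" using tail[OF e] by blast
    define d where "d = e / (norm x + 1)"
    have nx: "norm x + 1 > 0" using norm_ge_zero[of x] by linarith
    then have d: "d > 0" using e by (simp add: d_def)
    have "compact (\<Union>k\<in>{..<n}. {t. d \<le> norm (C0_apply (g k) t)})"
      by (intro compact_UN compact_C0_ge d) simp
    moreover have "closed {t. e \<le> norm (v x t)}"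
      by (intro closed_Collect_le continuous_intros cont)
    moreover have "{t. e \<le> norm (v x t)} \<subseteq> (\<Union>k\<in>{..<n}. {t. d \<le> norm (C0_apply (g k) t)})"
    proof
      fix t assume "t \<in> {t. e \<le> norm (v x t)}"
      then have et: "e \<le> norm (v x t)" by simp
      then have "\<not> norm (c0_apply x (K t)) < e" using vle[of x t] by linarith
      then have "K t < n" using n by (meson not_le)
      have "e \<le> norm (c0_apply x (K t)) * norm (C0_apply (g (K t)) t)" using et by (simp add: v_def norm_mult)
      also have "\<dots> \<le> (norm x + 1) * norm (C0_apply (g (K t)) t)"
        using norm_c0_apply_le[of x "K t"] by (intro mult_right_mono) auto
      finally have "d \<le> norm (C0_apply (g (K t)) t)" using nx by (simp add: d_def divide_le_eq mult.commute)
      then show "t \<in> (\<Union>k\<in>{..<n}. {t. d \<le> norm (C0_apply (g k) t)})" using \<open>K t < n\<close> by blast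
    qed
    ultimately show ?thesis using compact_Int_closed by (metis Int_absorb1)
  qed
  have ap: "C0_apply (C0_of (v x)) = v x" for x by (rule C0_apply_C0_of[OF cont compact])
  have le: "norm (C0_of (v x)) \<le> 1 * norm x" for x
    by (rule norm_C0_le) (simp add: ap order_trans[OF vle norm_c0_apply_le])
  obtain V where V: "V \<in> operators c0_scale C0_scale" "blinfun_apply V = (\<lambda>x. C0_of (v x))"
  proof (rule c0.operatorsI[OF normed_space_C0, of "\<lambda>x. C0_of (v x)"])
    show "C0_of (v (x + y)) = C0_of (v x) + C0_of (v y)" for x y
      by (rule C0_eqI) (simp add: C0_apply_simps ap, simp add: v_def c0_apply_add distrib_right)
    show "C0_of (v (c0_scale a x)) = C0_scale a (C0_of (v x))" for a x
      by (rule C0_eqI) (simp add: C0_apply_simps ap, simp add: v_def c0_apply_scale mult.assoc)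
    show "norm (C0_of (v x)) \<le> 1 * norm x" for x by (rule le)
  qed (rule that)
  show ?thesis
  proof (rule that[OF V(1)])
    show "norm V \<le> 1" by (rule norm_blinfun_bound) (use le in \<open>simp_all add: V(2)\<close>)
    show "C0_apply (V x) t = c0_apply x k * C0_apply (g k) t" if "C0_apply (g k) t \<noteq> 0" for x t k
      using v1[OF that] by (simp add: V(2) ap)
    show "C0_apply (V x) t = 0" if "\<forall>k. C0_apply (g k) t = 0" for x t
      using v0[of t x] that by (simp add: V(2) ap)
  qed
qed


section \<open>The factorization\<close>

lemma operators_compose:
  assumes "A \<in> operators t u" "B \<in> operators s t"
  shows "A o\<^sub>L B \<in> operators s u"
  using assms unfolding operators_def Vector_Spaces.linear_iff by (simp add: blinfun.add_right)

text \<open>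
  The functionals and humps are constructed together with an increasing sequence of finite sets: each hump vanishes on the current
  set, which is then enlarged to carry the functional that norms its image. Rescaling the disjoint humps makes all diagonal values
  equal to \<open>\<beta>\<close>.
\<close>

lemma nearly_diagonal_operator:
  fixes T :: "('p::t2_space, 'k::real_or_complex) C0 \<Rightarrow>\<^sub>L 'x::real_normed_vector"
  assumes sc: "scattered (UNIV :: 'p set)" and lc: "locally_compact_space (euclidean :: 'p topology)"
    and s: "normed_space s" and T: "T \<in> operators C0_scale s"
    and \<beta>: "0 < \<beta>" "2 * \<beta> < essential_norm C0_scale s T" and \<eta>: "\<eta> > 0"
  obtains \<psi> V where "range \<psi> \<subseteq> dual s \<inter> cball 0 1" "V \<in> operators c0_scale C0_scale" "norm V \<le> 1"
    "\<And>m x. norm ((\<psi> m) (T (V x)) - of_real \<beta> * c0_apply x m) \<le> \<eta> * norm x"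
proof -
  interpret s: normed_space s by (rule s)
  obtain c where c: "2 * \<beta> < c" "c < essential_norm C0_scale s T" using dense[OF \<beta>(2)] by blast
  define \<kappa> where "\<kappa> = min (\<eta> / 2) (c / 4 - \<beta> / 2)"
  have \<kappa>: "\<kappa> > 0" "2 * \<kappa> \<le> \<eta>" "\<beta> \<le> c / 2 - 2 * \<kappa>" 
  proof -
    have "\<kappa> \<le> \<eta> / 2" unfolding \<kappa>_def by (rule min.cobounded1)
    then show "2 * \<kappa> \<le> \<eta>" by linarith
    have "\<kappa> \<le> c / 4 - \<beta> / 2" unfolding \<kappa>_def by (rule min.cobounded2)
    then show "\<beta> \<le> c / 2 - 2 * \<kappa>" by linarith
    show "\<kappa> > 0" using \<eta> c(1) by (simp add: \<kappa>_def)
  qed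
  have c0: "c \<ge> 0" using \<beta> c by linarith
  define Q where "Q = (\<lambda>F (\<psi> :: 'x \<Rightarrow>\<^sub>L 'k, f, F'). \<psi> \<in> dual s \<and> norm \<psi> \<le> 1 \<and> norm f \<le> 1 \<and>
    (\<forall>t\<in>F. C0_apply f t = 0) \<and> c / 2 \<le> norm (\<psi> (T f)) \<and> finite F' \<and> F \<subseteq> F' \<and>
    (\<forall>h. (\<forall>t\<in>F'. C0_apply h t = 0) \<longrightarrow> norm (\<psi> (T h)) \<le> \<kappa> * norm h))"
  have step: "\<exists>y. Q F y" if F: "finite F" for F
  proof -
    obtain f where f: "norm f \<le> 1" "\<And>t. t \<in> F \<Longrightarrow> C0_apply f t = 0" "c / 2 < norm (T f)"
      by (rule essential_norm_vanishing_witness[OF lc s T F c0 c(2)]) (rule that)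
    obtain \<psi> where \<psi>: "\<psi> \<in> dual s" "norm \<psi> \<le> 1"
      "norm (\<psi> (T f)) = norm (T f)"
      by (rule s.norming_functional) (rule that)
    obtain F' where F': "finite F'" "\<And>h. (\<forall>t\<in>F'. C0_apply h t = 0) \<Longrightarrow>
        norm ((\<psi> o\<^sub>L T) h) \<le> \<kappa> * norm h"
      by (rule scattered_functional_finitely_carried[OF sc operators_compose[OF \<psi>(1) T] \<kappa>(1)])
        (rule that)
    have "Q F (\<psi>, f, F \<union> F')"
      unfolding Q_def prod.case
    proof (intro conjI allI impI ballI)
      fix h :: "('p, 'k) C0" assume "\<forall>t\<in>F \<union> F'. C0_apply h t = 0"
      then show "norm (\<psi> (T h)) \<le> \<kappa> * norm h" using F'(2)[of h] by simp
    qed (use f \<psi> F F' in auto)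
    then show ?thesis ..
  qed
  have "\<exists>st. \<forall>n. finite (snd (snd (st n))) \<and> Q (snd (snd (st n))) (st (Suc n))"
  proof (rule dependent_nat_choice)
    \<comment> \<open>Only the finite set of the initial triple matters.\<close>
    show "\<exists>y. finite (snd (snd y))" by (rule exI[of _ "(undefined, undefined, {})"]) simp
    fix y :: "('x \<Rightarrow>\<^sub>L 'k) \<times> ('p, 'k) C0 \<times> 'p set" and n :: nat assume "finite (snd (snd y))"
    from step[OF this] obtain y' where "Q (snd (snd y)) y'" ..
    then show "\<exists>y'. finite (snd (snd y')) \<and> Q (snd (snd y)) y'"
      by (intro exI[of _ y']) (simp add: Q_def split_beta)
  qed
  then obtain st where st: "\<forall>n. finite (snd (snd (st n))) \<and> Q (snd (snd (st n))) (st (Suc n))" ..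
  define F where "F = (\<lambda>n. snd (snd (st n)))"
  define \<phi> f where "\<phi> = (\<lambda>n. fst (st (Suc n)))" and "f = (\<lambda>n. fst (snd (st (Suc n))))"
  have F: "finite (F n)" "F n \<subseteq> F (Suc n)" and \<phi>: "\<phi> n \<in> dual s" "norm (\<phi> n) \<le> 1"
    and f: "norm (f n) \<le> 1" "t \<in> F n \<Longrightarrow> C0_apply (f n) t = 0"
    and large: "c / 2 \<le> norm ((\<phi> n o\<^sub>L T) (f n))"
    and small': "\<forall>h. (\<forall>t\<in>F (Suc n). C0_apply h t = 0) \<longrightarrow> norm ((\<phi> n o\<^sub>L T) h) \<le> \<kappa> * norm h"
    for n t
    using st[THEN spec[of _ n]] by (simp_all add: Q_def F_def \<phi>_def f_def split_beta)
  have small: "norm ((\<phi> n o\<^sub>L T) h) \<le> \<kappa> * norm h"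
    if "\<And>t. t \<in> F (Suc n) \<Longrightarrow> C0_apply h t = 0" for n h
    using small'[of n] that by blast
  have dual: "\<phi> n o\<^sub>L T \<in> dual C0_scale" for n by (rule operators_compose[OF \<phi>(1) T])
  have bound: "norm (\<phi> n o\<^sub>L T) \<le> norm T" for n
    using norm_blinfun_compose[of "\<phi> n" T] mult_right_mono[OF \<phi>(2)[of n], of "norm T"] by simp
  obtain i g where i: "strict_mono (i :: nat \<Rightarrow> nat)" and g: "\<And>k. norm (g k) \<le> 1"
    "\<And>k m t. k \<noteq> m \<Longrightarrow> C0_apply (g k) t \<noteq> 0 \<Longrightarrow> C0_apply (g m) t = 0"
    "\<And>k. c / 2 - 2 * \<kappa> \<le> norm ((\<phi> (i k) o\<^sub>L T) (g k))"
    "\<And>m h. (\<forall>t. C0_apply h t \<noteq> 0 \<longrightarrow> (\<exists>k. k \<noteq> m \<and> C0_apply (g k) t \<noteq> 0)) \<Longrightarrow>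
       norm ((\<phi> (i m) o\<^sub>L T) h) \<le> 2 * \<kappa> * norm h"
    by (rule disjointify[where \<mu> = "\<lambda>n. \<phi> n o\<^sub>L T" and F = F and f = f and b = "c / 2" and \<eta> = \<kappa> and M = "norm T",
          OF lc dual bound F f small large \<kappa>(1)]) (assumption | rule that)+
  define a where "a = (\<lambda>k. of_real \<beta> / (\<phi> (i k)) (T (g k)))"
  have nz: "(\<phi> (i k)) (T (g k)) \<noteq> 0"
    and ge: "\<beta> \<le> norm ((\<phi> (i k)) (T (g k)))" for k
    using g(3)[of k] \<kappa>(3) \<beta>(1) by auto
  have a: "norm (a k) \<le> 1" "a k \<noteq> 0" for k
    using ge[of k] nz[of k] \<beta>(1) by (auto simp: a_def norm_divide divide_le_eq)
  define e where "e = (\<lambda>k. C0_scale (a k) (g k))"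
  have e_iff: "C0_apply (e k) t = 0 \<longleftrightarrow> C0_apply (g k) t = 0" for k t
    using a(2)[of k] by (simp add: e_def C0_apply_scale)
  have e1: "norm (e k) \<le> 1" for k
    using a(1)[of k] g(1)[of k] unfolding e_def normed_space.norm_scale[OF normed_space_C0] by (intro mult_le_one) auto
  have e_disj: "C0_apply (e m) t = 0" if "k \<noteq> m" "C0_apply (e k) t \<noteq> 0" for k m t
    using g(2)[OF that(1)] that(2) unfolding e_iff .
  have e\<beta>: "(\<phi> (i k)) (T (e k)) = of_real \<beta>" for k
    unfolding e_def operators_scale[OF T] operators_scale[OF \<phi>(1)] using nz[of k] by (simp add: a_def)
  obtain V where V: "V \<in> operators c0_scale C0_scale" "norm V \<le> 1"
    "\<And>x t k. C0_apply (e k) t \<noteq> 0 \<Longrightarrow> C0_apply (V x) t = c0_apply x k * C0_apply (e k) t"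
    "\<And>x t. (\<forall>k. C0_apply (e k) t = 0) \<Longrightarrow> C0_apply (V x) t = 0"
    by (rule disjoint_c0_embedding[of e, OF e1 e_disj]) (assumption | rule that)+
  show ?thesis
  proof (rule that[of "\<lambda>k. \<phi> (i k)" V])
    show "range (\<lambda>k. \<phi> (i k)) \<subseteq> dual s \<inter> cball 0 1" using \<phi> by auto
    fix m and x :: "'k c0"
    define h where "h = V x - C0_scale (c0_apply x m) (e m)"
    have ht: "C0_apply h t = (if C0_apply (e m) t = 0 then C0_apply (V x) t else 0)" for t
      using V(3)[of m t x] by (simp add: h_def C0_apply_diff C0_apply_scale)
    have "norm ((\<phi> (i m) o\<^sub>L T) h) \<le> 2 * \<kappa> * norm h"
    proof (rule g(4), intro allI impI)
      fix t assume "C0_apply h t \<noteq> 0"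
      then have t: "C0_apply (e m) t = 0" "C0_apply (V x) t \<noteq> 0" by (auto simp: ht split: if_splits)
      then obtain k where "C0_apply (e k) t \<noteq> 0" using V(4) by blast
      then show "\<exists>k. k \<noteq> m \<and> C0_apply (g k) t \<noteq> 0" using t(1) e_iff by metis
    qed
    also have "\<dots> \<le> \<eta> * norm x"
    proof (rule mult_mono[OF \<kappa>(2)])
      have "norm (C0_apply h t) \<le> norm (V x)" for t
        using norm_C0_apply_le[of "V x" t] by (simp add: ht)
      then have "norm h \<le> norm (V x)" by (rule norm_C0_le)
      also have "\<dots> \<le> norm V * norm x" by (rule norm_blinfun)
      also have "\<dots> \<le> norm x" using mult_right_mono[OF V(2), of "norm x"] by simp
      finally show "norm h \<le> norm x" .
    qed (use \<eta> in auto)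
    finally have "norm ((\<phi> (i m) o\<^sub>L T) h) \<le> \<eta> * norm x" .
    moreover have "(\<phi> (i m) o\<^sub>L T) h =
        (\<phi> (i m)) (T (V x)) - of_real \<beta> * c0_apply x m"
      by (simp add: h_def blinfun.diff_right operators_scale[OF T] operators_scale[OF \<phi>(1)] e\<beta> mult.commute)
    ultimately show "norm ((\<phi> (i m)) (T (V x)) -
      of_real \<beta> * c0_apply x m) \<le> \<eta> * norm x" by simp
  qed (use V in auto)
qed

text \<open>
  The operator that repeats the term \<open>x n\<close> over the block \<open>2 n\<close> and \<open>- x n\<close> over the block \<open>2 n + 1\<close>, where the \<open>n\<close>-th block
  of indices is \<open>{k n..<k (Suc n)}\<close>.
\<close>

lemma alternating_block_operator:
  fixes k :: "nat \<Rightarrow> nat"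
  assumes k: "k 0 = 0" "strict_mono k"
  obtains J :: "'k::real_or_complex c0 \<Rightarrow>\<^sub>L 'k c0" where "J \<in> operators c0_scale c0_scale"
    "\<And>x. norm (J x) \<le> norm x"
    "\<And>x n i. i \<in> {k (2 * n)..<k (Suc (2 * n))} \<Longrightarrow> c0_apply (J x) i = c0_apply x n"
    "\<And>x n i. i \<in> {k (Suc (2 * n))..<k (Suc (Suc (2 * n)))} \<Longrightarrow> c0_apply (J x) i = - c0_apply x n"
proof -
  interpret c0: normed_space "c0_scale :: 'k \<Rightarrow> _" by (rule normed_space_c0)
  define B where "B = (\<lambda>i. LEAST n. i < k (Suc n))"
  have ex: "i < k (Suc i)" for i using seq_suble[OF k(2), of "Suc i"] by simp
  have B: "i < k (Suc (B i))" for i unfolding B_def using ex by (rule LeastI)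
  have B_le: "B i \<le> n" if "i < k (Suc n)" for i n unfolding B_def using that by (rule Least_le)
  have B_eq: "B i = n" if "i \<in> {k n..<k (Suc n)}" for i n
  proof (rule antisym)
    show "B i \<le> n" using that by (intro B_le) simp
    have "k n < k (Suc (B i))" using that B[of i] by simp
    then show "n \<le> B i" using k(2) by (simp add: strict_mono_less less_Suc_eq_le)
  qed
  have B_ge: "N \<le> B i" if "k N \<le> i" for i N
  proof -
    have "k N < k (Suc (B i))" using that B[of i] by simp
    then show ?thesis using k(2) by (simp add: strict_mono_less less_Suc_eq_le)
  qed
  define j where "j = (\<lambda>(x :: 'k c0) i. (if even (B i) then 1 else - 1) * c0_apply x (B i div 2))"
  have norm_j: "norm (j x i) = norm (c0_apply x (B i div 2))" for x i by (simp add: j_def norm_mult)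
  have lim: "j x \<longlonglongrightarrow> 0" for x
  proof (rule LIMSEQ_I)
    fix e :: real assume "e > 0"
    then obtain N where N: "\<forall>n\<ge>N. norm (c0_apply x n - 0) < e"
      using LIMSEQ_D[OF c0_apply_tendsto] by blast
    have "norm (j x i - 0) < e" if "i \<ge> k (2 * N)" for i
      using N B_ge[OF that] by (simp add: norm_j)
    then show "\<exists>no. \<forall>n\<ge>no. norm (j x n - 0) < e" by blast
  qed
  have le: "norm (c0_of (j x)) \<le> 1 * norm x" for x
    by (rule norm_c0_le) (simp add: c0_apply_c0_of[OF lim] norm_j norm_c0_apply_le)
  obtain J where J: "J \<in> operators c0_scale c0_scale" "blinfun_apply J = (\<lambda>x. c0_of (j x))"
  proof (rule c0.operatorsI[OF normed_space_c0, of "\<lambda>x. c0_of (j x)"])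
    show "c0_of (j (x + y)) = c0_of (j x) + c0_of (j y)" for x y
      by (rule c0_eqI) (simp add: c0_apply_add c0_apply_c0_of[OF lim], simp add: j_def c0_apply_add algebra_simps)
    show "c0_of (j (c0_scale a x)) = c0_scale a (c0_of (j x))" for a x
      by (rule c0_eqI) (simp add: c0_apply_scale c0_apply_c0_of[OF lim], simp add: j_def c0_apply_scale)
    show "norm (c0_of (j x)) \<le> 1 * norm x" for x by (rule le)
  qed (rule that)
  show ?thesis
  proof (rule that[OF J(1)])
    show "norm (J x) \<le> norm x" for x using le[of x] by (simp add: J(2))
    show "c0_apply (J x) i = c0_apply x n" if "i \<in> {k (2 * n)..<k (Suc (2 * n))}" for x n i
      using B_eq[OF that] unfolding J(2) c0_apply_c0_of[OF lim] by (simp add: j_def)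
    show "c0_apply (J x) i = - c0_apply x n"
      if "i \<in> {k (Suc (2 * n))..<k (Suc (Suc (2 * n)))}" for x n i
      using B_eq[OF that] unfolding J(2) c0_apply_c0_of[OF lim] by (simp add: j_def)
  qed
qed

text \<open>
  With \<open>E = I - U R\<close>, the operator \<open>W = \<Sum>n. E\<^sup>n U\<close> satisfies \<open>W = U + E W\<close>, so \<open>W R - I\<close> is fixed by \<open>E\<close> and must
  vanish. Linearity of \<open>W\<close> over the scalars follows from the same uniqueness.
\<close>

lemma left_inverse_of_perturbation:
  fixes U :: "'x::real_normed_vector \<Rightarrow>\<^sub>L 'k::real_or_complex c0" and R :: "'k c0 \<Rightarrow>\<^sub>L 'x"
  assumes s: "normed_space s" and U: "U \<in> operators s c0_scale" and R: "R \<in> operators c0_scale s"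
    and \<delta>: "norm (id_blinfun - (U o\<^sub>L R)) \<le> \<delta>" "\<delta> < 1"
  obtains W where "W \<in> operators s c0_scale" "W o\<^sub>L R = id_blinfun" "norm W \<le> norm U / (1 - \<delta>)"
proof -
  define E where "E = id_blinfun - (U o\<^sub>L R)"
  have E: "norm E \<le> \<delta>" "\<delta> \<ge> 0" using \<delta>(1) norm_ge_zero[of E] unfolding E_def by linarith+
  define P where "P = (\<lambda>n. ((\<lambda>A. E o\<^sub>L A) ^^ n) U)"
  have P: "P 0 = U" "P (Suc n) = E o\<^sub>L P n" for n by (simp_all add: P_def)
  have normP: "norm (P n) \<le> norm U * \<delta> ^ n" for n
  proof (induction n)
    case (Suc n)
    have "norm (P (Suc n)) \<le> norm E * norm (P n)" unfolding P(2) by (rule norm_blinfun_compose)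
    also have "\<dots> \<le> \<delta> * (norm U * \<delta> ^ n)" using E Suc by (intro mult_mono) auto
    finally show ?case by (simp add: algebra_simps)
  qed (simp add: P)
  have geo: "summable (\<lambda>n. norm U * \<delta> ^ n)" using E \<delta>(2) by (intro summable_mult summable_geometric) simp
  have sn: "summable (\<lambda>n. norm (P n))"
    by (rule summable_comparison_test'[OF geo, of 0]) (simp add: normP)
  then have sP: "summable P" by (rule summable_norm_cancel)
  define W where "W = suminf P"
  have "W = P 0 + (\<Sum>n. P (Suc n))" unfolding W_def using suminf_split_head[OF sP] by simp
  also have "(\<Sum>n. P (Suc n)) = E o\<^sub>L W"
    unfolding P(2) W_def
    by (rule bounded_linear.suminf[OF bounded_bilinear.bounded_linear_right[OF bounded_bilinear_blinfun_compose] sP, symmetric])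
  finally have W: "W = U + (E o\<^sub>L W)" by (simp add: P)
  have fixpoint: "y = 0" if "y = E y" for y
  proof -
    have "norm y \<le> \<delta> * norm y"
      using norm_blinfun[of E y] mult_right_mono[OF E(1) norm_ge_zero[of y]] that by simp
    then have "(1 - \<delta>) * norm y \<le> 0" by (simp add: algebra_simps)
    then show ?thesis using \<delta>(2) by (simp add: mult_le_0_iff)
  qed
  interpret s: normed_space s by (rule s)
  interpret c0: normed_space "c0_scale :: 'k \<Rightarrow> _" by (rule normed_space_c0)
  have Wx: "W x = U x + E (W x)" for x
    by (subst W) (simp add: blinfun.add_left)
  have E_scale: "E (c0_scale a y) = c0_scale a (E y)" for a y
    by (simp add: E_def blinfun.diff_left operators_scale[OF U] operators_scale[OF R] c0.scale_right_diff_distrib)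
  have W_scale: "W (s a x) = c0_scale a (W x)" for a x
  proof -
    define y where "y = W (s a x) - c0_scale a (W x)"
    have "y = E (W (s a x)) - c0_scale a (E (W x))"
      unfolding y_def by (subst (1 2) Wx) (simp add: operators_scale[OF U] c0.scale_right_distrib)
    also have "\<dots> = E y" by (simp add: y_def blinfun.diff_right E_scale)
    finally have "y = 0" by (rule fixpoint)
    then show ?thesis by (simp add: y_def)
  qed
  show ?thesis
  proof (rule that)
    show "W \<in> operators s c0_scale"
      by (simp add: operators_def Vector_Spaces.linear_iff s.vector_space_axioms c0.vector_space_axioms
          blinfun.add_right W_scale)
    show "W o\<^sub>L R = id_blinfun"
    proof (rule blinfun_eqI)
      fix x
      define y where "y = W (R x) - x"
      have UR: "U (R x) = x - E x"
        by (simp add: E_def blinfun.diff_left)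
      have "y = U (R x) + E (W (R x)) - x"
        unfolding y_def by (subst Wx) simp
      also have "\<dots> = E y" by (simp add: UR y_def blinfun.diff_right)
      finally have "y = 0" by (rule fixpoint)
      then show "(W o\<^sub>L R) x = blinfun_apply id_blinfun x" by (simp add: y_def)
    qed
    have "norm W \<le> (\<Sum>n. norm (P n))" unfolding W_def by (rule summable_norm[OF sn])
    also have "\<dots> \<le> (\<Sum>n. norm U * \<delta> ^ n)" by (rule suminf_le[OF normP sn geo])
    also have "\<dots> = norm U * (1 / (1 - \<delta>))"
      using E \<delta>(2) by (subst suminf_mult) (simp_all add: summable_geometric suminf_geometric)
    finally show "norm W \<le> norm U / (1 - \<delta>)" by simp
  qed
qed

theorem theorem1p6:
  fixes scaleX :: "'k::real_or_complex \<Rightarrow> 'x::banach \<Rightarrow> 'x"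
    and T :: "('p::t2_space, 'k) C0 \<Rightarrow>\<^sub>L 'x"
    and \<epsilon> :: real
  assumes "scattered (UNIV :: 'p set)"
    and "locally_compact_space (euclidean :: 'p topology)"
    and "normed_space scaleX"
    and "\<not> contains_copy_of_l1 scaleX \<or> dual_ball_weak_star_seq_compact scaleX"
    and "T \<in> operators C0_scale scaleX"
    and "T \<notin> compact_operators C0_scale scaleX"
    and "\<epsilon> > 0"
  shows "\<exists>U \<in> operators scaleX c0_scale. \<exists>V \<in> operators c0_scale C0_scale.
           U o\<^sub>L T o\<^sub>L V = id_blinfun \<and>
           norm U * norm V < 2 / essential_norm C0_scale scaleX T + \<epsilon>"
proof -
  note sc = assms(1) and lc = assms(2) and nsX = assms(3) and T = assms(5)
  interpret X: normed_space scaleX by (rule nsX)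
  interpret c0: normed_space "c0_scale :: 'k \<Rightarrow> _" by (rule normed_space_c0)
  define a where "a = essential_norm C0_scale scaleX T"
  have a: "a > 0" unfolding a_def by (rule essential_norm_pos[OF normed_space_C0 nsX T assms(6)])
  \<comment> \<open>The final bound will be \<open>1 / d\<close>: the operators have norms at most \<open>1 / \<beta>\<close> and \<open>1\<close>, and the Neumann series for the
    relative error \<open>\<eta> / \<beta>\<close> adds the factor \<open>1 / (1 - \<eta> / \<beta>) = \<beta> / d\<close>.\<close>
  have "1 / (2 / a + \<epsilon>) < a / 2" using a assms(7) by (simp add: field_simps add_pos_pos)
  then obtain d where d: "1 / (2 / a + \<epsilon>) < d" "d < a / 2" using dense by blast
  have d0: "d > 0" using d(1) a assms(7) by (smt (verit) divide_pos_pos)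
  obtain \<beta> where \<beta>: "d < \<beta>" "\<beta> < a / 2" using dense[OF d(2)] by blast
  define \<eta> where "\<eta> = \<beta> - d"
  have \<eta>: "\<eta> > 0" "\<beta> > 0" using \<beta> d0 by (simp_all add: \<eta>_def)
  obtain \<psi> V0 where \<psi>: "range \<psi> \<subseteq> dual scaleX \<inter> cball 0 1"
    and V0: "V0 \<in> operators c0_scale C0_scale" "norm V0 \<le> 1"
    and diag: "\<And>m x. norm ((\<psi> m) (T (blinfun_apply V0 x)) -
      of_real \<beta> * c0_apply x m) \<le> \<eta> * norm x"
  proof (rule nearly_diagonal_operator[OF sc lc nsX T \<eta>(2) _ \<eta>(1)])
    show "2 * \<beta> < essential_norm C0_scale scaleX T" using \<beta>(2) by (simp add: a_def)
  qed (rule that)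
  obtain \<xi> where \<xi>: "tail_block \<xi> \<psi>" "\<And>x. Cauchy (\<lambda>n. (\<xi> n) x)"
    using assms(4)
  proof
    assume "\<not> contains_copy_of_l1 scaleX"
    then show thesis by (rule no_l1_imp_Cauchy_tail_block[OF nsX _ \<psi>]) (rule that)
  next
    assume "dual_ball_weak_star_seq_compact scaleX"
    then show thesis by (rule seq_compact_imp_Cauchy_tail_block[OF _ \<psi>]) (rule that)
  qed
  obtain k \<phi> where k: "k 0 = 0" "strict_mono (k :: nat \<Rightarrow> nat)"
    and \<phi>: "\<And>n. \<phi> n \<in> convex hull (\<psi> ` {k n..<k (Suc n)})"
    and null: "\<And>x. (\<lambda>n. (\<phi> (2 * n)) x - blinfun_apply (\<phi> (Suc (2 * n))) x) \<longlonglongrightarrow> 0"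
    by (rule Cauchy_tail_block_imp_null_differences[OF \<xi>]) (rule that)
  have \<phi>D: "\<phi> n \<in> dual scaleX" "norm (\<phi> n) \<le> 1" for n
  proof -
    have "convex hull (\<psi> ` {k n..<k (Suc n)}) \<subseteq> dual scaleX \<inter> cball 0 1"
      using \<psi> by (intro hull_minimal X.convex_dual_ball) auto
    then show "\<phi> n \<in> dual scaleX" "norm (\<phi> n) \<le> 1" using \<phi>[of n] by auto
  qed
  obtain J :: "'k c0 \<Rightarrow>\<^sub>L 'k c0" where J: "J \<in> operators c0_scale c0_scale"
    "\<And>x. norm (J x) \<le> norm x"
    "\<And>x n i. i \<in> {k (2 * n)..<k (Suc (2 * n))} \<Longrightarrow> c0_apply (J x) i = c0_apply x n"
    "\<And>x n i. i \<in> {k (Suc (2 * n))..<k (Suc (Suc (2 * n)))} \<Longrightarrow> c0_apply (J x) i = - c0_apply x n"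
    by (rule alternating_block_operator[OF k]) (assumption | rule that)+
  define V where "V = V0 o\<^sub>L J"
  have V: "V \<in> operators c0_scale C0_scale" unfolding V_def by (rule operators_compose[OF V0(1) J(1)])
  have "norm V \<le> 1"
  proof -
    have "norm J \<le> 1" by (rule norm_blinfun_bound) (simp_all add: J(2))
    then have "norm V0 * norm J \<le> 1" using V0(2) by (intro mult_le_one) auto
    then show ?thesis unfolding V_def using norm_blinfun_compose[of V0 J] by linarith
  qed
  \<comment> \<open>For fixed \<open>x\<close> the estimate is a convex condition on the functional, so it passes to convex combinations over a block
    on which \<open>J x\<close> is constant.\<close>
  have block: "norm (blinfun_apply u (T (V x)) - of_real \<beta> * c) \<le> \<eta> * norm x"
    if "u \<in> convex hull (\<psi> ` I)" "\<And>i. i \<in> I \<Longrightarrow> c0_apply (J x) i = c" for u I x c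
    using that(1)
  proof (rule convex_hull_blinfun_dist_le)
    fix v assume "v \<in> \<psi> ` I"
    then obtain i where i: "i \<in> I" "v = \<psi> i" by blast
    have "norm (blinfun_apply v (T (V x)) - of_real \<beta> * c) \<le> \<eta> * norm (J x)"
      using diag[of i "J x"] that(2)[OF i(1)] by (simp add: V_def i(2))
    also have "\<dots> \<le> \<eta> * norm x" using \<eta>(1) J(2) by (intro mult_left_mono) auto
    finally show "norm (blinfun_apply v (T (V x)) - of_real \<beta> * c) \<le> \<eta> * norm x" .
  qed
  define u where "u = (\<lambda>x n. of_real (1 / (2 * \<beta>)) * ((\<phi> (2 * n)) x - blinfun_apply (\<phi> (Suc (2 * n))) x))"
  have u0: "u x \<longlonglongrightarrow> 0" for x
    unfolding u_def using tendsto_mult_right_zero[OF null] .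
  have u_le: "norm (c0_of (u x)) \<le> 1 / \<beta> * norm x" for x
  proof (rule norm_c0_le)
    fix n
    have *: "norm ((\<phi> m) x) \<le> norm x" for m
      using norm_blinfun[of "\<phi> m" x] mult_right_mono[OF \<phi>D(2)[of m] norm_ge_zero[of x]] by simp
    have "norm ((\<phi> (2 * n)) x - blinfun_apply (\<phi> (Suc (2 * n))) x) \<le> 2 * norm x"
      using norm_triangle_ineq4[of "(\<phi> (2 * n)) x" "blinfun_apply (\<phi> (Suc (2 * n))) x"]
        *[of "2 * n"] *[of "Suc (2 * n)"] by linarith
    then have "1 / (2 * \<beta>) * norm ((\<phi> (2 * n)) x - blinfun_apply (\<phi> (Suc (2 * n))) x) \<le>
        1 / (2 * \<beta>) * (2 * norm x)" using \<eta>(2) by (intro mult_left_mono) auto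
    then show "norm (c0_apply (c0_of (u x)) n) \<le> 1 / \<beta> * norm x"
      unfolding c0_apply_c0_of[OF u0] unfolding u_def norm_mult norm_of_real using \<eta>(2) by simp
  qed
  obtain U0 where U0: "U0 \<in> operators scaleX c0_scale" "blinfun_apply U0 = (\<lambda>x. c0_of (u x))"
  proof (rule X.operatorsI[OF normed_space_c0, of "\<lambda>x. c0_of (u x)"])
    show "c0_of (u (x + y)) = c0_of (u x) + c0_of (u y)" for x y
      by (rule c0_eqI) (simp add: c0_apply_add c0_apply_c0_of[OF u0],
          simp add: u_def blinfun.add_right diff_divide_distrib add_divide_distrib)
    show "c0_of (u (scaleX a x)) = c0_scale a (c0_of (u x))" for a x
      by (rule c0_eqI) (simp add: c0_apply_scale c0_apply_c0_of[OF u0],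
          simp add: u_def operators_scale[OF \<phi>D(1)] algebra_simps)
    show "norm (c0_of (u x)) \<le> 1 / \<beta> * norm x" for x by (rule u_le)
  qed (rule that)
  have normU0: "norm U0 \<le> 1 / \<beta>"
    by (rule norm_blinfun_bound) (use \<eta>(2) u_le in \<open>simp_all add: U0(2)\<close>)
  have near: "norm (id_blinfun - (U0 o\<^sub>L (T o\<^sub>L V))) \<le> \<eta> / \<beta>"
  proof (rule norm_blinfun_bound)
    fix x :: "'k c0"
    show "norm (blinfun_apply (id_blinfun - (U0 o\<^sub>L (T o\<^sub>L V))) x) \<le> \<eta> / \<beta> * norm x"
    proof (rule norm_c0_le)
      fix n
      define y where "y = T (V x)"
      define p q where "p = (\<phi> (2 * n)) y - of_real \<beta> * c0_apply x n"
        and "q = blinfun_apply (\<phi> (Suc (2 * n))) y - of_real \<beta> * - c0_apply x n"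
      have p: "norm p \<le> \<eta> * norm x" unfolding p_def y_def by (rule block[OF \<phi> J(3)])
      have q: "norm q \<le> \<eta> * norm x" unfolding q_def y_def by (rule block[OF \<phi> J(4)])
      have "c0_apply (blinfun_apply (id_blinfun - (U0 o\<^sub>L (T o\<^sub>L V))) x) n =
          c0_apply x n - of_real (1 / (2 * \<beta>)) * (p - q + of_real (2 * \<beta>) * c0_apply x n)"
        unfolding blinfun.diff_left U0(2) c0_apply_diff blinfun_apply_blinfun_compose c0_apply_c0_of[OF u0]
        by (simp add: u_def p_def q_def flip: y_def)
      also have "\<dots> = - (of_real (1 / (2 * \<beta>)) * (p - q))"
      proof -
        have "of_real (1 / (2 * \<beta>)) * (of_real (2 * \<beta>) * c0_apply x n) = c0_apply x n"
          using \<eta>(2) by (simp flip: mult.assoc of_real_mult)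
        then show ?thesis by (simp only: distrib_left) simp
      qed
      also have "norm \<dots> = 1 / (2 * \<beta>) * norm (p - q)"
        unfolding norm_minus_cancel norm_mult norm_of_real using \<eta>(2) by simp
      also have "\<dots> \<le> 1 / (2 * \<beta>) * (2 * (\<eta> * norm x))"
        using \<eta>(2) norm_triangle_ineq4[of p q] p q by (intro mult_left_mono) auto
      also have "\<dots> = \<eta> / \<beta> * norm x" by simp
      finally show "norm (c0_apply (blinfun_apply (id_blinfun - (U0 o\<^sub>L (T o\<^sub>L V))) x) n) \<le> \<eta> / \<beta> * norm x" .
    qed
  qed (use \<eta> in simp)
  have "\<eta> / \<beta> < 1" using \<eta> d0 by (simp add: \<eta>_def)
  then obtain U where U: "U \<in> operators scaleX c0_scale" "U o\<^sub>L (T o\<^sub>L V) = id_blinfun"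
    and normU: "norm U \<le> norm U0 / (1 - \<eta> / \<beta>)"
    by (rule left_inverse_of_perturbation[OF nsX U0(1) operators_compose[OF T V] near]) (rule that)
  have "norm U0 / (1 - \<eta> / \<beta>) \<le> (1 / \<beta>) / (1 - \<eta> / \<beta>)"
    using normU0 \<open>\<eta> / \<beta> < 1\<close> by (intro divide_right_mono) auto
  also have "\<dots> = 1 / d" using \<eta> d0 by (simp add: \<eta>_def field_simps)
  finally have "norm U \<le> 1 / d" using normU by linarith
  then have "norm U * norm V \<le> 1 / d * 1" using \<open>norm V \<le> 1\<close> d0 by (intro mult_mono) auto
  also have "\<dots> < 2 / a + \<epsilon>"
    using d(1) d0 a assms(7) by (simp add: field_simps add_pos_pos)
  finally have "norm U * norm V < 2 / essential_norm C0_scale scaleX T + \<epsilon>" by (simp add: a_def)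
  moreover have "U o\<^sub>L T o\<^sub>L V = id_blinfun"
  proof (rule blinfun_eqI)
    fix x
    show "(U o\<^sub>L T o\<^sub>L V) x = blinfun_apply id_blinfun x"
      unfolding U(2)[symmetric] by simp
  qed
  ultimately show ?thesis using U(1) V by blast
qed

end
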